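(* There are a smooth manifold $Z$ and symplectic forms $\omega_\delta$ on $Z$, $\delta\in(0,1]$, such that for each $\delta$ the group $\pi_0\mathrm{Symp}(Z,\omega_\delta)$ surjects onto a free group of rank $N(\delta)$, where $N(\delta)\to\infty$ as $\delta\to 0$.
   Context: $\mathrm{Symp}(Z,\omega)$ is the group of symplectomorphisms of $(Z,\omega)$ with the $C^\infty$ topology, and $\pi_0\mathrm{Symp}(Z,\omega)$ is its group of connected components (the symplectic mapping class group). *)

theory Defs
  imports "HOL-Analysis.Analysis" "HOL-Algebra.Bij" "HOL-Algebra.Coset"
begin

section \<open>Smooth functions on open subsets of Euclidean space\<close>

text \<open>
  Euclidean \<open>n\<close>-space is the library's \<open>Euclidean_space n\<close>, whose points are
  the sequences \<open>x\<close> with \<open>x i = 0\<close> for \<open>i \<ge> n\<close>; this allows the dimension to be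
  existentially quantified.
\<close>

definition partial_deriv :: "nat \<Rightarrow> ((nat \<Rightarrow> real) \<Rightarrow> real) \<Rightarrow> (nat \<Rightarrow> real) \<Rightarrow> real" where
  "partial_deriv i f x = deriv (\<lambda>t. f (x(i := t))) (x i)"

primrec Ck_on :: "nat \<Rightarrow> nat \<Rightarrow> (nat \<Rightarrow> real) set \<Rightarrow> ((nat \<Rightarrow> real) \<Rightarrow> real) \<Rightarrow> bool" where
  "Ck_on n 0 W f \<longleftrightarrow> continuous_map (subtopology (Euclidean_space n) W) euclideanreal f"
| "Ck_on n (Suc k) W f \<longleftrightarrow>
     continuous_map (subtopology (Euclidean_space n) W) euclideanreal f \<and>
     (\<forall>i<n. (\<forall>x\<in>W. (\<lambda>t. f (x(i := t))) field_differentiable at (x i)) \<and>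
            Ck_on n k W (partial_deriv i f))"

text \<open>Only used for \<open>W\<close> open in \<open>Euclidean_space n\<close>.\<close>

definition smooth_on :: "nat \<Rightarrow> (nat \<Rightarrow> real) set \<Rightarrow> ((nat \<Rightarrow> real) \<Rightarrow> real) \<Rightarrow> bool" where
  "smooth_on n W f \<longleftrightarrow> (\<forall>k. Ck_on n k W f)"

definition iter_partial :: "nat list \<Rightarrow> ((nat \<Rightarrow> real) \<Rightarrow> real) \<Rightarrow> (nat \<Rightarrow> real) \<Rightarrow> real" where
  "iter_partial is f = foldr partial_deriv is f"


section \<open>Smooth manifolds and smooth maps\<close>

type_synonym 'a chart = "'a set \<times> ('a \<Rightarrow> nat \<Rightarrow> real)"

record 'a manifold =
  mtop :: "'a topology"
  mdim :: nat
  matlas :: "'a chart set"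

text \<open>
  The atlas need not be maximal. It determines a unique maximal atlas, and none of the notions
  below changes when the atlas is replaced by a compatible one.
\<close>

definition smooth_manifold :: "'a manifold \<Rightarrow> bool" where
  "smooth_manifold M \<longleftrightarrow>
     Hausdorff_space (mtop M) \<and> second_countable (mtop M) \<and>
     (\<Union>(U, \<phi>)\<in>matlas M. U) = topspace (mtop M) \<and>
     (\<forall>(U, \<phi>)\<in>matlas M.
        openin (mtop M) U \<and> openin (Euclidean_space (mdim M)) (\<phi> ` U) \<and>
        homeomorphic_map (subtopology (mtop M) U)
          (subtopology (Euclidean_space (mdim M)) (\<phi> ` U)) \<phi>) \<and>
     (\<forall>(U, \<phi>)\<in>matlas M. \<forall>(V, \<psi>)\<in>matlas M. \<forall>j<mdim M.
        smooth_on (mdim M) (\<phi> ` (U \<inter> V)) (\<lambda>x. \<psi> (inv_into U \<phi> x) j))"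

definition smooth_fun :: "'a manifold \<Rightarrow> ('a \<Rightarrow> real) \<Rightarrow> bool" where
  "smooth_fun M f \<longleftrightarrow>
     (\<forall>(U, \<phi>)\<in>matlas M. smooth_on (mdim M) (\<phi> ` U) (\<lambda>x. f (inv_into U \<phi> x)))"

definition smooth_map :: "'a manifold \<Rightarrow> 'b manifold \<Rightarrow> ('a \<Rightarrow> 'b) \<Rightarrow> bool" where
  "smooth_map M N f \<longleftrightarrow>
     continuous_map (mtop M) (mtop N) f \<and>
     (\<forall>(U, \<phi>)\<in>matlas M. \<forall>(V, \<psi>)\<in>matlas N. \<forall>j<mdim N.
        smooth_on (mdim M) (\<phi> ` {p \<in> U. f p \<in> V}) (\<lambda>x. \<psi> (f (inv_into U \<phi> x)) j))"

definition diffeo :: "'a manifold \<Rightarrow> ('a \<Rightarrow> 'a) \<Rightarrow> bool" where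
  "diffeo M f \<longleftrightarrow>
     bij_betw f (topspace (mtop M)) (topspace (mtop M)) \<and>
     smooth_map M M f \<and> smooth_map M M (inv_into (topspace (mtop M)) f)"


section \<open>Tangent vectors and symplectic forms\<close>

type_synonym 'a tvec = "('a \<Rightarrow> real) \<Rightarrow> real"

text \<open>
  Tangent vectors are derivations of the algebra of smooth functions, made total by the value \<open>0\<close>
  on functions that are not smooth. The Leibniz rule forces a derivation to ignore
  the values of its argument outside \<open>topspace (mtop M)\<close>.
\<close>

definition tangent_space :: "'a manifold \<Rightarrow> 'a \<Rightarrow> 'a tvec set" where
  "tangent_space M p = {v.
     (\<forall>f. \<not> smooth_fun M f \<longrightarrow> v f = 0) \<and>
     (\<forall>f g a. smooth_fun M f \<and> smooth_fun M g \<longrightarrow> v (\<lambda>q. a * f q + g q) = a * v f + v g) \<and>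
     (\<forall>f g. smooth_fun M f \<and> smooth_fun M g \<longrightarrow> v (\<lambda>q. f q * g q) = f p * v g + g p * v f)}"

definition pushforward :: "'a manifold \<Rightarrow> 'b manifold \<Rightarrow> ('a \<Rightarrow> 'b) \<Rightarrow> 'a tvec \<Rightarrow> 'b tvec" where
  "pushforward M N F v = (\<lambda>f. if smooth_fun N f then v (\<lambda>q. f (F q)) else 0)"

definition coord_vec :: "'a manifold \<Rightarrow> 'a chart \<Rightarrow> nat \<Rightarrow> 'a \<Rightarrow> 'a tvec" where
  "coord_vec M c i p = (\<lambda>f. if smooth_fun M f
     then partial_deriv i (\<lambda>x. f (inv_into (fst c) (snd c) x)) (snd c p) else 0)"

type_synonym 'a form2 = "'a \<Rightarrow> 'a tvec \<Rightarrow> 'a tvec \<Rightarrow> real"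

definition form_coeff ::
    "'a manifold \<Rightarrow> 'a form2 \<Rightarrow> 'a chart \<Rightarrow> nat \<Rightarrow> nat \<Rightarrow> (nat \<Rightarrow> real) \<Rightarrow> real" where
  "form_coeff M \<omega> c i j x =
     (let p = inv_into (fst c) (snd c) x in \<omega> p (coord_vec M c i p) (coord_vec M c j p))"

text \<open>
  Only the values \<open>\<omega> p u v\<close> with \<open>p\<close> a point of \<open>M\<close> and \<open>u\<close>, \<open>v\<close> tangent vectors at \<open>p\<close> matter.
\<close>

definition two_form :: "'a manifold \<Rightarrow> 'a form2 \<Rightarrow> bool" where
  "two_form M \<omega> \<longleftrightarrow>
     (\<forall>p\<in>topspace (mtop M). \<forall>u\<in>tangent_space M p. \<forall>v\<in>tangent_space M p.
        \<omega> p u u = 0 \<and>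
        (\<forall>w\<in>tangent_space M p. \<forall>a.
           \<omega> p (\<lambda>f. a * u f + v f) w = a * \<omega> p u w + \<omega> p v w \<and>
           \<omega> p w (\<lambda>f. a * u f + v f) = a * \<omega> p w u + \<omega> p w v)) \<and>
     (\<forall>c\<in>matlas M. \<forall>i<mdim M. \<forall>j<mdim M.
        smooth_on (mdim M) (snd c ` fst c) (form_coeff M \<omega> c i j))"

text \<open>The coefficient of \<open>dx\<^sub>i \<and> dx\<^sub>j \<and> dx\<^sub>k\<close> (\<open>i < j < k\<close>) in the exterior derivative.\<close>

definition ext_deriv_coeff ::
    "'a manifold \<Rightarrow> 'a form2 \<Rightarrow> 'a chart \<Rightarrow> nat \<Rightarrow> nat \<Rightarrow> nat \<Rightarrow> (nat \<Rightarrow> real) \<Rightarrow> real" where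
  "ext_deriv_coeff M \<omega> c i j k x =
     partial_deriv i (form_coeff M \<omega> c j k) x
     - partial_deriv j (form_coeff M \<omega> c i k) x
     + partial_deriv k (form_coeff M \<omega> c i j) x"

definition closed_form :: "'a manifold \<Rightarrow> 'a form2 \<Rightarrow> bool" where
  "closed_form M \<omega> \<longleftrightarrow>
     (\<forall>c\<in>matlas M. \<forall>x\<in>snd c ` fst c. \<forall>i j k. i < j \<and> j < k \<and> k < mdim M \<longrightarrow>
        ext_deriv_coeff M \<omega> c i j k x = 0)"

definition nondegenerate_form :: "'a manifold \<Rightarrow> 'a form2 \<Rightarrow> bool" where
  "nondegenerate_form M \<omega> \<longleftrightarrow>
     (\<forall>p\<in>topspace (mtop M). \<forall>u\<in>tangent_space M p.
        (\<forall>v\<in>tangent_space M p. \<omega> p u v = 0) \<longrightarrow> u = (\<lambda>f. 0))"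

definition symplectic_form :: "'a manifold \<Rightarrow> 'a form2 \<Rightarrow> bool" where
  "symplectic_form M \<omega> \<longleftrightarrow> two_form M \<omega> \<and> closed_form M \<omega> \<and> nondegenerate_form M \<omega>"

definition symplectomorphism :: "'a manifold \<Rightarrow> 'a form2 \<Rightarrow> ('a \<Rightarrow> 'a) \<Rightarrow> bool" where
  "symplectomorphism M \<omega> F \<longleftrightarrow> diffeo M F \<and>
     (\<forall>p\<in>topspace (mtop M). \<forall>u\<in>tangent_space M p. \<forall>v\<in>tangent_space M p.
        \<omega> (F p) (pushforward M M F u) (pushforward M M F v) = \<omega> p u v)"


section \<open>The topological group of symplectomorphisms and its group of components\<close>

text \<open>
  As in \<open>BijGroup\<close>, maps are extensional: equal to \<open>undefined\<close> outside the manifold.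
\<close>

definition Symp :: "'a manifold \<Rightarrow> 'a form2 \<Rightarrow> ('a \<Rightarrow> 'a) monoid" where
  "Symp M \<omega> = BijGroup (topspace (mtop M))
     \<lparr>carrier := {F \<in> extensional (topspace (mtop M)). symplectomorphism M \<omega> F}\<rparr>"

definition smooth_maps :: "'a manifold \<Rightarrow> 'b manifold \<Rightarrow> ('a \<Rightarrow> 'b) set" where
  "smooth_maps M N = {f \<in> extensional (topspace (mtop M)). smooth_map M N f}"

text \<open>
  Subbasic neighbourhoods of \<open>f\<close>: the maps \<open>g\<close> whose expression in the charts \<open>c\<close>, \<open>d\<close> is
  \<open>\<epsilon>\<close>-close to that of \<open>f\<close> on the compact set \<open>K\<close>, together with all partial derivatives
  of order at most \<open>k\<close>.
\<close>

definition Cinf_nbhd :: "'a manifold \<Rightarrow> 'b manifold \<Rightarrow> ('a \<Rightarrow> 'b) \<Rightarrow> 'a chart \<Rightarrow> 'b chart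
    \<Rightarrow> 'a set \<Rightarrow> nat \<Rightarrow> real \<Rightarrow> ('a \<Rightarrow> 'b) set" where
  "Cinf_nbhd M N f c d K k \<epsilon> = {g \<in> smooth_maps M N. g ` K \<subseteq> fst d \<and>
     (\<forall>x\<in>snd c ` K. \<forall>j<mdim N. \<forall>is. set is \<subseteq> {..<mdim M} \<and> length is \<le> k \<longrightarrow>
        \<bar>iter_partial is (\<lambda>y. snd d (g (inv_into (fst c) (snd c) y)) j) x
         - iter_partial is (\<lambda>y. snd d (f (inv_into (fst c) (snd c) y)) j) x\<bar> < \<epsilon>)}"

text \<open>
  The (weak) \<open>C\<^sup>\<infinity>\<close> topology of uniform convergence of all derivatives on compact sets. The whole
  space is listed separately only to cover the empty manifold with empty atlas.
\<close>

definition Cinf_topology :: "'a manifold \<Rightarrow> 'b manifold \<Rightarrow> ('a \<Rightarrow> 'b) topology" where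
  "Cinf_topology M N = topology_generated_by (insert (smooth_maps M N)
     {Cinf_nbhd M N f c d K k \<epsilon> | f c d K k \<epsilon>.
        f \<in> smooth_maps M N \<and> c \<in> matlas M \<and> d \<in> matlas N \<and>
        compactin (mtop M) K \<and> K \<subseteq> fst c \<and> f ` K \<subseteq> fst d \<and> 0 < \<epsilon>})"

definition Symp_topology :: "'a manifold \<Rightarrow> 'a form2 \<Rightarrow> ('a \<Rightarrow> 'a) topology" where
  "Symp_topology M \<omega> = subtopology (Cinf_topology M M) (carrier (Symp M \<omega>))"

text \<open>
  For a topological group, given as a group \<open>G\<close> and a topology \<open>T\<close> on its carrier, the components
  are the cosets of the identity component, and the product set of two components is the
  component containing the products.
\<close>

definition pi0_group :: "('a, 'b) monoid_scheme \<Rightarrow> 'a topology \<Rightarrow> 'a set monoid" where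
  "pi0_group G T =
     \<lparr>carrier = connected_components_of T,
      mult = (\<lambda>A B. A <#>\<^bsub>G\<^esub> B),
      one = connected_component_of_set T \<one>\<^bsub>G\<^esub>\<rparr>"

definition pi0_Symp :: "'a manifold \<Rightarrow> 'a form2 \<Rightarrow> ('a \<Rightarrow> 'a) set monoid" where
  "pi0_Symp M \<omega> = pi0_group (Symp M \<omega>) (Symp_topology M \<omega>)"


section \<open>Free groups\<close>

text \<open>
  The free group on \<open>S\<close> as reduced words; the letter \<open>(False, s)\<close> is the inverse of \<open>(True, s)\<close>.
\<close>

definition letter_inv :: "bool \<times> 'a \<Rightarrow> bool \<times> 'a" where
  "letter_inv x = (\<not> fst x, snd x)"

definition reduced_word :: "(bool \<times> 'a) list \<Rightarrow> bool" where
  "reduced_word w \<longleftrightarrow> successively (\<lambda>x y. y \<noteq> letter_inv x) w"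

fun letter_mult :: "bool \<times> 'a \<Rightarrow> (bool \<times> 'a) list \<Rightarrow> (bool \<times> 'a) list" where
  "letter_mult x [] = [x]"
| "letter_mult x (y # w) = (if y = letter_inv x then w else x # y # w)"

definition free_group :: "'a set \<Rightarrow> (bool \<times> 'a) list monoid" where
  "free_group S =
     \<lparr>carrier = {w. reduced_word w \<and> snd ` set w \<subseteq> S},
      mult = foldr letter_mult,
      one = []\<rparr>"

lemma letter_inv_letter_inv [simp]: "letter_inv (letter_inv x) = x"
  by (simp add: letter_inv_def)

lemma letter_inv_neq [simp]: "letter_inv x \<noteq> x"
  by (cases x) (simp add: letter_inv_def)

lemma reduced_word_Cons:
  "reduced_word (x # w) \<longleftrightarrow> reduced_word w \<and> (w = [] \<or> hd w \<noteq> letter_inv x)"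
  by (cases w) (auto simp: reduced_word_def)

lemma reduced_letter_mult: "reduced_word w \<Longrightarrow> reduced_word (letter_mult x w)"
  by (cases w) (auto simp: reduced_word_def successively_Cons)

lemma reduced_foldr: "reduced_word w \<Longrightarrow> reduced_word (foldr letter_mult u w)"
  by (induction u) (auto simp: reduced_letter_mult)

lemma letter_mult_cancel:
  "reduced_word w \<Longrightarrow> letter_mult x (letter_mult (letter_inv x) w) = w"
proof (cases w)
  case (Cons y v)
  assume "reduced_word w"
  with Cons show ?thesis by (cases v) (auto simp: reduced_word_Cons)
qed simp

lemma foldr_letter_mult:
  "reduced_word w \<Longrightarrow> foldr letter_mult (letter_mult x u) w = letter_mult x (foldr letter_mult u w)"
  by (cases u) (auto simp: letter_mult_cancel reduced_foldr)

lemma foldr_letter_mult_assoc: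
  "reduced_word w \<Longrightarrow>
     foldr letter_mult (foldr letter_mult u v) w = foldr letter_mult u (foldr letter_mult v w)"
  by (induction u) (auto simp: foldr_letter_mult)

lemma foldr_letter_mult_Nil: "reduced_word u \<Longrightarrow> foldr letter_mult u [] = u"
proof (induction u)
  case (Cons x u)
  then show ?case by (cases u) (auto simp: reduced_word_Cons)
qed simp

lemma set_letter_mult: "set (letter_mult x w) \<subseteq> insert x (set w)"
  by (cases w) auto

lemma set_foldr_letter_mult: "set (foldr letter_mult u w) \<subseteq> set u \<union> set w"
proof (induction u)
  case (Cons x u)
  then show ?case using set_letter_mult[of x "foldr letter_mult u w"] by auto
qed simp

lemma foldr_letter_mult_inverse: "foldr letter_mult (map letter_inv (rev u)) u = []"
  by (induction u) auto

lemma group_free_group: "group (free_group S)"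
proof (rule groupI)
  fix u v assume "u \<in> carrier (free_group S)" "v \<in> carrier (free_group S)"
  moreover from this have "snd ` set (foldr letter_mult u v) \<subseteq> S"
    using image_mono[OF set_foldr_letter_mult[of u v], of snd]
    by (simp add: free_group_def image_Un) (meson Un_least order_trans)
  ultimately show "u \<otimes>\<^bsub>free_group S\<^esub> v \<in> carrier (free_group S)"
    by (simp add: free_group_def reduced_foldr)
next
  fix u assume u: "u \<in> carrier (free_group S)"
  define v where "v = foldr letter_mult (map letter_inv (rev u)) []"
  have "set v \<subseteq> letter_inv ` set u"
    using set_foldr_letter_mult[of "map letter_inv (rev u)" "[]"] by (auto simp: v_def)
  then have "snd ` set v \<subseteq> snd ` set u"
    by (force simp: letter_inv_def)
  moreover have "reduced_word v"
    unfolding v_def by (rule reduced_foldr) (simp add: reduced_word_def)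
  ultimately have "v \<in> carrier (free_group S)"
    using u by (auto simp: free_group_def)
  moreover have "v \<otimes>\<^bsub>free_group S\<^esub> u = \<one>\<^bsub>free_group S\<^esub>"
    using u foldr_letter_mult_assoc[of u "map letter_inv (rev u)" "[]"]
    by (simp add: free_group_def v_def foldr_letter_mult_inverse)
  ultimately show "\<exists>v\<in>carrier (free_group S). v \<otimes>\<^bsub>free_group S\<^esub> u = \<one>\<^bsub>free_group S\<^esub>"
    by blast
qed (auto simp: free_group_def foldr_letter_mult_assoc reduced_word_def[of "[]"])

end

(*
  Take Z = (C - {0})^4, with coordinates z_i. A skew form b on Z^4 with real values gives the
  symplectic form sum b_ij (dp_i dp_j + dq_i dq_j), where log z_i = p_i + i q_i. A symplectomorphism
  acts on H_1(Z) = Z^4 by a matrix A, which does not change along paths of symplectomorphisms; its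
  action on the periods of the form over 2-tori shows that A preserves b. Conversely, every A that
  preserves b is realized by the monomial map z |-> z^A, so the symplectic mapping class group
  surjects onto the stabilizer of b.

  For b = e_01 + sqrt 2 (n e_03 - e_12) + sqrt 3 e_23 the stabilizer is the congruence group
  Gamma_0(n): as 1, sqrt 2, sqrt 3 are independent over the rationals, all three integral parts are
  preserved, which makes A block diagonal with the upper block a in SL_2 and the lower block
  determined by a. Let n = k^2 with 4 | k. Modulo its centre, Gamma_0(4) is free on the matrices
  s = (1 1; 0 1) and t = (1 0; 4 1). In its action on the cosets of Gamma_0(n) the generator s has
  k fixed points in the orbit of the base point. Reading an element of Gamma_0(n) as a closed path
  in the Schreier graph of the cosets, and recording only its passages through the k loops labelled
  s, gives a surjection onto the free group of rank k.
*)
theory Submission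
  imports Defs
begin

section \<open>A free subgroup of rank two in the modular group\<close>

text \<open>The stabilizer of one integral symplectic form is a group like Sp_4(Z), which has
  property (T) and hence no free quotient. Coefficients independent over the rationals cut it down
  to the common stabilizer of three integral forms, which is virtually free. The parts e_01 and e_23
  make the two blocks unimodular; the mixed part ties the blocks by conjugation with diag(1, n), and
  the integrality of the conjugate is the congruence condition.

  The level is a square because t^-m s t^m has lower left entry - (4 m)^2: with 4 m = k j it lies in
  Gamma_0(k^2) for every j, which gives k loops. A loop of a graph is a free factor of the
  fundamental group, so a homomorphism arises by erasing all other edges.

  Z is open in R^8, so the identity serves as its only chart. The functions p_i = log |z_i| are
  single-valued on Z, so only the part dq_i dq_j has periods, while the part dp_i dp_j makes the
  form nondegenerate. The action on H_1 is read off from lifts to the universal cover C^4, where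
  symplectomorphisms become maps that are equivariant under a lattice.\<close>

type_synonym mat2 = "int \<times> int \<times> int \<times> int"

fun mul2 :: "mat2 \<Rightarrow> mat2 \<Rightarrow> mat2" where
  "mul2 (a, b, c, d) (a', b', c', d') =
     (a * a' + b * c', a * b' + b * d', c * a' + d * c', c * b' + d * d')"

fun neg2 :: "mat2 \<Rightarrow> mat2" where
  "neg2 (a, b, c, d) = (- a, - b, - c, - d)"

text \<open>The second component of a letter chooses the generator (\<open>False\<close>: s,
  \<open>True\<close>: t), the first its sign, in accordance with \<open>letter_inv\<close>.
  Conjugation by diag(2, 1) turns s and t into Sanov's free generators (1 2; 0 1) and (1 0; 2
  1).\<close>

fun sanov :: "bool \<times> bool \<Rightarrow> mat2" where
  "sanov (e, False) = (1, if e then 1 else - 1, 0, 1)"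
| "sanov (e, True) = (1, 0, if e then 4 else - 4, 1)"

definition word_mat :: "(bool \<times> bool) list \<Rightarrow> mat2" where
  "word_mat w = foldr (\<lambda>x. mul2 (sanov x)) w (1, 0, 0, 1)"

lemma word_mat_Nil [simp]: "word_mat [] = (1, 0, 0, 1)"
  by (simp add: word_mat_def)

lemma word_mat_Cons [simp]: "word_mat (x # w) = mul2 (sanov x) (word_mat w)"
  by (simp add: word_mat_def)

lemma mul2_assoc: "mul2 (mul2 A B) C = mul2 A (mul2 B C)"
  by (cases A; cases B; cases C) (simp add: algebra_simps)

lemma mul2_one [simp]: "mul2 (1, 0, 0, 1) A = A" "mul2 A (1, 0, 0, 1) = A"
  by (cases A; simp)+

lemma mul2_neg2 [simp]: "mul2 (neg2 A) B = neg2 (mul2 A B)" "mul2 A (neg2 B) = neg2 (mul2 A B)"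
  by (cases A; cases B; simp)+

lemma neg2_neg2 [simp]: "neg2 (neg2 A) = A"
  by (cases A) simp

lemma sanov_cancel: "mul2 (sanov x) (mul2 (sanov (letter_inv x)) A) = A"
proof -
  have "mul2 (sanov x) (sanov (letter_inv x)) = (1, 0, 0, 1)"
    by (cases x rule: sanov.cases) (auto simp: letter_inv_def)
  then show ?thesis
    by (metis mul2_assoc mul2_one(1))
qed

lemma word_mat_letter_mult: "word_mat (letter_mult x w) = mul2 (sanov x) (word_mat w)"
  by (cases w) (auto simp: sanov_cancel)

lemma word_mat_mult: "word_mat (foldr letter_mult u w) = mul2 (word_mat u) (word_mat w)"
  by (induction u) (auto simp: word_mat_letter_mult mul2_assoc)

text \<open>A reduced word in s alone repeats one letter, so the exponents add up without
  cancellation. Such words are treated apart from ping-pong because s fixes the column (1, 0) from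
  which the game starts.\<close>

lemma word_mat_shear:
  assumes "reduced_word w" "\<forall>x\<in>set w. \<not> snd x" "w \<noteq> []"
  shows "\<exists>q. word_mat w = (1, q, 0, 1) \<and> (if fst (hd w) then q > 0 else q < 0)"
  using assms
proof (induction w)
  case (Cons x w)
  obtain e where x: "x = (e, False)"
    using Cons.prems by (cases x) auto
  show ?case
  proof (cases "w = []")
    case True
    then show ?thesis by (auto simp: x)
  next
    case False
    have "reduced_word w" "hd w \<noteq> letter_inv x" "\<not> snd (hd w)"
      using Cons.prems False by (auto simp: reduced_word_Cons)
    then have "fst (hd w) = e"
      by (cases "hd w") (simp add: letter_inv_def x)
    moreover obtain q where "word_mat w = (1, q, 0, 1)" "if fst (hd w) then q > 0 else q < 0"
      using Cons.IH \<open>reduced_word w\<close> Cons.prems(2) False by (meson list.set_intros(2))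
    ultimately show ?thesis
      by (cases e) (auto simp: x)
  qed
qed simp

text \<open>
  Ping-pong: \<open>ping x p r\<close> describes the region that contains the first column \<open>(p, r)\<close> of the
  matrix of a reduced word with first letter \<open>x\<close>.
\<close>

definition ping :: "bool \<times> bool \<Rightarrow> int \<Rightarrow> int \<Rightarrow> bool" where
  "ping x p r \<longleftrightarrow> (let r' = if fst x then r else - r in
     if snd x then 0 < 2 * p \<and> 2 * p < r' \<or> r' < 2 * p \<and> 2 * p < 0
     else 0 < r' \<and> r' < 2 * p \<or> 2 * p < r' \<and> r' < 0)"

text \<open>The lines r = 2 p and r = - 2 p separate the regions. If |r| < 2 |p|, adding 4 p or - 4
  p to r makes |r| exceed 2 |p|; if 2 |p| < |r|, adding r or - r to p makes 2 |p| exceed |r|; the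
  sign is that of the summand. Repeating a letter stays in its region, and an inverse letter is
  excluded.\<close>

lemma ping_step:
  assumes "ping y p r" "y \<noteq> letter_inv x" "mul2 (sanov x) (p, q, r, s) = (p', q', r', s')"
  shows "ping x p' r'"
proof -
  obtain e f where x: "x = (e, f)" by force
  obtain e' f' where y: "y = (e', f')" by force
  show ?thesis
    apply (insert assms, unfold x y)
    apply (cases e; cases f; cases e'; cases f')
    apply (simp_all add: ping_def letter_inv_def Let_def)
    apply (smt (verit))+
    done
qed

text \<open>The induction starts at the rightmost t or inverse of t: to its right stand only powers
  of s, so the column is still (1, 0) and becomes (1, 4) or (1, - 4).\<close>

lemma word_mat_ping:
  assumes "reduced_word w" "\<exists>x\<in>set w. snd x"
  shows "\<exists>p q r s. word_mat w = (p, q, r, s) \<and> ping (hd w) p r"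
  using assms
proof (induction w)
  case (Cons x w)
  show ?case
  proof (cases "\<exists>x\<in>set w. snd x")
    case True
    then obtain p q r s where IH: "word_mat w = (p, q, r, s)" "ping (hd w) p r"
      using Cons by (auto simp: reduced_word_Cons)
    have "hd w \<noteq> letter_inv x"
      using Cons.prems True by (cases w) (auto simp: reduced_word_Cons)
    show ?thesis
    proof -
      obtain p' q' r' s' where M': "mul2 (sanov x) (p, q, r, s) = (p', q', r', s')"
        by (metis prod_cases4)
      show ?thesis
        using ping_step[OF IH(2) \<open>hd w \<noteq> letter_inv x\<close> M'] by (simp add: IH(1) M')
    qed
  next
    case False
    then have x: "snd x" using Cons.prems by auto
    show ?thesis
    proof (cases "w = []")
      case True
      then show ?thesis
        using x by (cases x rule: sanov.cases) (auto simp: ping_def)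
    next
      case False
      then obtain q where "word_mat w = (1, q, 0, 1)"
        using word_mat_shear[of w] Cons.prems \<open>\<not> (\<exists>x\<in>set w. snd x)\<close>
        by (auto simp: reduced_word_Cons)
      then show ?thesis
        using x by (cases x rule: sanov.cases) (auto simp: ping_def)
    qed
  qed
qed simp

text \<open>In every region of \<open>ping\<close> the entry r is nonzero, and a nontrivial power of
  s has a nonzero upper right entry. Excluding -1 as well makes s and t free modulo the
  centre.\<close>

lemma word_mat_eq_one:
  assumes "reduced_word w" "word_mat w = (1, 0, 0, 1) \<or> word_mat w = neg2 (1, 0, 0, 1)"
  shows "w = []"
proof (cases "\<exists>x\<in>set w. snd x")
  case True
  with word_mat_ping[OF assms(1)] assms(2) show ?thesis
    by (auto simp: ping_def Let_def split: if_splits)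
next
  case False
  with word_mat_shear[OF assms(1)] assms(2) show ?thesis
    by (cases "w = []") (auto split: if_splits)
qed

lemma word_mat_inj:
  assumes "reduced_word u" "reduced_word v" "word_mat u = word_mat v \<or> word_mat u = neg2 (word_mat v)"
  shows "u = v"
proof -
  define F where "F = free_group (UNIV :: bool set)"
  interpret F: group F unfolding F_def by (rule group_free_group)
  have car: "w \<in> carrier F \<longleftrightarrow> reduced_word w" for w
    by (auto simp: F_def free_group_def)
  have mult: "x \<otimes>\<^bsub>F\<^esub> y = foldr letter_mult x y" for x y
    by (simp add: F_def free_group_def)
  have one: "\<one>\<^bsub>F\<^esub> = []"
    by (simp add: F_def free_group_def)
  have uv: "u \<in> carrier F" "v \<in> carrier F"
    using assms by (auto simp: car)
  define i where "i = inv\<^bsub>F\<^esub> v"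
  have i: "i \<in> carrier F" unfolding i_def using uv by auto
  have "mul2 (word_mat i) (word_mat v) = (1, 0, 0, 1)"
    using F.l_inv[OF uv(2)] word_mat_mult[of i v] by (simp add: mult one i_def[symmetric])
  then have "word_mat (i \<otimes>\<^bsub>F\<^esub> u) = (1, 0, 0, 1) \<or> word_mat (i \<otimes>\<^bsub>F\<^esub> u) = neg2 (1, 0, 0, 1)"
    using assms(3) by (auto simp: mult word_mat_mult simp del: neg2.simps)
  moreover have "reduced_word (i \<otimes>\<^bsub>F\<^esub> u)"
    using F.m_closed[OF i uv(1)] car by blast
  ultimately have "i \<otimes>\<^bsub>F\<^esub> u = \<one>\<^bsub>F\<^esub>"
    using word_mat_eq_one one by metis
  then show ?thesis
    using uv unfolding i_def by (metis F.inv_equality F.inv_inv F.inv_closed)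
qed

text \<open>Euclid's algorithm on the first column: if |r| < 2 |p|, replacing p by p - r or p + r
  shortens it, and if 2 |p| < |r|, a step by 4 p shortens r. Equality cannot occur, as p is odd by
  the determinant and 4 divides r. The sign enters because the algorithm may end in the column (- 1,
  0).\<close>

lemma word_mat_surj:
  assumes "p * s - q * r = 1" "4 dvd r"
  shows "\<exists>w. reduced_word w \<and> (word_mat w = (p, q, r, s) \<or> word_mat w = neg2 (p, q, r, s))"
  using assms
proof (induction "nat (2 * \<bar>p\<bar> + \<bar>r\<bar>)" arbitrary: p q r s rule: less_induct)
  case less
  have step: ?case if M': "mul2 (sanov x) (p, q, r, s) = (p', q', r', s')"
    and smaller: "2 * \<bar>p'\<bar> + \<bar>r'\<bar> < 2 * \<bar>p\<bar> + \<bar>r\<bar>"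
    for x p' q' r' s'
  proof -
    have det: "p' * s' - q' * r' = 1"
      using less.prems(1) M' by (cases x rule: sanov.cases) (auto simp: algebra_simps split: if_splits)
    have "4 dvd r'"
      using less.prems(2) M' by (cases x rule: sanov.cases) (auto split: if_splits)
    moreover have "nat (2 * \<bar>p'\<bar> + \<bar>r'\<bar>) < nat (2 * \<bar>p\<bar> + \<bar>r\<bar>)"
      using smaller by linarith
    ultimately obtain w where w: "reduced_word w"
      "word_mat w = (p', q', r', s') \<or> word_mat w = neg2 (p', q', r', s')"
      using less.hyps det by blast
    have "mul2 (sanov (letter_inv x)) (p', q', r', s') = (p, q, r, s)"
      using sanov_cancel[of "letter_inv x" "(p, q, r, s)"] M' by simp
    with w show ?thesis
      by (intro exI[of _ "letter_mult (letter_inv x) w"])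
        (auto simp: reduced_letter_mult word_mat_letter_mult simp del: neg2.simps)
  qed
  show ?case
  proof (cases "r = 0")
    case True
    then have ps: "p * s = 1" using less.prems by simp
    then have "p = 1 \<and> s = 1 \<or> p = - 1 \<and> s = - 1"
      using zmult_eq_1_iff by blast
    \<comment> \<open>For r = 0 the matrix is p times a shear with exponent q / p = p * q.\<close>
    moreover define c where "c = p * q"
    have rep: "word_mat (replicate n (e, False)) = (1, if e then int n else - int n, 0, 1)" for n e
      by (induction n) auto
    have red: "reduced_word (replicate n x)" for n and x :: "bool \<times> bool"
      by (induction n) (auto simp: reduced_word_Cons reduced_word_def[of "[]"] letter_inv_def prod_eq_iff)
    ultimately show ?thesis
      by (intro exI[of _ "replicate (nat \<bar>c\<bar>) (c > 0, False)"]) (auto simp: red rep True c_def)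
  next
    case False
    have "odd p"
    proof
      assume "even p"
      moreover have "even r"
        using less.prems(2) by (meson dvd_trans even_numeral)
      ultimately have "even (p * s - q * r)"
        by simp
      then show False
        using less.prems(1) by simp
    qed
    then have "p \<noteq> 0" by auto
    from \<open>odd p\<close> have "2 * \<bar>p\<bar> \<noteq> \<bar>r\<bar>"
      using less.prems(2) by (auto elim!: oddE dvdE) presburger
    then consider "\<bar>r\<bar> < 2 * \<bar>p\<bar>" | "2 * \<bar>p\<bar> < \<bar>r\<bar>" by linarith
    then show ?thesis
    proof cases
      case 1
      show ?thesis
      proof (cases "p > 0 \<longleftrightarrow> r > 0")
        case True
        show ?thesis
          by (rule step[of "(False, False)"]) (use True 1 False in auto)
      next
        case pr: False
        show ?thesis
          by (rule step[of "(True, False)"]) (use pr 1 False in auto)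
      qed
    next
      case 2
      show ?thesis
      proof (cases "p > 0 \<longleftrightarrow> r > 0")
        case True
        show ?thesis
          by (rule step[of "(False, True)"]) (use True 2 \<open>p \<noteq> 0\<close> in auto)
      next
        case pr: False
        show ?thesis
          by (rule step[of "(True, True)"]) (use pr 2 \<open>p \<noteq> 0\<close> in auto)
      qed
    qed
  qed
qed

section \<open>Free quotients of congruence subgroups\<close>

fun second_row :: "mat2 \<Rightarrow> int \<times> int" where
  "second_row (p, q, r, s) = (r, s)"

text \<open>
  The second row \<open>(r, s)\<close> of \<open>A \<in> SL\<^sub>2\<close> with \<open>k dvd r\<close> shows that \<open>A\<close> lies in the coset of
  \<open>(1 0; k j 1)\<close> modulo \<open>Gamma0 (k\<^sup>2)\<close>, where \<open>j = (r / k) s\<close> modulo \<open>k\<close>; these \<open>k\<close> cosets are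
  fixed by the generator \<open>(1 1; 0 1)\<close>.
\<close>

definition cusp_letter :: "int \<Rightarrow> bool \<times> bool \<Rightarrow> int \<times> int \<Rightarrow> (bool \<times> nat) list \<Rightarrow> (bool \<times> nat) list" where
  "cusp_letter k x v y =
     (if \<not> snd x \<and> k dvd fst v then letter_mult (fst x, nat ((fst v div k * snd v) mod k)) y else y)"

text \<open>A letter is read at the coset reached by the suffix behind it, so the path in the
  Schreier graph is traversed from the right end of the word.\<close>

primrec cusp_word :: "int \<Rightarrow> (bool \<times> bool) list \<Rightarrow> (bool \<times> nat) list" where
  "cusp_word k [] = []"
| "cusp_word k (x # w) = cusp_letter k x (second_row (word_mat w)) (cusp_word k w)"

definition Gamma0 :: "int \<Rightarrow> mat2 set" where
  "Gamma0 n = {(p, q, r, s). p * s - q * r = 1 \<and> n dvd r}"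

lemma reduced_cusp_word: "reduced_word (cusp_word k w)"
  by (induction w) (auto simp: cusp_letter_def reduced_letter_mult reduced_word_def[of "[]"])

lemma cusp_word_letters:
  assumes "k > 0" shows "snd ` set (cusp_word k w) \<subseteq> {..<nat k}"
proof (induction w)
  case (Cons x w)
  have "snd ` set (letter_mult y v) \<subseteq> {..<nat k}"
    if "snd y < nat k" "snd ` set v \<subseteq> {..<nat k}" for y and v :: "(bool \<times> nat) list"
    using that set_letter_mult[of y v] by fastforce
  with Cons assms show ?case
    by (auto simp: cusp_letter_def simp del: image_subset_iff)
qed simp

text \<open>s and its inverse leave the second row unchanged, so a loop has the same label in both
  directions; t and its inverse contribute nothing.\<close>

lemma cusp_letter_cancel:
  assumes "reduced_word y"
  shows "cusp_letter k x (second_row (mul2 (sanov (letter_inv x)) A)) (cusp_letter k (letter_inv x) (second_row A) y) = y"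
proof -
  obtain p q r s where A: "A = (p, q, r, s)" using prod_cases4 by blast
  show ?thesis
    using assms letter_mult_cancel[of y "(fst x, nat ((r div k * s) mod k))"]
    by (cases x rule: sanov.cases) (simp_all add: cusp_letter_def letter_inv_def A)
qed

lemma cusp_word_letter_mult:
  "cusp_word k (letter_mult x w) = cusp_letter k x (second_row (word_mat w)) (cusp_word k w)"
proof (cases w)
  case (Cons y v)
  then show ?thesis
    using cusp_letter_cancel[OF reduced_cusp_word[of k v], of k x "word_mat v"] by auto
qed simp

text \<open>The label (r / k) * s is quadratic in the row and so does not see its sign. This is what
  permits words to represent matrices only up to sign.\<close>

lemma second_row_neg2: "cusp_letter k x (second_row (neg2 A)) y = cusp_letter k x (second_row A) y"
proof -
  obtain p q r s where A: "A = (p, q, r, s)" using prod_cases4 by blast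
  show ?thesis by (auto simp: A cusp_letter_def dvd_neg_div)
qed

text \<open>The label depends only on the coset of the suffix modulo \<open>Gamma0 (k\<^sup>2)\<close>.\<close>

lemma cusp_letter_coset:
  assumes "g \<in> Gamma0 (k\<^sup>2)" "k > 0"
  shows "cusp_letter k x (second_row (mul2 A g)) y = cusp_letter k x (second_row A) y"
proof -
  obtain p q r s where A: "A = (p, q, r, s)" using prod_cases4 by blast
  obtain p' q' c s' where g: "g = (p', q', k\<^sup>2 * c, s')" and det: "p' * s' - q' * (k\<^sup>2 * c) = 1"
    using assms by (auto simp: Gamma0_def dvd_def)
  define r2 s2 where "r2 = r * p' + s * (k\<^sup>2 * c)" and "s2 = r * q' + s * s'"
  have row: "second_row (mul2 A g) = (r2, s2)"
    by (simp add: A g r2_def s2_def)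
  have ps: "p' * s' = 1 + k * (q' * k * c)"
    using det by (simp add: power2_eq_square algebra_simps)
  have dvd: "k dvd r2 \<longleftrightarrow> k dvd r"
  proof
    assume "k dvd r2"
    then have "k dvd r * p'"
      unfolding r2_def power2_eq_square by (metis dvd_add_left_iff dvd_mult dvd_mult2 dvd_triv_left mult.assoc)
    then have "k dvd r * (p' * s')"
      by (metis dvd_mult2 mult.assoc)
    then have "k dvd r + k * (r * (q' * k * c))"
      unfolding ps by (simp add: algebra_simps)
    then show "k dvd r"
      by (metis dvd_add_left_iff dvd_triv_left)
  qed (simp add: r2_def power2_eq_square mult.assoc)
  \<comment> \<open>Modulo k the new label is (r / k) * p' * s * s', and p' * s' = 1 modulo k by the
    determinant.\<close>
  have "(r2 div k * s2) mod k = (r div k * s) mod k" if kr: "k dvd r"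
  proof -
    obtain t where t: "r = k * t" using kr by (auto simp: dvd_def)
    have "r2 = k * (t * p' + s * (k * c))"
      by (simp add: r2_def t power2_eq_square algebra_simps)
    then have "r2 div k = t * p' + s * (k * c)"
      using assms(2) by simp
    then have "r2 div k * s2 = t * s * (p' * s') + k * (t * p' * t * q' + s * c * s2)"
      by (simp add: s2_def t algebra_simps)
    also have "\<dots> = t * s + k * (t * s * (q' * k * c) + t * p' * t * q' + s * c * s2)"
      unfolding ps by (simp add: algebra_simps)
    finally show ?thesis
      using assms(2) by (simp add: t)
  qed
  with dvd show ?thesis
    unfolding cusp_letter_def row by (auto simp: A)
qed

text \<open>The path of \<open>w\<close> closes up at the base coset, so \<open>u\<close> is then
  read at the same vertices as if it stood alone.\<close>

lemma cusp_word_mult: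
  assumes "k > 0" "reduced_word w" "word_mat w \<in> Gamma0 (k\<^sup>2) \<or> neg2 (word_mat w) \<in> Gamma0 (k\<^sup>2)"
  shows "cusp_word k (foldr letter_mult u w) = foldr letter_mult (cusp_word k u) (cusp_word k w)"
proof (induction u)
  case (Cons x u)
  have "cusp_letter k x (second_row (mul2 (word_mat u) (word_mat w))) y =
    cusp_letter k x (second_row (word_mat u)) y" for y
    using assms cusp_letter_coset[of "word_mat w" k x "word_mat u" y]
      cusp_letter_coset[of "neg2 (word_mat w)" k x "word_mat u" y]
    by (auto simp: second_row_neg2)
  then show ?case
    using Cons
    by (simp add: cusp_word_letter_mult word_mat_mult)
      (auto simp: cusp_letter_def foldr_letter_mult reduced_cusp_word)
qed simp

section \<open>The homomorphism on matrices and its surjectivity\<close>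

definition cusp_hom :: "int \<Rightarrow> mat2 \<Rightarrow> (bool \<times> nat) list" where
  "cusp_hom k A = cusp_word k (THE w. reduced_word w \<and> (word_mat w = A \<or> word_mat w = neg2 A))"

lemma cusp_hom_eq:
  assumes "reduced_word w" "word_mat w = A \<or> word_mat w = neg2 A"
  shows "cusp_hom k A = cusp_word k w"
proof -
  have "(THE w. reduced_word w \<and> (word_mat w = A \<or> word_mat w = neg2 A)) = w"
  proof (rule the_equality)
    fix v assume "reduced_word v \<and> (word_mat v = A \<or> word_mat v = neg2 A)"
    with assms show "v = w"
      by (intro word_mat_inj) (auto simp del: neg2.simps)
  qed (use assms in auto)
  then show ?thesis by (simp add: cusp_hom_def)
qed

lemma Gamma0_word:
  assumes "A \<in> Gamma0 (k\<^sup>2)" "4 dvd k"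
  obtains w where "reduced_word w" "word_mat w = A \<or> word_mat w = neg2 A"
proof -
  obtain p q r s where A: "A = (p, q, r, s)" using prod_cases4 by blast
  have "4 dvd r"
    using assms by (auto simp: A Gamma0_def power2_eq_square intro: dvd_trans[OF dvd_trans[OF assms(2) dvd_triv_left]])
  then show thesis
    using word_mat_surj[of p s q r] assms that by (auto simp: A Gamma0_def simp del: neg2.simps)
qed

lemma Gamma0_mult: "A \<in> Gamma0 n \<Longrightarrow> B \<in> Gamma0 n \<Longrightarrow> mul2 A B \<in> Gamma0 n"
proof -
  assume *: "A \<in> Gamma0 n" "B \<in> Gamma0 n"
  obtain p q r s where A: "A = (p, q, r, s)" using prod_cases4 by blast
  obtain p' q' r' s' where B: "B = (p', q', r', s')" using prod_cases4 by blast
  have "(p * p' + q * r') * (r * q' + s * s') - (p * q' + q * s') * (r * p' + s * r')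
      = (p * s - q * r) * (p' * s' - q' * r')"
    by (simp add: algebra_simps)
  then show ?thesis
    using * by (simp add: A B Gamma0_def)
qed

lemma cusp_hom_mult:
  assumes "k > 0" "4 dvd k" "A \<in> Gamma0 (k\<^sup>2)" "B \<in> Gamma0 (k\<^sup>2)"
  shows "cusp_hom k (mul2 A B) = foldr letter_mult (cusp_hom k A) (cusp_hom k B)"
proof -
  obtain u where u: "reduced_word u" "word_mat u = A \<or> word_mat u = neg2 A"
    using Gamma0_word assms by metis
  obtain v where v: "reduced_word v" "word_mat v = B \<or> word_mat v = neg2 B"
    using Gamma0_word assms by metis
  have "cusp_hom k (mul2 A B) = cusp_word k (foldr letter_mult u v)"
    using u v by (intro cusp_hom_eq) (auto simp: reduced_foldr word_mat_mult simp del: neg2.simps)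
  also have "\<dots> = foldr letter_mult (cusp_word k u) (cusp_word k v)"
    using assms v by (intro cusp_word_mult) (auto simp del: neg2.simps)
  finally show ?thesis
    using cusp_hom_eq[OF u] cusp_hom_eq[OF v] by simp
qed

lemma cusp_hom_carrier:
  assumes "k > 0" shows "cusp_hom k A \<in> carrier (free_group {..<nat k})"
  using assms cusp_word_letters reduced_cusp_word unfolding cusp_hom_def free_group_def by auto

text \<open>The path goes out along t to the coset numbered j, runs once through the loop there, and
  returns the same way. The lower left entry of the resulting matrix is (k j)^2 up to sign, hence a
  multiple of the level.\<close>

lemma cusp_hom_letter:
  assumes "k > 0" "4 dvd k" "j < nat k"
  shows "\<exists>A\<in>Gamma0 (k\<^sup>2). cusp_hom k A = [(e, j)]"
proof -
  define x where "x = (e, False)"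
  \<comment> \<open>t has lower left entry 4, so its power k j / 4 leads to the coset of (1 0; k j
    1); this is where k must be a multiple of 4.\<close>
  define n where "n = nat (k div 4) * j"
  define t where "t = k * int j"
  have n: "4 * int n = t"
    using assms by (auto simp: n_def t_def)
  have rep: "word_mat (replicate i (d, True)) = (1, 0, if d then 4 * int i else - (4 * int i), 1)" for i d
    by (induction i) auto
  have red: "reduced_word (replicate i y)" for i and y :: "bool \<times> bool"
    by (induction i) (auto simp: reduced_word_Cons reduced_word_def[of "[]"] letter_inv_def prod_eq_iff)
  define v where "v = letter_mult x (replicate n (True, True))"
  define w where "w = foldr letter_mult (replicate n (False, True)) v"
  have "word_mat w = mul2 (1, 0, - t, 1) (mul2 (sanov x) (1, 0, t, 1))"
    by (simp add: w_def v_def word_mat_mult word_mat_letter_mult rep n del: foldr_replicate)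
  then have w: "word_mat w \<in> Gamma0 (k\<^sup>2)"
    by (cases e) (auto simp: x_def Gamma0_def t_def power2_eq_square algebra_simps)
  have b: "cusp_word k (replicate i (d, True)) = []" for i d
    by (induction i) (auto simp: cusp_letter_def)
  have "cusp_word k v = [(e, j)]"
    using assms by (simp add: v_def cusp_word_letter_mult b rep n cusp_letter_def x_def t_def)
  moreover have "cusp_word k (foldr letter_mult (replicate i (d, True)) u) = cusp_word k u" for i d u
    by (induction i) (auto simp: cusp_word_letter_mult cusp_letter_def)
  ultimately have "cusp_word k w = [(e, j)]"
    by (simp add: w_def)
  moreover have "reduced_word w"
    unfolding w_def v_def by (intro reduced_foldr reduced_letter_mult red)
  ultimately show ?thesis
    using w cusp_hom_eq[of w "word_mat w" k] by auto
qed

lemma cusp_hom_surj: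
  assumes "k > 0" "4 dvd k" "y \<in> carrier (free_group {..<nat k})"
  shows "\<exists>A\<in>Gamma0 (k\<^sup>2). cusp_hom k A = y"
proof -
  have "reduced_word y" "snd ` set y \<subseteq> {..<nat k}"
    using assms by (auto simp: free_group_def)
  then show ?thesis
  proof (induction y)
    case Nil
    have "cusp_hom k (1, 0, 0, 1) = []"
      using cusp_hom_eq[of "[]" "(1, 0, 0, 1)" k] by (simp add: reduced_word_def)
    then show ?case
      by (intro bexI[of _ "(1, 0, 0, 1)"]) (auto simp: Gamma0_def)
  next
    case (Cons x y)
    then obtain A where A: "A \<in> Gamma0 (k\<^sup>2)" "cusp_hom k A = y"
      by (auto simp: reduced_word_Cons)
    obtain B where B: "B \<in> Gamma0 (k\<^sup>2)" "cusp_hom k B = [x]"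
      using cusp_hom_letter[OF assms(1,2), of "snd x" "fst x"] Cons.prems by auto
    have "cusp_hom k (mul2 B A) = letter_mult x y"
      using cusp_hom_mult[OF assms(1,2) B(1) A(1)] by (simp add: A B)
    also have "\<dots> = x # y"
      using Cons.prems by (cases y) (auto simp: reduced_word_Cons)
    finally show ?case
      using Gamma0_mult[OF B(1) A(1)] by blast
  qed
qed

section \<open>The stabilizer of a skew form on the integral lattice of rank four\<close>

text \<open>Squaring a = - (sqrt 2 b + sqrt 3 c) leaves a multiple of sqrt 6, and squaring again
  gives x^2 = 6 y^2 with y = 2 b c. So b c = 0, and what remains is a relation x^2 = 2 y^2 or x^2 =
  3 y^2.\<close>

lemma sqrt2_sqrt3_independent:
  fixes a b c :: int
  assumes "of_int a + sqrt 2 * of_int b + sqrt 3 * of_int c = 0"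
  shows "a = 0 \<and> b = 0 \<and> c = 0"
proof -
  have irrat: "x = 0 \<and> y = 0" if xy: "x\<^sup>2 = m * y\<^sup>2" and m: "m = 2 \<or> m = 3 \<or> m = 6" for x y m :: int
  proof (rule ccontr)
    assume *: "\<not> (x = 0 \<and> y = 0)"
    then have y: "y \<noteq> 0" using xy by auto
    then have x: "x \<noteq> 0" using xy m by auto
    \<comment> \<open>For a prime dividing m exactly once, the multiplicities in x^2 and in m y^2
      have different parity.\<close>
    obtain t :: int where t: "prime t" "multiplicity t m = 1"
    proof (cases "m = 3")
      case True
      then have "multiplicity 3 m = 1" by (intro multiplicity_eqI) auto
      then show thesis by (intro that[of 3]) auto
    next
      case False
      then have "multiplicity 2 m = 1" using m by (intro multiplicity_eqI) auto
      then show thesis by (intro that[of 2]) auto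
    qed
    have "multiplicity t (x\<^sup>2) = 2 * multiplicity t x" "multiplicity t (y\<^sup>2) = 2 * multiplicity t y"
      using prime_elem_multiplicity_mult_distrib[OF prime_imp_prime_elem[OF t(1)]] x y
      by (simp_all add: power2_eq_square)
    moreover have "multiplicity t (m * y\<^sup>2) = multiplicity t m + multiplicity t (y\<^sup>2)"
      using t m y by (intro prime_elem_multiplicity_mult_distrib) auto
    ultimately have "2 * multiplicity t x = 1 + 2 * multiplicity t y"
      using t xy by simp
    then show False by presburger
  qed
  have "of_int (a\<^sup>2 - 2 * b\<^sup>2 - 3 * c\<^sup>2) = 2 * of_int (b * c) * (sqrt 2 * sqrt 3)"
  proof -
    have "(of_int a)\<^sup>2 = (sqrt 2 * of_int b + sqrt 3 * of_int c)\<^sup>2"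
      using assms by (metis add.assoc add_eq_0_iff power2_minus)
    then show ?thesis
      by (simp add: power2_sum power_mult_distrib)
  qed
  then have "(of_int (a\<^sup>2 - 2 * b\<^sup>2 - 3 * c\<^sup>2))\<^sup>2 = (of_int (6 * (2 * (b * c))\<^sup>2) :: real)"
    by (simp add: power_mult_distrib)
  then have "(a\<^sup>2 - 2 * b\<^sup>2 - 3 * c\<^sup>2)\<^sup>2 = 6 * (2 * (b * c))\<^sup>2"
    by (metis of_int_eq_iff of_int_power)
  from irrat[OF this] have "b = 0 \<or> c = 0" by simp
  then show ?thesis
  proof
    assume "b = 0"
    then have "of_int a = - (sqrt 3 * of_int c)"
      using assms by simp
    then have "of_int (a\<^sup>2) = (of_int (3 * c\<^sup>2) :: real)"
      by (simp add: power_mult_distrib)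
    then have "a\<^sup>2 = 3 * c\<^sup>2" by (simp only: of_int_eq_iff)
    from irrat[OF this] show ?thesis using \<open>b = 0\<close> by simp
  next
    assume "c = 0"
    then have "of_int a = - (sqrt 2 * of_int b)"
      using assms by simp
    then have "of_int (a\<^sup>2) = (of_int (2 * b\<^sup>2) :: real)"
      by (simp add: power_mult_distrib)
    then have "a\<^sup>2 = 2 * b\<^sup>2" by (simp only: of_int_eq_iff)
    from irrat[OF this] show ?thesis using \<open>c = 0\<close> by simp
  qed
qed

text \<open>The index \<open>m\<close> selects the coefficient of 1, sqrt 2 or sqrt 3. The first and
  the last part live on the blocks {0, 1} and {2, 3}; the middle one pairs the blocks, and for a
  block matrix diag(a, d) with unimodular blocks its invariance means d = D^-1 a D with D = diag(1,
  n).\<close>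

definition torus_form_coeff :: "nat \<Rightarrow> int \<Rightarrow> nat \<Rightarrow> nat \<Rightarrow> int" where
  "torus_form_coeff m n i j =
     (if m = 0 then (if (i, j) = (0, 1) then 1 else if (i, j) = (1, 0) then - 1 else 0)
      else if m = 1 then (if (i, j) = (0, 3) then n else if (i, j) = (3, 0) then - n
        else if (i, j) = (1, 2) then - 1 else if (i, j) = (2, 1) then 1 else 0)
      else (if (i, j) = (2, 3) then 1 else if (i, j) = (3, 2) then - 1 else 0))"

definition torus_form :: "int \<Rightarrow> nat \<Rightarrow> nat \<Rightarrow> real" where
  "torus_form n i j = of_int (torus_form_coeff 0 n i j)
     + sqrt 2 * of_int (torus_form_coeff 1 n i j) + sqrt 3 * of_int (torus_form_coeff 2 n i j)"

definition preserves_form :: "(nat \<Rightarrow> nat \<Rightarrow> real) \<Rightarrow> (nat \<Rightarrow> nat \<Rightarrow> int) \<Rightarrow> bool" where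
  "preserves_form b A \<longleftrightarrow>
     (\<forall>j<4. \<forall>k<4. (\<Sum>i<4. \<Sum>l<4. b i l * of_int (A i j) * of_int (A l k)) = b j k)"

lemma sum_lessThan_4: "(\<Sum>i<4::nat. f i) = f 0 + f 1 + f 2 + (f 3 :: 'a::comm_monoid_add)"
  by (simp add: eval_nat_numeral add.assoc)

lemma less_4_cases: "(i::nat) < 4 \<longleftrightarrow> i = 0 \<or> i = 1 \<or> i = 2 \<or> i = 3"
  by auto

lemma preserves_form_coeff:
  assumes "preserves_form (torus_form n) A" "j < 4" "k < 4" "m \<in> {0, 1, 2}"
  shows "(\<Sum>i<4. \<Sum>l<4. torus_form_coeff m n i l * A i j * A l k) = torus_form_coeff m n j k"
proof -
  define d where "d m = (\<Sum>i<4. \<Sum>l<4. torus_form_coeff m n i l * A i j * A l k) - torus_form_coeff m n j k" for m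
  have "(\<Sum>i<4. \<Sum>l<4. torus_form n i l * of_int (A i j) * of_int (A l k)) = torus_form n j k"
    using assms by (simp add: preserves_form_def)
  then have "of_int (d 0) + sqrt 2 * of_int (d 1) + sqrt 3 * of_int (d 2) = 0"
    by (simp add: d_def torus_form_def algebra_simps sum.distrib sum_distrib_left)
  from sqrt2_sqrt3_independent[OF this] assms(4) show ?thesis
    by (auto simp: d_def)
qed

definition corner :: "(nat \<Rightarrow> nat \<Rightarrow> int) \<Rightarrow> mat2" where
  "corner A = (A 0 0, A 0 1, A 1 0, A 1 1)"

text \<open>Invariance of the part at 1 prescribes the minors of rows 0 and 1: the one in columns 0,
  1 equals 1 and the others vanish, which kills the entries of these rows in columns 2 and 3. The
  part at sqrt 3 does the same for rows 2 and 3.\<close>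

lemma preserves_form_corner:
  assumes "preserves_form (torus_form n) A"
  shows "corner A \<in> Gamma0 n" "A 0 2 = 0" "A 0 3 = 0" "A 1 2 = 0" "A 1 3 = 0"
proof -
  note c = preserves_form_coeff[OF assms]
  have e: "A 0 0 * A 1 1 - A 1 0 * A 0 1 = 1"
    "A 0 0 * A 1 2 - A 1 0 * A 0 2 = 0" "A 0 1 * A 1 2 - A 1 1 * A 0 2 = 0"
    "A 0 0 * A 1 3 - A 1 0 * A 0 3 = 0" "A 0 1 * A 1 3 - A 1 1 * A 0 3 = 0"
    using c[of 0 1 0] c[of 0 2 0] c[of 1 2 0] c[of 0 3 0] c[of 1 3 0]
    by (simp_all add: torus_form_coeff_def sum_lessThan_4 del: One_nat_def)
  show z: "A 0 2 = 0" "A 0 3 = 0" "A 1 2 = 0" "A 1 3 = 0"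
    using e by algebra+
  have f: "A 2 2 * A 3 3 - A 3 2 * A 2 3 = 1"
    "A 2 0 * A 3 2 - A 3 0 * A 2 2 = 0" "A 2 0 * A 3 3 - A 3 0 * A 2 3 = 0"
    "A 2 1 * A 3 2 - A 3 1 * A 2 2 = 0" "A 2 1 * A 3 3 - A 3 1 * A 2 3 = 0"
    using c[of 2 3 2] c[of 0 2 2] c[of 0 3 2] c[of 1 2 2] c[of 1 3 2]
    by (simp_all add: torus_form_coeff_def sum_lessThan_4 algebra_simps del: One_nat_def)
  have w: "A 2 0 = 0" "A 3 0 = 0" "A 2 1 = 0" "A 3 1 = 0"
    using f by algebra+
  have g: "n * A 0 0 * A 3 2 = A 1 0 * A 2 2" "n * A 0 1 * A 3 2 - A 1 1 * A 2 2 = - 1"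
    using c[of 0 2 1] c[of 1 2 1]
    by (simp_all add: torus_form_coeff_def sum_lessThan_4 z w del: One_nat_def)
  \<comment> \<open>Cramer's rule for the unknowns \<open>n * A 3 2\<close> and \<open>A 2 2\<close>
    in \<open>g\<close>; the determinant of the system is a unit by \<open>e(1)\<close>.\<close>
  have "A 1 0 = n * A 3 2"
    using g e(1) by algebra
  then show "corner A \<in> Gamma0 n"
    using e(1) by (simp add: corner_def Gamma0_def algebra_simps del: One_nat_def)
qed

text \<open>The lower block is determined by the upper one through the coefficient of \<open>sqrt 2\<close>.\<close>

definition stabilizer_mat :: "int \<Rightarrow> mat2 \<Rightarrow> nat \<Rightarrow> nat \<Rightarrow> int" where
  "stabilizer_mat n g = (case g of (p, q, r, s) \<Rightarrow> (\<lambda>i j.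
     if (i, j) = (0, 0) then p else if (i, j) = (0, 1) then q
     else if (i, j) = (1, 0) then r else if (i, j) = (1, 1) then s
     else if (i, j) = (2, 2) then p else if (i, j) = (2, 3) then q * n
     else if (i, j) = (3, 2) then r div n else if (i, j) = (3, 3) then s else 0))"

lemma corner_stabilizer_mat [simp]: "corner (stabilizer_mat n g) = g"
  by (cases g) (simp add: corner_def stabilizer_mat_def)

lemma preserves_form_stabilizer_mat:
  assumes "g \<in> Gamma0 n" "n > 0"
  shows "preserves_form (torus_form n) (stabilizer_mat n g)"
proof -
  obtain p q c s where g: "g = (p, q, n * c, s)" and det: "p * s - q * (n * c) = 1"
    using assms by (auto simp: Gamma0_def dvd_def)
  have det': "real_of_int p * real_of_int s - real_of_int q * (real_of_int n * real_of_int c) = 1"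
    using det by (metis of_int_1 of_int_diff of_int_mult)
  have nz: "n \<noteq> 0" using assms(2) by simp
  show ?thesis
    unfolding preserves_form_def less_4_cases
    using det'
    apply (intro allI impI)
    apply (elim disjE; hypsubst)
    apply (simp_all (no_asm) add: sum_lessThan_4 torus_form_def torus_form_coeff_def stabilizer_mat_def g nz)
    apply algebra+
    done
qed

definition mat4_mult :: "(nat \<Rightarrow> nat \<Rightarrow> int) \<Rightarrow> (nat \<Rightarrow> nat \<Rightarrow> int) \<Rightarrow> nat \<Rightarrow> nat \<Rightarrow> int" where
  "mat4_mult A B i j = (\<Sum>k<4. A i k * B k j)"

text \<open>The upper right block of \<open>A\<close> vanishes, so the upper left block of the
  product involves only the two corners.\<close>

lemma corner_mult:
  assumes "preserves_form (torus_form n) A"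
  shows "corner (mat4_mult A B) = mul2 (corner A) (corner B)"
  using preserves_form_corner[OF assms] by (simp add: corner_def mat4_mult_def sum_lessThan_4)

lemma stabilizer_mat_inverse:
  assumes "g \<in> Gamma0 n" "n > 0"
  obtains h where "h \<in> Gamma0 n"
    "\<And>i j. i < 4 \<Longrightarrow> j < 4 \<Longrightarrow> mat4_mult (stabilizer_mat n g) (stabilizer_mat n h) i j = (if i = j then 1 else 0)"
    "\<And>i j. i < 4 \<Longrightarrow> j < 4 \<Longrightarrow> mat4_mult (stabilizer_mat n h) (stabilizer_mat n g) i j = (if i = j then 1 else 0)"
proof -
  obtain p q c s where g: "g = (p, q, n * c, s)" and det: "p * s - q * (n * c) = 1"
    using assms by (auto simp: Gamma0_def dvd_def)
  \<comment> \<open>The adjugate of \<open>g\<close>; its lower left entry is again a multiple of n,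
    so the lower block stays integral.\<close>
  define h where "h = (s, - q, n * (- c), p)"
  have nz: "n \<noteq> 0" using assms(2) by simp
  have dv: "- (n * c) div n = - c" using nz by (simp flip: mult_minus_right)
  have "h \<in> Gamma0 n" using det by (simp add: h_def Gamma0_def algebra_simps)
  moreover have "\<forall>i\<in>{0,1,2,3}. \<forall>j\<in>{0,1,2,3}.
      mat4_mult (stabilizer_mat n g) (stabilizer_mat n h) i j = (if i = j then 1 else 0) \<and>
      mat4_mult (stabilizer_mat n h) (stabilizer_mat n g) i j = (if i = j then 1 else 0)"
    using det
    apply (simp (no_asm) add: mat4_mult_def sum_lessThan_4 stabilizer_mat_def g h_def nz dv)
    apply (simp add: mult.assoc mult.commute mult.left_commute)
    done
  then have "mat4_mult (stabilizer_mat n g) (stabilizer_mat n h) i j = (if i = j then 1 else 0)"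
    "mat4_mult (stabilizer_mat n h) (stabilizer_mat n g) i j = (if i = j then 1 else 0)"
    if "i < 4" "j < 4" for i j
    using that unfolding less_4_cases by blast+
  ultimately show thesis using that by blast
qed

section \<open>Calculus of smooth functions on open subsets of Euclidean space\<close>

text \<open>Turns the space into a subspace of the product topology on the type
  \<open>nat \<Rightarrow> real\<close>, so that continuity can be handled through
  \<open>continuous_on\<close>.\<close>

lemma Euclidean_space_eq_top_of_set: "Euclidean_space n = top_of_set (topspace (Euclidean_space n))"
  by (simp add: Euclidean_space_def euclidean_product_topology topspace_Euclidean_space)

lemma continuous_map_Euclidean_space_subtopology:
  fixes f :: "(nat \<Rightarrow> real) \<Rightarrow> real"
  assumes "W \<subseteq> topspace (Euclidean_space n)"
  shows "continuous_map (subtopology (Euclidean_space n) W) euclidean f \<longleftrightarrow> continuous_on W f"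
proof -
  have "subtopology (Euclidean_space n) W = top_of_set W"
    using assms by (metis Euclidean_space_eq_top_of_set inf.absorb_iff2 subtopology_subtopology)
  then show ?thesis by simp
qed

lemma continuous_on_fun_upd: "continuous_on UNIV (\<lambda>t::real. x(i := t))"
proof (rule continuous_on_coordinatewise_then_product)
  show "continuous_on UNIV (\<lambda>t. (x(i := t)) j)" for j
    by (cases "j = i") auto
qed

lemma open_fun_upd_vimage:
  assumes "openin (Euclidean_space n) W" "x \<in> W" "i < n"
  shows "open {t. x(i := t) \<in> W}"
proof -
  obtain T where T: "open T" "W = topspace (Euclidean_space n) \<inter> T"
    using assms(1) by (metis Euclidean_space_eq_top_of_set openin_open)
  have "{t. x(i := t) \<in> W} = (\<lambda>t. x(i := t)) -` T"
    using T assms by (auto simp: topspace_Euclidean_space)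
  then show ?thesis
    using open_vimage[OF T(1) continuous_on_fun_upd] by simp
qed

lemma eventually_fun_upd:
  assumes "openin (Euclidean_space n) W" "x \<in> W" "i < n"
  shows "\<forall>\<^sub>F t in nhds (x i). x(i := t) \<in> W"
  unfolding eventually_nhds
  by (intro exI[of _ "{t. x(i := t) \<in> W}"]) (use open_fun_upd_vimage[OF assms] assms(2) in auto)

lemma Ck_on_imp_continuous_on:
  assumes "openin (Euclidean_space n) W" "Ck_on n k W f"
  shows "continuous_on W f"
  using assms continuous_map_Euclidean_space_subtopology[OF openin_subset[OF assms(1)]]
  by (cases k) auto

lemma Ck_on_SucD:
  assumes "Ck_on n (Suc k) W f" "i < n"
  shows "Ck_on n k W (partial_deriv i f)"
    and "x \<in> W \<Longrightarrow> ((\<lambda>t. f (x(i := t))) has_real_derivative partial_deriv i f x) (at (x i))"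
  using assms by (auto simp: partial_deriv_def DERIV_deriv_iff_field_differentiable)

text \<open>Values off \<open>W\<close> could enter only through derivatives at points of
  \<open>W\<close>, and these are local because \<open>W\<close> is open along every coordinate
  line.\<close>

lemma Ck_on_cong:
  assumes W: "openin (Euclidean_space n) W" and eq: "\<And>x. x \<in> W \<Longrightarrow> f x = g x"
  shows "Ck_on n k W f \<longleftrightarrow> Ck_on n k W g"
proof -
  have "Ck_on n k W g" if "Ck_on n k W f" "\<forall>x\<in>W. f x = g x" for f g
    using that
  proof (induction k arbitrary: f g)
    case 0
    then show ?case
      using continuous_map_Euclidean_space_subtopology[OF openin_subset[OF W]] continuous_on_cong[of W W f g]
      by simp
  next
    case (Suc k)
    have ev: "\<forall>\<^sub>F t in nhds (x i). f (x(i := t)) = g (x(i := t))" if "x \<in> W" "i < n" for x i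
      using eventually_fun_upd[OF W that] by eventually_elim (use Suc.prems(2) in blast)
    have pd: "partial_deriv i f x = partial_deriv i g x" if "x \<in> W" "i < n" for x i
      unfolding partial_deriv_def by (rule deriv_cong_ev[OF ev[OF that] refl])
    have "(\<lambda>t. g (x(i := t))) field_differentiable at (x i)" if "x \<in> W" "i < n" for x i
      using Ck_on_SucD(2)[OF Suc.prems(1) that(2,1)] DERIV_cong_ev[OF refl ev[OF that] refl]
      unfolding field_differentiable_def by metis
    moreover have "continuous_map (subtopology (Euclidean_space n) W) euclideanreal g"
      using Suc.prems continuous_map_Euclidean_space_subtopology[OF openin_subset[OF W]]
        continuous_on_cong[of W W f g]
      by simp
    ultimately show ?case
      using Suc.prems Suc.IH pd by simp blast
  qed
  then show ?thesis using eq by metis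
qed

lemma partial_deriv_eqI:
  "((\<lambda>t. f (x(i := t))) has_real_derivative d) (at (x i)) \<Longrightarrow> partial_deriv i f x = d"
  by (simp add: partial_deriv_def DERIV_imp_deriv)

lemma Ck_on_SucI:
  assumes W: "openin (Euclidean_space n) W" and "continuous_on W f"
    and d: "\<And>i x. i < n \<Longrightarrow> x \<in> W \<Longrightarrow> ((\<lambda>t. f (x(i := t))) has_real_derivative D i x) (at (x i))"
    and D: "\<And>i. i < n \<Longrightarrow> Ck_on n k W (D i)"
  shows "Ck_on n (Suc k) W f"
proof -
  have "Ck_on n k W (partial_deriv i f)" if "i < n" for i
  proof -
    have "partial_deriv i f x = D i x" if "x \<in> W" for x
      using partial_deriv_eqI[OF d[OF \<open>i < n\<close> that]] .
    then show ?thesis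
      using Ck_on_cong[OF W, of "partial_deriv i f" "D i"] D[OF that] by blast
  qed
  moreover have "(\<lambda>t. f (x(i := t))) field_differentiable at (x i)" if "x \<in> W" "i < n" for x i
    using d[OF that(2,1)] by (auto simp: field_differentiable_def)
  ultimately show ?thesis
    using assms continuous_map_Euclidean_space_subtopology[OF openin_subset[OF W]] by auto
qed

lemma Ck_on_mono: "Ck_on n (Suc k) W f \<Longrightarrow> Ck_on n k W f"
  by (induction k arbitrary: f) auto

lemma Ck_on_subset:
  assumes "openin (Euclidean_space n) W" "V \<subseteq> W" "Ck_on n k W f"
  shows "Ck_on n k V f"
  using assms(3)
proof (induction k arbitrary: f)
  case 0
  then show ?case
    using assms(2) by (auto intro: continuous_map_from_subtopology_mono)
next
  case (Suc k)
  then show ?case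
    using assms(2) by (auto intro: continuous_map_from_subtopology_mono)
qed

lemma continuous_on_local:
  assumes "W \<subseteq> topspace (Euclidean_space n)"
    and "\<And>x. x \<in> W \<Longrightarrow> \<exists>V. openin (Euclidean_space n) V \<and> x \<in> V \<and> continuous_on V f"
  shows "continuous_on W f"
  unfolding continuous_on_eq_continuous_within
proof
  fix x assume x: "x \<in> W"
  then obtain V where V: "openin (Euclidean_space n) V" "x \<in> V" "continuous_on V f"
    using assms by blast
  obtain T where T: "open T" "V = topspace (Euclidean_space n) \<inter> T"
    using V(1) by (metis Euclidean_space_eq_top_of_set openin_open)
  have "continuous (at x within V) f"
    using V by (simp add: continuous_on_eq_continuous_within)
  then have "continuous (at x within W \<inter> T) f"
    using assms(1) T(2) by (elim continuous_within_subset) auto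
  moreover have "at x within W \<inter> T = at x within W"
    using T V(2) by (intro at_within_nhd[of x T]) auto
  ultimately show "continuous (at x within W) f"
    by simp
qed

text \<open>Used for functions given by different expressions on overlapping open sets, such as a
  bump function times a local function, extended by 0.\<close>

lemma Ck_on_local:
  assumes W: "openin (Euclidean_space n) W"
    and "\<And>x. x \<in> W \<Longrightarrow> \<exists>V. openin (Euclidean_space n) V \<and> x \<in> V \<and> Ck_on n k V f"
  shows "Ck_on n k W f"
  using assms(2)
proof (induction k arbitrary: f)
  case 0
  have "continuous_on W f"
    using 0 Ck_on_imp_continuous_on by (intro continuous_on_local[OF openin_subset[OF W]]) metis
  then show ?case
    using continuous_map_Euclidean_space_subtopology[OF openin_subset[OF W]] by simp
next
  case (Suc k)
  show ?case
  proof (rule Ck_on_SucI[OF W])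
    show "continuous_on W f"
      using Suc.prems Ck_on_imp_continuous_on by (intro continuous_on_local[OF openin_subset[OF W]]) metis
    show "((\<lambda>t. f (x(i := t))) has_real_derivative partial_deriv i f x) (at (x i))" if "i < n" "x \<in> W" for i x
      using Suc.prems[OF that(2)] Ck_on_SucD(2)[OF _ that(1)] by metis
    show "Ck_on n k W (partial_deriv i f)" if "i < n" for i
      using Suc.prems Ck_on_SucD(1)[OF _ that] by (intro Suc.IH) metis
  qed
qed

section \<open>Closure of smoothness under arithmetic and composition\<close>

lemma fun_upd_partial_simp: "((\<lambda>t. (x(i := t)) j) has_real_derivative (if i = j then 1 else 0)) F"
  by (cases "i = j") auto

lemma Ck_on_const: "openin (Euclidean_space n) W \<Longrightarrow> Ck_on n k W (\<lambda>x. c)"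
proof (induction k arbitrary: c)
  case (Suc k)
  show ?case by (rule Ck_on_SucI[OF Suc.prems, where D = "\<lambda>i x. 0"]) (simp_all add: Suc)
qed simp

lemma Ck_on_coord:
  assumes "openin (Euclidean_space n) W"
  shows "Ck_on n k W (\<lambda>x. x j)"
proof (cases k)
  case 0
  then show ?thesis
    using continuous_map_Euclidean_space_subtopology[OF openin_subset[OF assms]]
      continuous_on_subset[OF continuous_on_product_coordinates subset_UNIV, of W j] by simp
next
  case (Suc k)
  have "continuous_on W (\<lambda>x. x j)"
    by (rule continuous_on_subset[OF continuous_on_product_coordinates subset_UNIV])
  then show ?thesis
    unfolding Suc
    by (rule Ck_on_SucI[OF assms, where D = "\<lambda>i x. if i = j then 1 else 0"])
      (rule fun_upd_partial_simp Ck_on_const assms)+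
qed

lemma Ck_on_add:
  assumes W: "openin (Euclidean_space n) W"
  shows "Ck_on n k W f \<Longrightarrow> Ck_on n k W g \<Longrightarrow> Ck_on n k W (\<lambda>x. f x + g x)"
proof (induction k arbitrary: f g)
  case 0
  then show ?case by (auto intro: continuous_map_add)
next
  case (Suc k)
  show ?case
  proof (rule Ck_on_SucI[OF W])
    show "continuous_on W (\<lambda>x. f x + g x)"
      using Suc.prems Ck_on_imp_continuous_on[OF W] by (intro continuous_intros) metis+
    show "((\<lambda>t. f (x(i := t)) + g (x(i := t))) has_real_derivative
        partial_deriv i f x + partial_deriv i g x) (at (x i))" if "i < n" "x \<in> W" for i x
      using Ck_on_SucD(2)[OF Suc.prems(1) that] Ck_on_SucD(2)[OF Suc.prems(2) that]
      by (rule DERIV_add)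
    show "Ck_on n k W (\<lambda>x. partial_deriv i f x + partial_deriv i g x)" if "i < n" for i
      using Suc.IH Ck_on_SucD(1)[OF Suc.prems(1) that] Ck_on_SucD(1)[OF Suc.prems(2) that] .
  qed
qed

lemma Ck_on_mult:
  assumes W: "openin (Euclidean_space n) W"
  shows "Ck_on n k W f \<Longrightarrow> Ck_on n k W g \<Longrightarrow> Ck_on n k W (\<lambda>x. f x * g x)"
proof (induction k arbitrary: f g)
  case 0
  then show ?case by (auto intro: continuous_map_real_mult)
next
  case (Suc k)
  show ?case
  proof (rule Ck_on_SucI[OF W])
    show "continuous_on W (\<lambda>x. f x * g x)"
      using Suc.prems Ck_on_imp_continuous_on[OF W] by (intro continuous_intros) metis+
    show "((\<lambda>t. f (x(i := t)) * g (x(i := t))) has_real_derivative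
        f x * partial_deriv i g x + partial_deriv i f x * g x) (at (x i))" if "i < n" "x \<in> W" for i x
      by (rule DERIV_cong[OF DERIV_mult'[OF Ck_on_SucD(2)[OF Suc.prems(1) that] Ck_on_SucD(2)[OF Suc.prems(2) that]]])
        simp
    show "Ck_on n k W (\<lambda>x. f x * partial_deriv i g x + partial_deriv i f x * g x)" if "i < n" for i
      using Suc.prems[THEN Ck_on_mono] Suc.prems[THEN Ck_on_SucD(1), OF that]
      by (intro Ck_on_add[OF W] Suc.IH)
  qed
qed

lemma Ck_on_inverse:
  assumes W: "openin (Euclidean_space n) W" and nz: "\<And>x. x \<in> W \<Longrightarrow> f x \<noteq> 0"
  shows "Ck_on n k W f \<Longrightarrow> Ck_on n k W (\<lambda>x. inverse (f x))"
proof (induction k)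
  case 0
  then show ?case
    using nz openin_subset[OF W] by (auto intro!: continuous_map_real_inverse)
next
  case (Suc k)
  show ?case
  proof (rule Ck_on_SucI[OF W])
    show "continuous_on W (\<lambda>x. inverse (f x))"
      using Suc.prems Ck_on_imp_continuous_on[OF W] nz by (intro continuous_intros) (metis | blast)+
    show "((\<lambda>t. inverse (f (x(i := t)))) has_real_derivative
        - 1 * (inverse (f x) * partial_deriv i f x * inverse (f x))) (at (x i))" if "i < n" "x \<in> W" for i x
      using nz[OF that(2)] by (intro DERIV_cong[OF DERIV_inverse'[OF Ck_on_SucD(2)[OF Suc.prems that]]]) simp_all
    show "Ck_on n k W (\<lambda>x. - 1 * (inverse (f x) * partial_deriv i f x * inverse (f x)))" if "i < n" for i
      using Suc.prems[THEN Ck_on_mono] Suc.prems[THEN Ck_on_SucD(1), OF that]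
      by (intro Ck_on_mult[OF W] Ck_on_const[OF W] Suc.IH)
  qed
qed

text \<open>The family \<open>h\<close> lists a function of one variable with its successive
  derivatives. The chain rule passes from \<open>h m\<close> to \<open>h (Suc m)\<close>, so the
  induction has to run over all \<open>m\<close> at once.\<close>

lemma Ck_on_compose_real:
  fixes h :: "nat \<Rightarrow> real \<Rightarrow> real"
  assumes W: "openin (Euclidean_space n) W" and h: "\<And>m t. (h m has_real_derivative h (Suc m) t) (at t)"
  shows "Ck_on n k W f \<Longrightarrow> Ck_on n k W (\<lambda>x. h m (f x))"
proof (induction k arbitrary: m)
  have cont: "continuous_on UNIV (h m)" for m
    using h DERIV_isCont continuous_at_imp_continuous_on by blast
  case 0
  then show ?case
    using continuous_map_compose[of _ euclideanreal f euclideanreal "h m"] cont by (simp add: comp_def)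
next
  case (Suc k)
  show ?case
  proof (rule Ck_on_SucI[OF W])
    have cont: "continuous_on UNIV (h m)"
      using h DERIV_isCont continuous_at_imp_continuous_on by blast
    show "continuous_on W (\<lambda>x. h m (f x))"
      using continuous_on_compose2[OF cont Ck_on_imp_continuous_on[OF W Suc.prems]] by simp
    show "((\<lambda>t. h m (f (x(i := t)))) has_real_derivative h (Suc m) (f x) * partial_deriv i f x) (at (x i))"
      if "i < n" "x \<in> W" for i x
      by (rule DERIV_cong[OF DERIV_chain2[OF h Ck_on_SucD(2)[OF Suc.prems that]]]) simp
    show "Ck_on n k W (\<lambda>x. h (Suc m) (f x) * partial_deriv i f x)" if "i < n" for i
      using Suc.prems[THEN Ck_on_mono] Suc.prems[THEN Ck_on_SucD(1), OF that]
      by (intro Ck_on_mult[OF W] Suc.IH)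
  qed
qed

lemma smooth_on_const: "openin (Euclidean_space n) W \<Longrightarrow> smooth_on n W (\<lambda>x. c)"
  and smooth_on_coord: "openin (Euclidean_space n) W \<Longrightarrow> smooth_on n W (\<lambda>x. x j)"
  and smooth_on_add: "\<lbrakk>openin (Euclidean_space n) W; smooth_on n W f; smooth_on n W g\<rbrakk>
    \<Longrightarrow> smooth_on n W (\<lambda>x. f x + g x)"
  and smooth_on_mult: "\<lbrakk>openin (Euclidean_space n) W; smooth_on n W f; smooth_on n W g\<rbrakk>
    \<Longrightarrow> smooth_on n W (\<lambda>x. f x * g x)"
  and smooth_on_inverse: "\<lbrakk>openin (Euclidean_space n) W; smooth_on n W f; \<And>x. x \<in> W \<Longrightarrow> f x \<noteq> 0\<rbrakk>
    \<Longrightarrow> smooth_on n W (\<lambda>x. inverse (f x))"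
  by (simp_all add: smooth_on_def Ck_on_const Ck_on_coord Ck_on_add Ck_on_mult Ck_on_inverse)

lemma smooth_on_minus:
  "openin (Euclidean_space n) W \<Longrightarrow> smooth_on n W f \<Longrightarrow> smooth_on n W (\<lambda>x. - f x)"
  using smooth_on_mult[OF _ smooth_on_const[of n W "- 1"], of f] by simp

lemma smooth_on_diff:
  "\<lbrakk>openin (Euclidean_space n) W; smooth_on n W f; smooth_on n W g\<rbrakk> \<Longrightarrow> smooth_on n W (\<lambda>x. f x - g x)"
  using smooth_on_add[OF _ _ smooth_on_minus, of n W f g] by simp

lemma smooth_on_divide:
  "\<lbrakk>openin (Euclidean_space n) W; smooth_on n W f; smooth_on n W g; \<And>x. x \<in> W \<Longrightarrow> g x \<noteq> 0\<rbrakk>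
    \<Longrightarrow> smooth_on n W (\<lambda>x. f x / g x)"
  using smooth_on_mult[OF _ _ smooth_on_inverse, of n W f g] by (simp add: divide_inverse)

lemma smooth_on_sum:
  "\<lbrakk>openin (Euclidean_space n) W; \<And>i. i \<in> I \<Longrightarrow> smooth_on n W (f i)\<rbrakk>
    \<Longrightarrow> smooth_on n W (\<lambda>x. \<Sum>i\<in>I. f i x)"
  by (induction I rule: infinite_finite_induct) (simp_all add: smooth_on_const smooth_on_add)

lemma smooth_on_cong:
  "\<lbrakk>openin (Euclidean_space n) W; \<And>x. x \<in> W \<Longrightarrow> f x = g x\<rbrakk> \<Longrightarrow> smooth_on n W f \<longleftrightarrow> smooth_on n W g"
  unfolding smooth_on_def using Ck_on_cong by blast

lemma smooth_on_imp_continuous_on: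
  "openin (Euclidean_space n) W \<Longrightarrow> smooth_on n W f \<Longrightarrow> continuous_on W f"
  unfolding smooth_on_def using Ck_on_imp_continuous_on by blast

lemma smooth_on_partial_deriv: "smooth_on n W f \<Longrightarrow> i < n \<Longrightarrow> smooth_on n W (partial_deriv i f)"
  unfolding smooth_on_def using Ck_on_SucD(1) by blast

lemma smooth_on_has_partial_deriv:
  "\<lbrakk>smooth_on n W f; i < n; x \<in> W\<rbrakk>
    \<Longrightarrow> ((\<lambda>t. f (x(i := t))) has_real_derivative partial_deriv i f x) (at (x i))"
  unfolding smooth_on_def using Ck_on_SucD(2) by blast

section \<open>Bump functions and integrals depending on a parameter\<close>

text \<open>For P = 1 this is the classical function that is flat at 0. The polynomial factor in 1 /
  t makes the family closed under differentiation.\<close>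

definition flat_exp :: "real poly \<Rightarrow> real \<Rightarrow> real" where
  "flat_exp P t = (if t > 0 then poly P (1 / t) * exp (- (1 / t)) else 0)"

lemma poly_times_exp_minus_tendsto_0: "((\<lambda>x. poly P x * exp (- x)) \<longlongrightarrow> (0::real)) at_top"
proof -
  have "((\<lambda>x. coeff P i * (x ^ i / exp x)) \<longlongrightarrow> 0) at_top" for i
    using tendsto_mult[OF tendsto_const tendsto_power_div_exp_0] by simp
  then have "((\<lambda>x. \<Sum>i\<le>degree P. coeff P i * (x ^ i / exp x)) \<longlongrightarrow> (\<Sum>i\<le>degree P. 0)) at_top"
    by (intro tendsto_sum)
  moreover have "poly P x * exp (- x) = (\<Sum>i\<le>degree P. coeff P i * (x ^ i / exp x))" for x
    by (simp add: poly_altdef sum_distrib_right exp_minus divide_inverse mult.assoc)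
  ultimately show ?thesis
    by simp
qed

lemma flat_exp_at_right_0: "(flat_exp P \<longlongrightarrow> 0) (at_right 0)"
proof -
  have "((\<lambda>t. poly P (inverse t) * exp (- inverse t)) \<longlongrightarrow> 0) (at_right 0)"
    using filterlim_compose[OF poly_times_exp_minus_tendsto_0 filterlim_inverse_at_top_right] .
  moreover have "\<forall>\<^sub>F t in at_right 0. poly P (inverse t) * exp (- inverse t) = flat_exp P t"
    using eventually_at_right_less[of "0::real"]
    by eventually_elim (simp add: flat_exp_def inverse_eq_divide)
  ultimately show ?thesis
    by (rule Lim_transform_eventually)
qed

text \<open>For t > 0 differentiation multiplies by t^-2 and replaces P by P - P', whence the factor
  \<open>[:0, 0, 1:]\<close> in the variable 1 / t. At 0 the right-hand difference quotient is
  \<open>flat_exp ([:0, 1:] * P)\<close>, which tends to 0.\<close>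

lemma flat_exp_has_derivative:
  "(flat_exp P has_real_derivative flat_exp ([:0, 0, 1:] * (P - pderiv P)) t) (at t)"
proof (cases "t = 0")
  case True
  have "((\<lambda>h. flat_exp P h / h) \<longlongrightarrow> 0) (at_right 0)"
  proof -
    have "\<forall>\<^sub>F h in at_right 0. flat_exp ([:0, 1:] * P) h = flat_exp P h / h"
      using eventually_at_right_less[of "0::real"]
      by eventually_elim (simp add: flat_exp_def)
    with flat_exp_at_right_0 show ?thesis
      by (rule Lim_transform_eventually)
  qed
  moreover have "((\<lambda>h. flat_exp P h / h) \<longlongrightarrow> 0) (at_left 0)"
  proof -
    have "\<forall>\<^sub>F h in at_left (0::real). 0 = flat_exp P h / h"
      unfolding eventually_at_filter by (simp add: flat_exp_def)
    then show ?thesis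
      by (rule Lim_transform_eventually[OF tendsto_const])
  qed
  ultimately have "((\<lambda>h. flat_exp P h / h) \<longlongrightarrow> 0) (at 0)"
    by (rule filterlim_split_at[rotated])
  then show ?thesis
    unfolding True DERIV_def by (simp add: flat_exp_def)
next
  case False
  show ?thesis
  proof (cases "t > 0")
    case True
    have "((\<lambda>t. poly P (1 / t) * exp (- (1 / t))) has_real_derivative
        flat_exp ([:0, 0, 1:] * (P - pderiv P)) t) (at t)"
    proof -
      have inv: "((\<lambda>t. 1 / t) has_real_derivative - (1 / t\<^sup>2)) (at t)"
        using True by (auto intro!: derivative_eq_intros simp: power2_eq_square)
      have "((\<lambda>t. poly P (1 / t)) has_real_derivative poly (pderiv P) (1 / t) * - (1 / t\<^sup>2)) (at t)"
        by (rule DERIV_chain2[OF poly_DERIV inv])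
      moreover have "((\<lambda>t. exp (- (1 / t))) has_real_derivative exp (- (1 / t)) * (1 / t\<^sup>2)) (at t)"
        by (rule DERIV_chain2[OF DERIV_exp]) (use DERIV_minus[OF inv] in simp)
      ultimately have "((\<lambda>t. poly P (1 / t) * exp (- (1 / t))) has_real_derivative
          poly (pderiv P) (1 / t) * - (1 / t\<^sup>2) * exp (- (1 / t)) +
          exp (- (1 / t)) * (1 / t\<^sup>2) * poly P (1 / t)) (at t)"
        by (rule DERIV_mult)
      moreover have "flat_exp ([:0, 0, 1:] * (P - pderiv P)) t =
          (1 / t) * ((1 / t) * (poly P (1 / t) - poly (pderiv P) (1 / t))) * exp (- (1 / t))"
        using True by (simp add: flat_exp_def)
      moreover have "poly (pderiv P) (1 / t) * - (1 / t\<^sup>2) * exp (- (1 / t)) +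
          exp (- (1 / t)) * (1 / t\<^sup>2) * poly P (1 / t) =
          (1 / t) * ((1 / t) * (poly P (1 / t) - poly (pderiv P) (1 / t))) * exp (- (1 / t))"
        by (simp add: algebra_simps power2_eq_square diff_divide_distrib)
      ultimately show ?thesis
        by simp
    qed
    moreover have ev: "\<forall>\<^sub>F s in nhds t. flat_exp P s = poly P (1 / s) * exp (- (1 / s))"
      by (rule eventually_mono[OF eventually_nhds_in_open[OF open_greaterThan[of 0]]])
        (use True in \<open>auto simp: flat_exp_def\<close>)
    ultimately show ?thesis
      by (simp only: DERIV_cong_ev[OF refl ev refl])
  next
    case neg: False
    have ev: "\<forall>\<^sub>F s in nhds t. flat_exp P s = 0"
      by (rule eventually_mono[OF eventually_nhds_in_open[OF open_lessThan[of 0]]])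
        (use neg False in \<open>auto simp: flat_exp_def\<close>)
    have "(flat_exp P has_real_derivative 0) (at t)"
      using DERIV_cong_ev[OF refl ev refl, of 0] by simp
    then show ?thesis
      using neg by (simp add: flat_exp_def)
  qed
qed

lemma smooth_on_flat_exp:
  assumes "openin (Euclidean_space n) W" "smooth_on n W f"
  shows "smooth_on n W (\<lambda>x. flat_exp P (f x))"
proof -
  define step :: "real poly \<Rightarrow> real poly" where "step P = [:0, 0, 1:] * (P - pderiv P)" for P
  have "(flat_exp ((step ^^ m) P) has_real_derivative flat_exp ((step ^^ Suc m) P) t) (at t)" for m t
    using flat_exp_has_derivative[of "(step ^^ m) P" t] unfolding step_def[symmetric] by simp
  from Ck_on_compose_real[OF assms(1), of "\<lambda>m. flat_exp ((step ^^ m) P)", OF this, where m = 0]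
  show ?thesis
    using assms(2) unfolding smooth_on_def by simp
qed

section \<open>Balls and contractions towards their centre\<close>

definition sqdist :: "nat \<Rightarrow> (nat \<Rightarrow> real) \<Rightarrow> (nat \<Rightarrow> real) \<Rightarrow> real" where
  "sqdist n p x = (\<Sum>i<n. (x i - p i)\<^sup>2)"

text \<open>\<open>\<rho>\<close> is the square of the radius: the squared distance is a polynomial
  and hence smooth, also at the centre.\<close>

definition eball :: "nat \<Rightarrow> (nat \<Rightarrow> real) \<Rightarrow> real \<Rightarrow> (nat \<Rightarrow> real) set" where
  "eball n p \<rho> = {x \<in> topspace (Euclidean_space n). sqdist n p x < \<rho>}"

lemma openin_vimage_real:
  fixes f :: "(nat \<Rightarrow> real) \<Rightarrow> real"
  assumes "openin (Euclidean_space n) W" "continuous_on W f" "open S"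
  shows "openin (Euclidean_space n) {x \<in> W. f x \<in> S}"
proof -
  have "subtopology (Euclidean_space n) W = top_of_set W"
    using openin_subset[OF assms(1)]
    by (metis Euclidean_space_eq_top_of_set inf.absorb_iff2 subtopology_subtopology)
  then have "openin (subtopology (Euclidean_space n) W) (W \<inter> f -` S)"
    using assms by (simp add: continuous_openin_preimage_gen)
  then have "openin (Euclidean_space n) (W \<inter> f -` S)"
    using assms(1) by (rule openin_trans_full)
  moreover have "W \<inter> f -` S = {x \<in> W. f x \<in> S}" by auto
  ultimately show ?thesis by simp
qed

lemma smooth_on_sqdist: "openin (Euclidean_space n) W \<Longrightarrow> smooth_on n W (sqdist n p)"
  unfolding sqdist_def[abs_def] power2_eq_square
  by (intro smooth_on_sum smooth_on_mult smooth_on_diff smooth_on_coord smooth_on_const)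

lemma openin_eball: "openin (Euclidean_space n) (eball n p \<rho>)"
proof -
  have "openin (Euclidean_space n) (topspace (Euclidean_space n))" by simp
  from openin_vimage_real[OF this smooth_on_imp_continuous_on[OF this smooth_on_sqdist[OF this]] open_lessThan]
  show ?thesis by (simp add: eball_def)
qed

text \<open>A basic open set of the product topology bounds each coordinate separately. All
  coordinates from n on vanish, so the smallest of the first n bounds gives the radius.\<close>

lemma eball_exists:
  assumes W: "openin (Euclidean_space n) W" and p: "p \<in> W"
  obtains \<rho> where "\<rho> > 0" "eball n p \<rho> \<subseteq> W"
proof -
  obtain T where T: "open T" "W = topspace (Euclidean_space n) \<inter> T"
    using W by (metis Euclidean_space_eq_top_of_set openin_open)
  have "openin (powertop_real UNIV) T"
    using T(1) by (simp add: euclidean_product_topology)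
  then obtain X where X: "p \<in> Pi\<^sub>E UNIV X" "\<And>i. open (X i)" "finite {i. X i \<noteq> UNIV}" "Pi\<^sub>E UNIV X \<subseteq> T"
    using p T(2) product_topology_open_contains_basis[of "\<lambda>i. euclideanreal" UNIV T p] by auto
  have "\<exists>e>0. ball (p i) e \<subseteq> X i" for i
    using X(1,2) open_contains_ball by (metis PiE_E iso_tuple_UNIV_I)
  then obtain e where e: "\<And>i. e i > 0" "\<And>i. ball (p i) (e i) \<subseteq> X i"
    by metis
  \<comment> \<open>The inserted 1 keeps the minimum defined for n = 0.\<close>
  define r where "r = Min (insert 1 (e ` {..<n}))"
  have r: "r > 0" "\<And>i. i < n \<Longrightarrow> r \<le> e i"
    using e(1) by (auto simp: r_def)
  have "eball n p (r\<^sup>2) \<subseteq> W"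
  proof
    fix x assume x: "x \<in> eball n p (r\<^sup>2)"
    have "x i \<in> X i" for i
    proof (cases "i < n")
      case True
      have "(x i - p i)\<^sup>2 \<le> sqdist n p x"
        unfolding sqdist_def using True by (intro member_le_sum) auto
      then have "(x i - p i)\<^sup>2 < r\<^sup>2"
        using x by (simp add: eball_def)
      then have "\<bar>x i - p i\<bar> < r"
        using r(1) power_less_imp_less_base[of "\<bar>x i - p i\<bar>" 2 r] by simp
      then have "x i \<in> ball (p i) (e i)"
        using r(2)[OF True] by (simp add: dist_real_def)
      then show ?thesis using e by blast
    next
      case False
      then have "x i = p i"
        using x p T(2) by (auto simp: eball_def topspace_Euclidean_space)
      then show ?thesis using e[of i] by (metis centre_in_ball subsetD)
    qed
    then show "x \<in> W"
      using X(4) x T(2) by (auto simp: eball_def)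
  qed
  with r(1) show thesis by (intro that[of "r\<^sup>2"]) auto
qed

text \<open>Each coordinate has its own factor, so that also the axis-parallel path from
  \<open>p\<close> to \<open>x\<close>, which moves one coordinate after the other, consists of such
  contractions.\<close>

definition contract :: "(nat \<Rightarrow> real) \<Rightarrow> (nat \<Rightarrow> real \<Rightarrow> real) \<Rightarrow> (nat \<Rightarrow> real) \<Rightarrow> real \<Rightarrow> nat \<Rightarrow> real" where
  "contract p c x t = (\<lambda>j. p j + c j t * (x j - p j))"

lemma contract_in_eball:
  assumes "p \<in> topspace (Euclidean_space n)" "x \<in> eball n p \<rho>" "\<And>j. 0 \<le> c j t \<and> c j t \<le> 1"
  shows "contract p c x t \<in> eball n p \<rho>"
proof -
  have "(c j t * (x j - p j))\<^sup>2 \<le> (x j - p j)\<^sup>2" for j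
  proof -
    have "(c j t)\<^sup>2 * (x j - p j)\<^sup>2 \<le> 1 * (x j - p j)\<^sup>2"
      using assms(3)[of j] by (intro mult_right_mono) (auto simp: power_le_one)
    then show ?thesis by (simp add: power_mult_distrib)
  qed
  then have "sqdist n p (contract p c x t) \<le> sqdist n p x"
    unfolding sqdist_def contract_def by (intro sum_mono) simp
  then show ?thesis
    using assms(1,2) by (auto simp: eball_def topspace_Euclidean_space contract_def)
qed

lemma continuous_on_contract:
  assumes "\<And>j. continuous_on {0..1} (c j)"
  shows "continuous_on (S \<times> {0..1}) (\<lambda>(x, t). contract p c x t)"
proof (rule continuous_on_coordinatewise_then_product)
  fix j
  have "continuous_on (S \<times> {0..1}) (\<lambda>z. c j (snd z))"
    by (intro continuous_on_compose2[OF assms continuous_on_snd]) (auto intro: continuous_intros)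
  moreover have "continuous_on (S \<times> {0..1}) (\<lambda>z. fst z j)"
    by (rule continuous_on_compose2[where g = "\<lambda>x. x j" and f = fst and t = UNIV])
      (auto intro: continuous_intros continuous_on_product_coordinates)
  ultimately show "continuous_on (S \<times> {0..1}) (\<lambda>z. (case z of (x, t) \<Rightarrow> contract p c x t) j)"
    unfolding contract_def split_beta
    by (intro continuous_on_add continuous_on_mult continuous_on_diff continuous_on_const)
qed

text \<open>Differentiation under the integral sign in the direction i produces the inner factor
  \<open>c i t\<close>. It is absorbed into the weight, which is why the induction varies
  \<open>w\<close> together with \<open>h\<close>.\<close>

lemma Ck_on_contract_integral:
  assumes p: "p \<in> topspace (Euclidean_space n)"
    and c: "\<And>j. continuous_on {0..1} (c j)" "\<And>j t. t \<in> {0..1} \<Longrightarrow> 0 \<le> c j t \<and> c j t \<le> 1"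
  shows "Ck_on n k (eball n p \<rho>) h \<Longrightarrow> continuous_on {0..1} w \<Longrightarrow>
    Ck_on n k (eball n p \<rho>) (\<lambda>x. integral {0..1} (\<lambda>t. w t * h (contract p c x t)))"
proof (induction k arbitrary: h w)
  note B = openin_eball[of n p \<rho>]
  have cont: "continuous_on (eball n p \<rho> \<times> {0..1}) (\<lambda>(x, t). w t * h (contract p c x t))"
    if "continuous_on (eball n p \<rho>) h" "continuous_on {0..1} w" for h w :: "_ \<Rightarrow> real"
  proof -
    have "continuous_on (eball n p \<rho> \<times> {0..1}) (\<lambda>z. h (case z of (x, t) \<Rightarrow> contract p c x t))"
      by (intro continuous_on_compose2[OF that(1) continuous_on_contract[OF c(1)]])
        (auto intro!: contract_in_eball[OF p] c(2))
    moreover have "continuous_on (eball n p \<rho> \<times> {0..1}) (\<lambda>z. w (snd z))"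
      by (intro continuous_on_compose2[OF that(2) continuous_on_snd]) (auto intro: continuous_intros)
    ultimately show ?thesis
      unfolding split_beta by (intro continuous_on_mult)
  qed
  have cont_int: "continuous_on (eball n p \<rho>) (\<lambda>x. integral {0..1} (\<lambda>t. w t * h (contract p c x t)))"
    if "continuous_on (eball n p \<rho>) h" "continuous_on {0..1} w" for h w :: "_ \<Rightarrow> real"
    using integral_continuous_on_param[of "eball n p \<rho>" 0 1 "\<lambda>x t. w t * h (contract p c x t)"] cont[OF that]
    by (simp add: cbox_interval)
  {
    case 0
    then show ?case
      using cont_int[of h w] continuous_map_Euclidean_space_subtopology[OF openin_subset[OF B]] by simp
  next
    case (Suc k)
    note hcont = Ck_on_imp_continuous_on[OF B Suc.prems(1)]
    show ?case
    proof (rule Ck_on_SucI[OF B cont_int[OF hcont Suc.prems(2)]])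
      fix i x assume i: "i < n" and x: "x \<in> eball n p \<rho>"
      obtain e where e: "e > 0" "ball (x i) e \<subseteq> {\<tau>. x(i := \<tau>) \<in> eball n p \<rho>}"
        by (rule openE[OF open_fun_upd_vimage[OF B x i], of "x i"]) (use x in auto)
      let ?F = "\<lambda>\<tau> t. w t * h (contract p c (x(i := \<tau>)) t)"
      let ?G = "\<lambda>\<tau> t. (w t * c i t) * partial_deriv i h (contract p c (x(i := \<tau>)) t)"
      have upd: "continuous_on (ball (x i) e \<times> {0..1}) (\<lambda>(\<tau>, t). (x(i := \<tau>), t))"
        unfolding split_beta
        by (intro continuous_on_Pair continuous_on_compose2[OF continuous_on_fun_upd continuous_on_fst] continuous_intros) auto
      have G: "continuous_on (ball (x i) e \<times> {0..1}) (\<lambda>(\<tau>, t). ?G \<tau> t)"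
      proof -
        have "continuous_on (eball n p \<rho>) (partial_deriv i h)"
          using Ck_on_imp_continuous_on[OF B Ck_on_SucD(1)[OF Suc.prems(1) i]] .
        moreover have "continuous_on {0..1} (\<lambda>t. w t * c i t)"
          using Suc.prems c by (intro continuous_intros)
        ultimately have "continuous_on (eball n p \<rho> \<times> {0..1})
            (\<lambda>(x, t). (w t * c i t) * partial_deriv i h (contract p c x t))"
          by (rule cont)
        moreover have "(\<lambda>(\<tau>, t). (x(i := \<tau>), t)) ` (ball (x i) e \<times> {0..1}) \<subseteq> eball n p \<rho> \<times> {0..1}"
          using e(2) by (auto dest: subsetD)
        ultimately show ?thesis
          using continuous_on_compose2[OF _ upd] by (fastforce simp: split_beta)
      qed
      have "((\<lambda>\<tau>. integral (cbox 0 1) (?F \<tau>)) has_real_derivative integral (cbox 0 1) (?G (x i)))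
          (at (x i) within ball (x i) e)"
      proof (rule leibniz_rule_field_derivative[where f = ?F and fx = ?G])
        fix \<tau> t assume \<tau>: "\<tau> \<in> ball (x i) e" and "t \<in> cbox 0 (1::real)"
        then have t: "t \<in> {0..1}" by simp
        define y where "y = contract p c (x(i := \<tau>)) t"
        have y: "y \<in> eball n p \<rho>"
          unfolding y_def using \<tau> e(2) c(2)[OF t] by (intro contract_in_eball[OF p]) auto
        have yi: "contract p c (x(i := s)) t = y(i := p i + c i t * (s - p i))" for s
          by (auto simp: y_def contract_def)
        have y_i: "p i + c i t * (\<tau> - p i) = y i" by (simp add: y_def contract_def)
        have h': "((\<lambda>s. h (y(i := s))) has_real_derivative partial_deriv i h y) (at (p i + c i t * (\<tau> - p i)))"
          unfolding y_i by (rule Ck_on_SucD(2)[OF Suc.prems(1) i y])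
        have "((\<lambda>s. p i + c i t * (s - p i)) has_real_derivative c i t) (at \<tau>)"
          by (auto intro!: derivative_eq_intros)
        from DERIV_chain2[where f = "\<lambda>s. h (y(i := s))", OF h' this]
        have "((\<lambda>s. h (y(i := p i + c i t * (s - p i)))) has_real_derivative partial_deriv i h y * c i t) (at \<tau>)" .
        then have "((\<lambda>s. h (contract p c (x(i := s)) t)) has_real_derivative partial_deriv i h y * c i t) (at \<tau>)"
          using yi by presburger
        from DERIV_cmult[OF this, of "w t"]
        have "((\<lambda>\<tau>. ?F \<tau> t) has_real_derivative ?G \<tau> t) (at \<tau>)"
          unfolding y_def by (rule DERIV_cong) (simp only: ab_semigroup_mult_class.mult_ac)
        then show "((\<lambda>\<tau>. ?F \<tau> t) has_real_derivative ?G \<tau> t) (at \<tau> within ball (x i) e)"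
          by (rule has_field_derivative_at_within)
      next
        fix \<tau> assume "\<tau> \<in> ball (x i) e"
        then have "x(i := \<tau>) \<in> eball n p \<rho>" using e by auto
        then have "(\<lambda>t. (x(i := \<tau>), t)) ` {0..1} \<subseteq> eball n p \<rho> \<times> {0..1}"
          by auto
        moreover have "continuous_on {0..1} (\<lambda>t. (x(i := \<tau>), t))"
          by (intro continuous_on_Pair continuous_on_const continuous_on_id)
        ultimately have "continuous_on {0..1} (?F \<tau>)"
          using continuous_on_compose2[OF cont[OF hcont Suc.prems(2)]] by fastforce
        then show "?F \<tau> integrable_on cbox 0 1"
          by (simp add: integrable_continuous_interval)
      qed (use G e in auto)
      then show "((\<lambda>\<tau>. integral {0..1} (?F \<tau>)) has_real_derivative
          integral {0..1} (\<lambda>t. (w t * c i t) * partial_deriv i h (contract p c x t))) (at (x i))"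
        unfolding at_within_open[OF centre_in_ball[THEN iffD2, OF e(1)] open_ball]
        by (simp only: cbox_interval fun_upd_triv)
    next
      fix i assume i: "i < n"
      show "Ck_on n k (eball n p \<rho>)
          (\<lambda>x. integral {0..1} (\<lambda>t. (w t * c i t) * partial_deriv i h (contract p c x t)))"
        using Ck_on_SucD(1)[OF Suc.prems(1) i] Suc.prems(2) c
        by (intro Suc.IH continuous_intros)
    qed
  }
qed

section \<open>Tangent vectors of open submanifolds of Euclidean space\<close>

text \<open>The difference f x - f p is telescoped along the axis-parallel path from
  \<open>p\<close> to \<open>x\<close>. On each segment a single coordinate moves, so the
  fundamental theorem and the chain rule in one variable apply; the chain rule in several variables
  is itself deduced from this decomposition later.\<close>

lemma Hadamard:
  assumes p: "p \<in> topspace (Euclidean_space n)" and f: "smooth_on n (eball n p \<rho>) f"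
  obtains g where "\<And>i. i < n \<Longrightarrow> smooth_on n (eball n p \<rho>) (g i)"
    "\<And>x. x \<in> eball n p \<rho> \<Longrightarrow> f x = f p + (\<Sum>i<n. (x i - p i) * g i x)"
proof
  \<comment> \<open>On the i-th segment the coordinates before i are already those of
    \<open>x\<close>, those after i still those of \<open>p\<close>.\<close>
  define c :: "nat \<Rightarrow> nat \<Rightarrow> real \<Rightarrow> real" where "c i j t = (if j < i then 1 else if j = i then t else 0)" for i j t
  define g where "g i x = integral {0..1} (\<lambda>t. 1 * partial_deriv i f (contract p (c i) x t))" for i x
  have c: "continuous_on {0..1} (c i j)" "t \<in> {0..1} \<Longrightarrow> 0 \<le> c i j t \<and> c i j t \<le> 1" for i j t
  proof -
    consider "j < i" | "j = i" | "i < j" by linarith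
    then show "continuous_on {0..1} (c i j)"
      by cases (simp_all add: c_def[abs_def] continuous_on_id)
    show "t \<in> {0..1} \<Longrightarrow> 0 \<le> c i j t \<and> c i j t \<le> 1"
      by (simp add: c_def)
  qed
  show "smooth_on n (eball n p \<rho>) (g i)" if "i < n" for i
    unfolding smooth_on_def g_def
    using smooth_on_partial_deriv[OF f that] c
    by (intro allI Ck_on_contract_integral[OF p]) (auto simp: smooth_on_def)
  show "f x = f p + (\<Sum>i<n. (x i - p i) * g i x)" if x: "x \<in> eball n p \<rho>" for x
  proof -
    define y where "y i = (\<lambda>j. if j < i then x j else p j)" for i :: nat
    have y: "y 0 = p" "y n = x"
      using p x by (auto simp: y_def eball_def topspace_Euclidean_space)
    have step: "f (y (Suc i)) - f (y i) = (x i - p i) * g i x" if i: "i < n" for i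
    proof -
      have contr: "contract p (c i) x t = (y i)(i := p i + t * (x i - p i))" for t
        by (auto simp: contract_def y_def c_def)
      have deriv: "((\<lambda>t. f (contract p (c i) x t)) has_real_derivative
          (x i - p i) * partial_deriv i f (contract p (c i) x t)) (at t)" if t: "t \<in> {0..1}" for t
      proof -
        define z where "z = contract p (c i) x t"
        have z: "z \<in> eball n p \<rho>"
          unfolding z_def using c(2)[OF t] by (intro contract_in_eball[OF p x])
        have zi: "p i + t * (x i - p i) = z i"
          by (simp add: z_def contract_def c_def)
        have yz: "(y i)(i := s) = z(i := s)" for s
          by (simp add: z_def contr)
        have 1: "((\<lambda>s. f (z(i := s))) has_real_derivative partial_deriv i f z) (at (p i + t * (x i - p i)))"
          unfolding zi by (rule smooth_on_has_partial_deriv[OF f i z])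
        have 2: "((\<lambda>t. p i + t * (x i - p i)) has_real_derivative (x i - p i)) (at t)"
          by (auto intro!: derivative_eq_intros)
        from DERIV_chain2[where f = "\<lambda>s. f (z(i := s))", OF 1 2]
        have "((\<lambda>t. f (contract p (c i) x t)) has_real_derivative partial_deriv i f z * (x i - p i)) (at t)"
          unfolding contr yz .
        then show ?thesis
          unfolding z_def by (rule DERIV_cong) (rule mult.commute)
      qed
      have "((\<lambda>t. (x i - p i) * partial_deriv i f (contract p (c i) x t)) has_integral
          f (contract p (c i) x 1) - f (contract p (c i) x 0)) {0..1}"
        using deriv
        by (intro fundamental_theorem_of_calculus)
          (auto simp: has_real_derivative_iff_has_vector_derivative[symmetric] intro: has_field_derivative_at_within)
      then have "integral {0..1} (\<lambda>t. (x i - p i) * partial_deriv i f (contract p (c i) x t)) =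
          f (contract p (c i) x 1) - f (contract p (c i) x 0)"
        by (rule integral_unique)
      moreover have "contract p (c i) x 1 = y (Suc i)" "contract p (c i) x 0 = y i"
        by (auto simp: contr y_def)
      ultimately show ?thesis
        by (simp add: g_def)
    qed
    have "(\<Sum>i<n. (x i - p i) * g i x) = (\<Sum>i<n. f (y (Suc i)) - f (y i))"
      by (intro sum.cong) (simp_all add: step)
    also have "\<dots> = f x - f p"
      using sum_lessThan_telescope[of "\<lambda>i. f (y i)" n] by (simp only: y)
    finally show ?thesis by simp
  qed
qed

section \<open>Manifolds with the identity as their only chart\<close>

definition open_manifold :: "nat \<Rightarrow> (nat \<Rightarrow> real) set \<Rightarrow> (nat \<Rightarrow> real) manifold" where
  "open_manifold n W = \<lparr>mtop = subtopology (Euclidean_space n) W, mdim = n, matlas = {(W, \<lambda>x. x)}\<rparr>"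

lemma inv_into_ident [simp]: "x \<in> W \<Longrightarrow> inv_into W (\<lambda>x. x) x = x"
  using inv_into_f_f[of "\<lambda>x. x" W x] by (simp add: inj_on_def)

context
  fixes n :: nat and W :: "(nat \<Rightarrow> real) set"
  assumes W: "openin (Euclidean_space n) W"
begin

lemma topspace_open_manifold [simp]: "topspace (mtop (open_manifold n W)) = W"
  using openin_subset[OF W] by (auto simp: open_manifold_def)

lemma smooth_fun_open_manifold: "smooth_fun (open_manifold n W) f \<longleftrightarrow> smooth_on n W f"
  using smooth_on_cong[OF W, of "\<lambda>x. f (inv_into W (\<lambda>x. x) x)" f]
  by (simp add: smooth_fun_def open_manifold_def)

lemma mtop_open_manifold: "mtop (open_manifold n W) = top_of_set W"
  using openin_subset[OF W]
  by (simp add: open_manifold_def) (metis Euclidean_space_eq_top_of_set inf.absorb_iff2 subtopology_subtopology)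

lemma smooth_manifold_open_manifold: "smooth_manifold (open_manifold n W)"
proof -
  have "Hausdorff_space (top_of_set W)"
    by (intro Hausdorff_space_subtopology) simp
  moreover have "second_countable (top_of_set W)"
  proof -
    obtain \<B> :: "(nat \<Rightarrow> real) set set" where "countable \<B>" "topological_basis \<B>"
      using ex_countable_basis by blast
    then have "second_countable (euclidean :: (nat \<Rightarrow> real) topology)"
      unfolding second_countable_def
      by (intro exI[of _ \<B>]) (auto simp: topological_basis_open elim!: topological_basisE)
    then show ?thesis
      by (rule second_countable_subtopology)
  qed
  moreover have "smooth_on n W (\<lambda>x. inv_into W (\<lambda>x. x) x j)" for j
    using smooth_on_coord[OF W] smooth_on_cong[OF W, of "\<lambda>x. inv_into W (\<lambda>x. x) x j" "\<lambda>x. x j"] by simp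
  ultimately show ?thesis
    unfolding smooth_manifold_def using W mtop_open_manifold openin_subset[OF W]
    using homeomorphic_map_id[of "subtopology (Euclidean_space n) W" "subtopology (Euclidean_space n) W"] by (simp add: open_manifold_def id_def subtopology_subtopology)
qed

lemma tangent_space_open_manifold:
  "v \<in> tangent_space (open_manifold n W) p \<longleftrightarrow>
     (\<forall>f. \<not> smooth_on n W f \<longrightarrow> v f = 0) \<and>
     (\<forall>f g a. smooth_on n W f \<and> smooth_on n W g \<longrightarrow> v (\<lambda>q. a * f q + g q) = a * v f + v g) \<and>
     (\<forall>f g. smooth_on n W f \<and> smooth_on n W g \<longrightarrow> v (\<lambda>q. f q * g q) = f p * v g + g p * v f)"
  by (simp add: tangent_space_def smooth_fun_open_manifold)

context
  fixes p u
  assumes u: "u \<in> tangent_space (open_manifold n W) p" and p: "p \<in> W"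
begin

lemma derivation_mult:
  "smooth_on n W f \<Longrightarrow> smooth_on n W g \<Longrightarrow> u (\<lambda>q. f q * g q) = f p * u g + g p * u f"
  using u by (simp add: tangent_space_open_manifold)

lemma derivation_add: "smooth_on n W f \<Longrightarrow> smooth_on n W g \<Longrightarrow> u (\<lambda>q. f q + g q) = u f + u g"
proof -
  assume fg: "smooth_on n W f" "smooth_on n W g"
  then have "u (\<lambda>q. 1 * f q + g q) = 1 * u f + u g"
    using u unfolding tangent_space_open_manifold by blast
  then show ?thesis by simp
qed

lemma derivation_const [simp]: "u (\<lambda>q. c) = 0"
proof -
  note S = smooth_on_const[OF W]
  have "u (\<lambda>q. 1 * 1) = 1 * u (\<lambda>q. 1) + 1 * u (\<lambda>q. 1)"
    by (rule derivation_mult[OF S S])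
  then have 1: "u (\<lambda>q. 1) = 0" by simp
  have "u (\<lambda>q. 0 + 0) = u (\<lambda>q. 0) + u (\<lambda>q. 0)"
    by (rule derivation_add[OF S S])
  then have 0: "u (\<lambda>q. 0) = 0" by simp
  have "u (\<lambda>q. c * 1 + 0) = c * u (\<lambda>q. 1) + u (\<lambda>q. 0)"
    using u S unfolding tangent_space_open_manifold by blast
  then show ?thesis using 0 1 by simp
qed

lemma derivation_cmult: "smooth_on n W f \<Longrightarrow> u (\<lambda>q. c * f q) = c * u f"
  using derivation_mult[OF smooth_on_const[OF W], of f c] by simp

lemma derivation_minus: "smooth_on n W f \<Longrightarrow> u (\<lambda>q. - f q) = - u f"
  using derivation_cmult[of f "- 1"] by simp

lemma derivation_diff: "smooth_on n W f \<Longrightarrow> smooth_on n W g \<Longrightarrow> u (\<lambda>q. f q - g q) = u f - u g"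
  using derivation_add[OF _ smooth_on_minus[OF W], of f g] derivation_minus[of g] by simp

lemma derivation_sum:
  assumes "\<And>i. i \<in> I \<Longrightarrow> smooth_on n W (f i)"
  shows "u (\<lambda>q. \<Sum>i\<in>I. f i q) = (\<Sum>i\<in>I. u (f i))"
  using assms
proof (induction I rule: infinite_finite_induct)
  case (insert i I)
  then have "u (\<lambda>q. f i q + (\<Sum>i\<in>I. f i q)) = u (f i) + u (\<lambda>q. \<Sum>i\<in>I. f i q)"
    by (intro derivation_add smooth_on_sum[OF W]) auto
  then show ?case using insert by simp
qed simp_all

text \<open>The indicator function of the manifold is idempotent, so derivations kill it.\<close>

lemma derivation_cong:
  assumes f: "smooth_on n W f" and eq: "\<And>q. q \<in> W \<Longrightarrow> f q = g q"
  shows "u f = u g"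
proof -
  define e :: "(nat \<Rightarrow> real) \<Rightarrow> real" where "e q = of_bool (q \<in> W)" for q
  have e: "smooth_on n W e"
    using smooth_on_cong[OF W, of e "\<lambda>q. 1"] smooth_on_const[OF W, of 1] by (simp add: e_def)
  have g: "smooth_on n W g"
    using smooth_on_cong[OF W, of f g] eq f by simp
  have "e p = 1" using p by (simp add: e_def)
  have "u (\<lambda>q. e q * e q) = e p * u e + e p * u e"
    by (rule derivation_mult[OF e e])
  moreover have "(\<lambda>q. e q * e q) = e" by (auto simp: e_def)
  ultimately have "u e = 0" using \<open>e p = 1\<close> by simp
  then have "u (\<lambda>q. h q * e q) = u h" if "smooth_on n W h" for h
    using derivation_mult[OF that e] \<open>e p = 1\<close> by simp
  moreover have "(\<lambda>q. f q * e q) = (\<lambda>q. g q * e q)"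
    using eq by (auto simp: e_def)
  ultimately show ?thesis using f g by metis
qed

text \<open>Multiplying by a bump function turns Hadamard's local decomposition at \<open>p\<close> into a global one.\<close>

lemma derivation_eq_zero:
  assumes coord: "\<And>i. i < n \<Longrightarrow> u (\<lambda>q. q i) = 0"
  shows "u = (\<lambda>f. 0)"
proof
  fix f show "u f = 0"
  proof (cases "smooth_on n W f")
    case False
    then show ?thesis using u by (simp add: tangent_space_open_manifold)
  next
    case f: True
    obtain \<rho> where \<rho>: "\<rho> > 0" "eball n p \<rho> \<subseteq> W"
      using eball_exists[OF W p] .
    have pE: "p \<in> topspace (Euclidean_space n)"
      using p openin_subset[OF W] by blast
    have fB: "smooth_on n (eball n p \<rho>) f"
      using f Ck_on_subset[OF W \<rho>(2)] by (auto simp: smooth_on_def)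
    obtain g where g: "\<And>i. i < n \<Longrightarrow> smooth_on n (eball n p \<rho>) (g i)"
      "\<And>x. x \<in> eball n p \<rho> \<Longrightarrow> f x = f p + (\<Sum>i<n. (x i - p i) * g i x)"
      using Hadamard[OF pE fB] by metis
    \<comment> \<open>A bump function that vanishes outside the ball of squared radius
      \<open>\<rho> / 2\<close>, so that its product with a smooth function on the larger ball
      extends smoothly by 0.\<close>
    define \<phi> where "\<phi> x = flat_exp 1 (\<rho> / 2 - sqdist n p x)" for x
    have \<phi>: "smooth_on n V \<phi>" if "openin (Euclidean_space n) V" for V
      unfolding \<phi>_def[abs_def] using that
      by (intro smooth_on_flat_exp smooth_on_diff smooth_on_const smooth_on_sqdist)
    have \<phi>0: "\<phi> x = 0" if "sqdist n p x > \<rho> / 2" for x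
      using that by (simp add: \<phi>_def flat_exp_def)
    have \<phi>p: "\<phi> p > 0"
      using \<rho>(1) by (simp add: \<phi>_def flat_exp_def sqdist_def)
    define G where "G i x = (if x \<in> eball n p \<rho> then \<phi> x * g i x else 0)" for i x
    have G: "smooth_on n W (G i)" if i: "i < n" for i
      unfolding smooth_on_def
    proof (intro allI Ck_on_local[OF W])
      fix k x assume x: "x \<in> W"
      show "\<exists>V. openin (Euclidean_space n) V \<and> x \<in> V \<and> Ck_on n k V (G i)"
      proof (cases "x \<in> eball n p \<rho>")
        case True
        have "smooth_on n (eball n p \<rho>) (\<lambda>x. \<phi> x * g i x)"
          using smooth_on_mult[OF openin_eball \<phi>[OF openin_eball] g(1)[OF i]] .
        then have "smooth_on n (eball n p \<rho>) (G i)"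
          using smooth_on_cong[OF openin_eball[of n p \<rho>], of "G i" "\<lambda>x. \<phi> x * g i x"] by (simp add: G_def)
        then show ?thesis
          using True openin_eball unfolding smooth_on_def by blast
      next
        case False
        define V where "V = {x \<in> W. sqdist n p x \<in> {\<rho> / 2<..}}"
        have V: "openin (Euclidean_space n) V"
          unfolding V_def
          by (rule openin_vimage_real[OF W smooth_on_imp_continuous_on[OF W smooth_on_sqdist[OF W]] open_greaterThan])
        have "x \<in> V"
          using x False \<rho>(1) openin_subset[OF W] by (auto simp: V_def eball_def)
        moreover have "smooth_on n V (G i)"
          using smooth_on_cong[OF V, of "G i" "\<lambda>x. 0"] smooth_on_const[OF V, of 0] \<phi>0
          by (simp add: G_def V_def)
        ultimately show ?thesis
          using V unfolding smooth_on_def by blast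
      qed
    qed
    note S = smooth_on_const[OF W] smooth_on_coord[OF W] \<phi>[OF W] G f
    have xG: "smooth_on n W (\<lambda>q. (q i - p i) * G i q)" if "i < n" for i
      using that by (intro smooth_on_mult[OF W] smooth_on_diff[OF W] S)
    have "\<phi> x * f x = f p * \<phi> x + (\<Sum>i<n. (x i - p i) * G i x)" if "x \<in> W" for x
    proof (cases "x \<in> eball n p \<rho>")
      case True
      then have "\<phi> x * f x = \<phi> x * (f p + (\<Sum>i<n. (x i - p i) * g i x))"
        using g(2) by metis
      then show ?thesis
        using True by (simp add: G_def algebra_simps sum_distrib_left)
    next
      case False
      then have "\<phi> x = 0"
        using that \<rho>(1) openin_subset[OF W] by (intro \<phi>0) (auto simp: eball_def)
      then show ?thesis using False by (simp add: G_def)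
    qed
    then have "u (\<lambda>q. \<phi> q * f q) = u (\<lambda>q. f p * \<phi> q + (\<Sum>i<n. (q i - p i) * G i q))"
      by (intro derivation_cong smooth_on_mult[OF W] S)
    also have "\<dots> = u (\<lambda>q. f p * \<phi> q) + u (\<lambda>q. \<Sum>i<n. (q i - p i) * G i q)"
      by (rule derivation_add[OF smooth_on_mult[OF W S(1) S(3)] smooth_on_sum[OF W]]) (use xG in auto)
    also have "u (\<lambda>q. f p * \<phi> q) = f p * u \<phi>"
      by (intro derivation_cmult S)
    also have "u (\<lambda>q. \<Sum>i<n. (q i - p i) * G i q) = (\<Sum>i<n. u (\<lambda>q. (q i - p i) * G i q))"
      using xG by (intro derivation_sum) auto
    also have "\<dots> = (\<Sum>i<n. 0)"
    proof (rule sum.cong[OF refl])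
      fix i assume "i \<in> {..<n}"
      then have i: "i < n" by simp
      have "u (\<lambda>q. (q i - p i) * G i q) = (p i - p i) * u (G i) + G i p * u (\<lambda>q. q i - p i)"
        using i by (intro derivation_mult smooth_on_diff[OF W] S)
      also have "u (\<lambda>q. q i - p i) = u (\<lambda>q. q i) - u (\<lambda>q. p i)"
        by (intro derivation_diff S)
      finally show "u (\<lambda>q. (q i - p i) * G i q) = 0"
        using coord[OF i] by simp
    qed
    finally have "u (\<lambda>q. \<phi> q * f q) = f p * u \<phi>" by simp
    \<comment> \<open>Both evaluations of \<open>u\<close> at \<phi> f contain the term f p * u
      \<phi>; it cancels, and \<phi> p > 0 leaves u f = 0.\<close>
    moreover have "u (\<lambda>q. \<phi> q * f q) = \<phi> p * u f + f p * u \<phi>"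
      by (intro derivation_mult S)
    ultimately show ?thesis using \<phi>p by simp
  qed
qed

end

lemma coord_vec_tangent:
  assumes i: "i < n" and p: "p \<in> W"
  shows "coord_vec (open_manifold n W) (W, \<lambda>x. x) i p \<in> tangent_space (open_manifold n W) p"
    and "smooth_on n W f \<Longrightarrow> coord_vec (open_manifold n W) (W, \<lambda>x. x) i p f = partial_deriv i f p"
proof -
  have eq: "coord_vec (open_manifold n W) (W, \<lambda>x. x) i p f = partial_deriv i f p" if "smooth_on n W f" for f
  proof -
    have "\<forall>\<^sub>F t in nhds (p i). f (inv_into W (\<lambda>x. x) (p(i := t))) = f (p(i := t))"
      using eventually_fun_upd[OF W p i] by (rule eventually_mono) simp
    from deriv_cong_ev[OF this refl] show ?thesis
      using that by (simp add: coord_vec_def smooth_fun_open_manifold partial_deriv_def)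
  qed
  then show "smooth_on n W f \<Longrightarrow> coord_vec (open_manifold n W) (W, \<lambda>x. x) i p f = partial_deriv i f p" .
  have lin: "partial_deriv i (\<lambda>q. a * f q + g q) p = a * partial_deriv i f p + partial_deriv i g p"
    if "smooth_on n W f" "smooth_on n W g" for a f g
    using that[THEN smooth_on_has_partial_deriv, OF i p]
    by (intro partial_deriv_eqI DERIV_add DERIV_cmult)
  have leib: "partial_deriv i (\<lambda>q. f q * g q) p = f p * partial_deriv i g p + g p * partial_deriv i f p"
    if "smooth_on n W f" "smooth_on n W g" for f g
    by (intro partial_deriv_eqI DERIV_cong[OF DERIV_mult'[OF that[THEN smooth_on_has_partial_deriv, OF i p]]]) simp
  show "coord_vec (open_manifold n W) (W, \<lambda>x. x) i p \<in> tangent_space (open_manifold n W) p"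
    unfolding tangent_space_open_manifold
    using smooth_on_add[OF W smooth_on_mult[OF W smooth_on_const[OF W]]] smooth_on_mult[OF W]
    by (simp add: eq lin leib) (simp add: coord_vec_def smooth_fun_open_manifold)
qed

end

section \<open>Logarithmic symplectic forms on the complex torus\<close>

definition csmooth_on :: "nat \<Rightarrow> (nat \<Rightarrow> real) set \<Rightarrow> ((nat \<Rightarrow> real) \<Rightarrow> complex) \<Rightarrow> bool" where
  "csmooth_on n W f \<longleftrightarrow> smooth_on n W (\<lambda>x. Re (f x)) \<and> smooth_on n W (\<lambda>x. Im (f x))"

definition cder :: "(nat \<Rightarrow> real) tvec \<Rightarrow> ((nat \<Rightarrow> real) \<Rightarrow> complex) \<Rightarrow> complex" where
  "cder u f = Complex (u (\<lambda>q. Re (f q))) (u (\<lambda>q. Im (f q)))"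

text \<open>The value of d log f on \<open>u\<close>: single-valued although log f is not, and
  turning products of functions into sums.\<close>

definition lder :: "(nat \<Rightarrow> real) tvec \<Rightarrow> (nat \<Rightarrow> real) \<Rightarrow> ((nat \<Rightarrow> real) \<Rightarrow> complex) \<Rightarrow> complex" where
  "lder u p f = cder u f / f p"

context
  fixes n :: nat and W :: "(nat \<Rightarrow> real) set"
  assumes W: "openin (Euclidean_space n) W"
begin

lemma csmooth_on_const: "csmooth_on n W (\<lambda>x. c)"
  by (simp add: csmooth_on_def smooth_on_const[OF W])

lemma csmooth_on_mult: "csmooth_on n W f \<Longrightarrow> csmooth_on n W g \<Longrightarrow> csmooth_on n W (\<lambda>x. f x * g x)"
  by (simp add: csmooth_on_def smooth_on_add[OF W] smooth_on_diff[OF W] smooth_on_mult[OF W])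

lemma csmooth_on_cnj: "csmooth_on n W f \<Longrightarrow> csmooth_on n W (\<lambda>x. cnj (f x))"
  by (simp add: csmooth_on_def smooth_on_minus[OF W])

lemma csmooth_on_inverse:
  assumes "csmooth_on n W f" "\<And>x. x \<in> W \<Longrightarrow> f x \<noteq> 0"
  shows "csmooth_on n W (\<lambda>x. inverse (f x))"
proof -
  have nz: "(Re (f x))\<^sup>2 + (Im (f x))\<^sup>2 \<noteq> 0" if "x \<in> W" for x
    using assms(2)[OF that] by (simp add: complex_eq_iff sum_power2_eq_zero_iff)
  show ?thesis
    using assms(1) nz unfolding csmooth_on_def inverse_complex.sel power2_eq_square
    by (intro conjI smooth_on_divide[OF W] smooth_on_add[OF W] smooth_on_mult[OF W] smooth_on_minus[OF W]) auto
qed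

lemma csmooth_on_power: "csmooth_on n W f \<Longrightarrow> csmooth_on n W (\<lambda>x. f x ^ k)"
  by (induction k) (simp_all add: csmooth_on_const csmooth_on_mult)

lemma csmooth_on_power_int:
  assumes "csmooth_on n W f" "\<And>x. x \<in> W \<Longrightarrow> f x \<noteq> 0"
  shows "csmooth_on n W (\<lambda>x. f x powi k)"
  by (cases "k \<ge> 0") (simp_all add: power_int_def csmooth_on_power csmooth_on_inverse assms)

lemma csmooth_on_prod:
  "(\<And>i. i \<in> I \<Longrightarrow> csmooth_on n W (f i)) \<Longrightarrow> csmooth_on n W (\<lambda>x. \<Prod>i\<in>I. f i x)"
  by (induction I rule: infinite_finite_induct) (simp_all add: csmooth_on_const csmooth_on_mult)

context
  fixes p u
  assumes u: "u \<in> tangent_space (open_manifold n W) p" and p: "p \<in> W"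
begin

lemma cder_const [simp]: "cder u (\<lambda>q. c) = 0"
  by (simp add: cder_def derivation_const[OF W u p] zero_complex.code)

lemma cder_cnj: "csmooth_on n W f \<Longrightarrow> cder u (\<lambda>q. cnj (f q)) = cnj (cder u f)"
  by (simp add: cder_def csmooth_on_def derivation_minus[OF W u p] complex_eq_iff)

lemma cder_mult:
  assumes "csmooth_on n W f" "csmooth_on n W g"
  shows "cder u (\<lambda>q. f q * g q) = f p * cder u g + g p * cder u f"
  using assms
  by (simp add: csmooth_on_def cder_def derivation_diff[OF W u p] derivation_add[OF W u p]
      derivation_mult[OF W u p] smooth_on_mult[OF W] complex_eq_iff algebra_simps)

lemma cder_cong:
  assumes "csmooth_on n W f" "\<And>q. q \<in> W \<Longrightarrow> f q = g q"
  shows "cder u f = cder u g"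
  unfolding cder_def using assms
  by (auto simp: csmooth_on_def complex_eq_iff intro!: derivation_cong[OF W u p])

lemma lder_mult:
  assumes "csmooth_on n W f" "csmooth_on n W g" "f p \<noteq> 0" "g p \<noteq> 0"
  shows "lder u p (\<lambda>q. f q * g q) = lder u p f + lder u p g"
  using assms by (simp add: lder_def cder_mult field_simps)

lemma lder_const [simp]: "lder u p (\<lambda>q. c) = 0"
  by (simp add: lder_def)

lemma lder_inverse:
  assumes f: "csmooth_on n W f" and nz: "\<And>x. x \<in> W \<Longrightarrow> f x \<noteq> 0"
  shows "lder u p (\<lambda>q. inverse (f q)) = - lder u p f"
proof -
  have "lder u p (\<lambda>q. f q * inverse (f q)) = lder u p f + lder u p (\<lambda>q. inverse (f q))"
    using nz p by (intro lder_mult f csmooth_on_inverse[OF f nz]) auto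
  moreover have "cder u (\<lambda>q. f q * inverse (f q)) = cder u (\<lambda>q. 1)"
    using nz by (intro cder_cong csmooth_on_mult f csmooth_on_inverse) auto
  ultimately have "lder u p f + lder u p (\<lambda>q. inverse (f q)) = 0"
    by (simp add: lder_def)
  then show ?thesis
    by (metis add.inverse_unique)
qed

lemma lder_power:
  assumes "csmooth_on n W f" "f p \<noteq> 0"
  shows "lder u p (\<lambda>q. f q ^ k) = of_nat k * lder u p f"
proof (induction k)
  case (Suc k)
  have "lder u p (\<lambda>q. f q * f q ^ k) = lder u p f + lder u p (\<lambda>q. f q ^ k)"
    using assms by (intro lder_mult csmooth_on_power) auto
  then show ?case using Suc by (simp add: algebra_simps)
qed simp

lemma lder_power_int:
  assumes "csmooth_on n W f" "\<And>x. x \<in> W \<Longrightarrow> f x \<noteq> 0"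
  shows "lder u p (\<lambda>q. f q powi k) = of_int k * lder u p f"
proof (cases "k \<ge> 0")
  case True
  then have "lder u p (\<lambda>q. f q powi k) = lder u p (\<lambda>q. f q ^ nat k)"
    by (simp add: power_int_def)
  then show ?thesis
    using True lder_power[OF assms(1), of "nat k"] assms(2)[OF p] by simp
next
  case False
  then have "lder u p (\<lambda>q. f q powi k) = lder u p (\<lambda>q. inverse (f q) ^ nat (- k))"
    by (simp add: power_int_def)
  also have "\<dots> = of_nat (nat (- k)) * lder u p (\<lambda>q. inverse (f q))"
    using assms p by (intro lder_power csmooth_on_inverse) auto
  finally show ?thesis
    using False lder_inverse[OF assms] by simp
qed

lemma lder_prod:
  assumes "\<And>i. i \<in> I \<Longrightarrow> csmooth_on n W (f i)" "\<And>i. i \<in> I \<Longrightarrow> f i p \<noteq> 0"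
  shows "lder u p (\<lambda>q. \<Prod>i\<in>I. f i q) = (\<Sum>i\<in>I. lder u p (f i))"
  using assms
proof (induction I rule: infinite_finite_induct)
  case (insert i I)
  have "lder u p (\<lambda>q. f i q * (\<Prod>i\<in>I. f i q)) = lder u p (f i) + lder u p (\<lambda>q. \<Prod>i\<in>I. f i q)"
    using insert by (intro lder_mult csmooth_on_prod) auto
  then show ?case using insert by simp
qed simp_all

end

end

section \<open>The complex torus and its logarithmic two-forms\<close>

definition zc :: "nat \<Rightarrow> (nat \<Rightarrow> real) \<Rightarrow> complex" where
  "zc i x = Complex (x (2 * i)) (x (2 * i + 1))"

definition cstar4 :: "(nat \<Rightarrow> real) set" where
  "cstar4 = {x \<in> topspace (Euclidean_space 8). \<forall>i<4. zc i x \<noteq> 0}"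

abbreviation cstar4_manifold :: "(nat \<Rightarrow> real) manifold" where
  "cstar4_manifold \<equiv> open_manifold 8 cstar4"

lemma openin_cstar4: "openin (Euclidean_space 8) cstar4"
proof -
  define E where "E = topspace (Euclidean_space 8)"
  have E: "openin (Euclidean_space 8) E" by (simp add: E_def)
  have "openin (Euclidean_space 8) {x \<in> E. x (2 * i) * x (2 * i) + x (2 * i + 1) * x (2 * i + 1) \<in> {0<..}}" for i
    by (intro openin_vimage_real[OF E] smooth_on_imp_continuous_on[OF E] smooth_on_add[OF E]
        smooth_on_mult[OF E] smooth_on_coord[OF E] open_greaterThan)
  moreover have "(zc i x \<noteq> 0) \<longleftrightarrow> x (2 * i) * x (2 * i) + x (2 * i + 1) * x (2 * i + 1) \<in> {0<..}" for i x
    by (simp add: zc_def complex_eq_iff sum_squares_gt_zero_iff)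
  ultimately have "openin (Euclidean_space 8) {x \<in> E. zc i x \<noteq> 0}" for i
    by simp
  then have "openin (Euclidean_space 8) (\<Inter>i\<in>{..<4}. {x \<in> E. zc i x \<noteq> 0})"
    by (intro openin_INT2) (auto simp: lessThan_empty_iff)
  moreover have "(\<Inter>i\<in>{..<4}. {x \<in> E. zc i x \<noteq> 0}) = cstar4"
    by (auto simp: cstar4_def E_def) (metis lessThan_iff zero_less_numeral)
  ultimately show ?thesis by simp
qed

lemma cstar4_nonzero [simp]: "x \<in> cstar4 \<Longrightarrow> i < 4 \<Longrightarrow> zc i x \<noteq> 0"
  by (simp add: cstar4_def)

lemma csmooth_on_zc: "csmooth_on 8 cstar4 (zc i)"
  using smooth_on_coord[OF openin_cstar4] by (simp add: csmooth_on_def zc_def)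

lemma sum_Re_mult: "(\<Sum>i\<in>I. b i * Re (c i * v)) = Re ((\<Sum>i\<in>I. of_real (b i) * c i) * v)"
proof -
  have "(\<Sum>i\<in>I. of_real (b i) * c i) * v = (\<Sum>i\<in>I. of_real (b i) * (c i * v))"
    by (simp add: sum_distrib_right mult.assoc)
  then show ?thesis
    unfolding Re_sum by (simp only: Re_sum) (intro sum.cong refl, simp)
qed

text \<open>With d log z_i = dp_i + i dq_i and \<open>b\<close> skew, this is the sum over i < j of
  \<open>b i j\<close> (dp_i \<and> dp_j + dq_i \<and> dq_j).\<close>

definition log_form :: "(nat \<Rightarrow> nat \<Rightarrow> real) \<Rightarrow> (nat \<Rightarrow> real) form2" where
  "log_form b p u v = (\<Sum>i<4. \<Sum>j<4. b i j * Re (lder u p (zc i) * cnj (lder v p (zc j))))"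

lemma lder_zc_linear: "lder (\<lambda>f. a * u f + v f) p (zc i) = of_real a * lder u p (zc i) + lder v p (zc i)"
proof -
  have "cder (\<lambda>f. a * u f + v f) (zc i) = of_real a * cder u (zc i) + cder v (zc i)"
    by (simp add: cder_def complex_eq_iff)
  then show ?thesis by (simp add: lder_def add_divide_distrib)
qed

definition dz_coeff :: "nat \<Rightarrow> nat \<Rightarrow> complex" where
  "dz_coeff i k = Complex (of_bool (k = 2 * i)) (of_bool (k = 2 * i + 1))"

abbreviation cstar4_vec :: "nat \<Rightarrow> (nat \<Rightarrow> real) \<Rightarrow> (nat \<Rightarrow> real) tvec" where
  "cstar4_vec \<equiv> coord_vec cstar4_manifold (cstar4, \<lambda>x. x)"

lemma cder_cstar4_vec:
  assumes "k < 8" "p \<in> cstar4"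
  shows "cder (cstar4_vec k p) (zc i) = dz_coeff i k"
proof -
  have "cstar4_vec k p (\<lambda>x. x j) = of_bool (k = j)" for j
  proof -
    have "((\<lambda>t. (p(k := t)) j) has_real_derivative of_bool (k = j)) (at (p k))"
      using fun_upd_partial_simp[of p k j "at (p k)"] by (cases "k = j") simp_all
    then show ?thesis
      using coord_vec_tangent(2)[OF openin_cstar4 assms smooth_on_coord[OF openin_cstar4]]
      by (simp add: partial_deriv_eqI)
  qed
  then show ?thesis
    by (simp add: cder_def zc_def dz_coeff_def)
qed

lemma lder_cstar4_vec:
  assumes "k < 8" "p \<in> cstar4"
  shows "lder (cstar4_vec k p) p (zc i) = dz_coeff i k * inverse (zc i p)"
  using cder_cstar4_vec[OF assms] by (simp add: lder_def divide_inverse)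

lemma form_coeff_log_form:
  assumes "k < 8" "l < 8" "x \<in> cstar4"
  shows "form_coeff cstar4_manifold (log_form b) (cstar4, \<lambda>x. x) k l x =
    (\<Sum>i<4. \<Sum>j<4. b i j * Re ((dz_coeff i k * inverse (zc i x)) * cnj (dz_coeff j l * inverse (zc j x))))"
  using assms by (simp only: form_coeff_def Let_def fst_conv snd_conv inv_into_ident log_form_def lder_cstar4_vec)

lemma csmooth_on_dlog: "i < 4 \<Longrightarrow> csmooth_on 8 cstar4 (\<lambda>x. c * inverse (zc i x))"
  by (intro csmooth_on_mult csmooth_on_const csmooth_on_inverse csmooth_on_zc openin_cstar4) auto

lemma smooth_form_coeff_log_form:
  assumes "k < 8" "l < 8"
  shows "smooth_on 8 cstar4 (form_coeff cstar4_manifold (log_form b) (cstar4, \<lambda>x. x) k l)"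
proof -
  have "smooth_on 8 cstar4 (\<lambda>x. Re ((dz_coeff i k * inverse (zc i x)) * cnj (dz_coeff j l * inverse (zc j x))))"
    if "i < 4" "j < 4" for i j
    using csmooth_on_mult[OF openin_cstar4 csmooth_on_dlog[OF that(1)] csmooth_on_cnj[OF openin_cstar4 csmooth_on_dlog[OF that(2)]]]
    unfolding csmooth_on_def by blast
  then have "smooth_on 8 cstar4 (\<lambda>x. \<Sum>i<4. \<Sum>j<4. b i j * Re ((dz_coeff i k * inverse (zc i x)) * cnj (dz_coeff j l * inverse (zc j x))))"
    by (intro smooth_on_sum smooth_on_mult smooth_on_const openin_cstar4) simp
  then show ?thesis
    by (rule iffD1[OF smooth_on_cong[OF openin_cstar4], rotated]) (rule form_coeff_log_form[OF assms, symmetric])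
qed

lemma two_form_log_form:
  assumes "\<And>i j. b j i = - b i j"
  shows "two_form cstar4_manifold (log_form b)"
proof -
  have "log_form b p u u = 0" for p u
  proof -
    have "log_form b p u u = (\<Sum>j<4. \<Sum>i<4. b i j * Re (lder u p (zc i) * cnj (lder u p (zc j))))"
      unfolding log_form_def by (rule sum.swap)
    also have "\<dots> = (\<Sum>j<4. \<Sum>i<4. - (b j i * Re (lder u p (zc j) * cnj (lder u p (zc i)))))"
      by (intro sum.cong refl, subst assms) (simp add: mult.commute)
    also have "\<dots> = - log_form b p u u"
      by (simp add: log_form_def sum_negf)
    finally show ?thesis by simp
  qed
  moreover have "log_form b p (\<lambda>f. a * u f + v f) w = a * log_form b p u w + log_form b p v w"
    "log_form b p w (\<lambda>f. a * u f + v f) = a * log_form b p w u + log_form b p w v" for a p u v w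
  proof -
    have Re: "r * Re ((of_real a * U + V) * cnj X) = a * (r * Re (U * cnj X)) + r * Re (V * cnj X)"
      "r * Re (X * cnj (of_real a * U + V)) = a * (r * Re (X * cnj U)) + r * Re (X * cnj V)" for r U V X
      by (simp_all add: algebra_simps)
    show "log_form b p (\<lambda>f. a * u f + v f) w = a * log_form b p u w + log_form b p v w"
      "log_form b p w (\<lambda>f. a * u f + v f) = a * log_form b p w u + log_form b p w v"
      by (simp_all only: log_form_def lder_zc_linear Re sum.distrib sum_distrib_left)
  qed
  moreover have "matlas cstar4_manifold = {(cstar4, \<lambda>x. x)}" "mdim cstar4_manifold = 8"
    by (simp_all add: open_manifold_def)
  ultimately show ?thesis
    using smooth_form_coeff_log_form unfolding two_form_def by simp
qed

text \<open>Each d log z_i is closed, that is, the derivative \<open>D i k m\<close> of its k-th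
  coefficient in direction m is symmetric in k and m. With the skewness of \<open>S\<close> the six
  terms of the exterior derivative cancel in pairs.\<close>

lemma closed_form_log_form:
  assumes skew: "\<And>i j. b j i = - b i j"
  shows "closed_form cstar4_manifold (log_form b)"
proof -
  define E where "E i k x = dz_coeff i k * inverse (zc i x)" for i k x
  define D where "D i k m x = - (dz_coeff i k * dz_coeff i m) * inverse (zc i x) ^ 2" for i k m x
  have pd: "partial_deriv m (form_coeff cstar4_manifold (log_form b) (cstar4, \<lambda>x. x) k l) x =
      (\<Sum>i<4. \<Sum>j<4. b i j * Re (E i k x * cnj (D j l m x) + D i k m x * cnj (E j l x)))"
    if klm: "k < 8" "l < 8" "m < 8" and x: "x \<in> cstar4" for k l m x
  proof -
    \<comment> \<open>Partial derivatives are evaluated as values of the coordinate vector, which as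
      a derivation obeys the complex product rules for \<open>cder\<close>.\<close>
    define u where "u = cstar4_vec m x"
    note u = coord_vec_tangent(1)[OF openin_cstar4 klm(3) x, folded u_def]
    have E_smooth: "csmooth_on 8 cstar4 (E i k)" if "i < 4" for i k
      using csmooth_on_dlog[OF that, of "dz_coeff i k"] by (simp add: E_def[abs_def])
    have uE: "cder u (E i k) = D i k m x" if i: "i < 4" for i k
    proof -
      have inv: "csmooth_on 8 cstar4 (\<lambda>x. inverse (zc i x))"
        using i by (intro csmooth_on_inverse csmooth_on_zc openin_cstar4) auto
      have "lder u x (\<lambda>x. inverse (zc i x)) = - lder u x (zc i)"
        using i by (intro lder_inverse[OF openin_cstar4 u x] csmooth_on_zc) auto
      then have "cder u (\<lambda>x. inverse (zc i x)) = - dz_coeff i m * inverse (zc i x) ^ 2"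
        using i x cder_cstar4_vec[OF klm(3) x, of i]
        by (simp add: lder_def u_def field_simps power2_eq_square)
      then show ?thesis
        using cder_mult[OF openin_cstar4 u x csmooth_on_const[OF openin_cstar4] inv, of "dz_coeff i k"]
          cder_const[OF openin_cstar4 u x]
        by (simp add: E_def[abs_def] D_def)
    qed
    have EE: "csmooth_on 8 cstar4 (\<lambda>x. E i k x * cnj (E j l x))" if "i < 4" "j < 4" for i j
      using that by (intro csmooth_on_mult csmooth_on_cnj E_smooth openin_cstar4)
    have uEE: "u (\<lambda>x. Re (E i k x * cnj (E j l x))) = Re (E i k x * cnj (D j l m x) + D i k m x * cnj (E j l x))"
      if "i < 4" "j < 4" for i j
    proof -
      have "cder u (\<lambda>x. E i k x * cnj (E j l x)) = E i k x * cder u (\<lambda>x. cnj (E j l x)) + cnj (E j l x) * cder u (E i k)"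
        using that by (intro cder_mult[OF openin_cstar4 u x] csmooth_on_cnj E_smooth openin_cstar4)
      also have "cder u (\<lambda>x. cnj (E j l x)) = cnj (cder u (E j l))"
        using that by (intro cder_cnj[OF openin_cstar4 u x] E_smooth)
      finally have "Re (cder u (\<lambda>x. E i k x * cnj (E j l x))) = Re (E i k x * cnj (D j l m x) + cnj (E j l x) * D i k m x)"
        using that by (simp add: uE)
      then show ?thesis by (simp add: cder_def mult.commute)
    qed
    note S = smooth_on_sum[OF openin_cstar4] smooth_on_mult[OF openin_cstar4] smooth_on_const[OF openin_cstar4]
    have sm: "smooth_on 8 cstar4 (\<lambda>x. Re (E i k x * cnj (E j l x)))" if "i < 4" "j < 4" for i j
      using EE[OF that] by (simp add: csmooth_on_def)
    let ?c = "form_coeff cstar4_manifold (log_form b) (cstar4, \<lambda>x. x) k l"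
    have "partial_deriv m ?c x = u ?c"
      unfolding u_def
      by (rule coord_vec_tangent(2)[OF openin_cstar4 klm(3) x smooth_form_coeff_log_form[OF klm(1,2)], symmetric])
    also have "\<dots> = u (\<lambda>x. \<Sum>i<4. \<Sum>j<4. b i j * Re (E i k x * cnj (E j l x)))"
      by (rule derivation_cong[OF openin_cstar4 u x smooth_form_coeff_log_form[OF klm(1,2)]])
        (simp only: form_coeff_log_form[OF klm(1,2)] E_def)
    also have "\<dots> = (\<Sum>i<4. u (\<lambda>x. \<Sum>j<4. b i j * Re (E i k x * cnj (E j l x))))"
      by (intro derivation_sum[OF openin_cstar4 u x] S sm) auto
    also have "\<dots> = (\<Sum>i<4. \<Sum>j<4. u (\<lambda>x. b i j * Re (E i k x * cnj (E j l x))))"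
      by (intro sum.cong refl derivation_sum[OF openin_cstar4 u x] S sm) auto
    also have "\<dots> = (\<Sum>i<4. \<Sum>j<4. b i j * u (\<lambda>x. Re (E i k x * cnj (E j l x))))"
      by (intro sum.cong refl derivation_cmult[OF openin_cstar4 u x] sm) auto
    also have "\<dots> = (\<Sum>i<4. \<Sum>j<4. b i j * Re (E i k x * cnj (D j l m x) + D i k m x * cnj (E j l x)))"
      by (intro sum.cong refl) (simp only: lessThan_iff uEE)
    finally show ?thesis .
  qed
  define S where "S f g = (\<Sum>i<4. \<Sum>j<4. b i j * Re (f i * cnj (g j)))" for f g :: "nat \<Rightarrow> complex"
  have swap: "S f g = - S g f" for f g
  proof -
    have "S f g = (\<Sum>j<4. \<Sum>i<4. b i j * Re (f i * cnj (g j)))"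
      unfolding S_def by (rule sum.swap)
    also have "\<dots> = (\<Sum>j<4. \<Sum>i<4. - (b j i * Re (g j * cnj (f i))))"
      by (intro sum.cong refl, subst skew) (simp add: mult.commute)
    finally show ?thesis by (simp add: S_def sum_negf)
  qed
  have pd_S: "partial_deriv m (form_coeff cstar4_manifold (log_form b) (cstar4, \<lambda>x. x) k l) x =
      S (\<lambda>i. E i k x) (\<lambda>j. D j l m x) + S (\<lambda>i. D i k m x) (\<lambda>j. E j l x)"
    if "k < 8" "l < 8" "m < 8" "x \<in> cstar4" for k l m x
    unfolding pd[OF that] S_def sum.distrib[symmetric]
    by (intro sum.cong refl) (simp only: plus_complex.sel distrib_left)
  have sym: "(\<lambda>i. D i k m x) = (\<lambda>i. D i m k x)" for k m x
    by (simp add: D_def mult.commute)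
  have "ext_deriv_coeff cstar4_manifold (log_form b) (cstar4, \<lambda>x. x) k l m x = 0"
    if klm: "k < 8" "l < 8" "m < 8" and x: "x \<in> cstar4" for k l m x
    using swap[of "\<lambda>i. D i k m x" "\<lambda>j. E j l x"]
    unfolding ext_deriv_coeff_def pd_S[OF klm(2,3,1) x] pd_S[OF klm(1,3,2) x] pd_S[OF klm x]
      sym[of l k] sym[of m l] sym[of m k] by linarith
  then show ?thesis
    by (auto simp: closed_form_def open_manifold_def)
qed

text \<open>Pairing \<open>u\<close> with the two real coordinate vectors of z_j yields the real and
  the imaginary part of one complex equation, so the logarithmic derivatives of the z_i lie in the
  kernel of \<open>b\<close> over C. Once they vanish, \<open>u\<close> kills all coordinates and
  \<open>derivation_eq_zero\<close> applies.\<close>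

lemma symplectic_form_log_form:
  assumes skew: "\<And>i j. b j i = - b i j"
    and nondeg: "\<And>c :: nat \<Rightarrow> complex. (\<And>j. j < 4 \<Longrightarrow> (\<Sum>i<4. of_real (b i j) * c i) = 0) \<Longrightarrow> \<forall>i<4. c i = 0"
  shows "symplectic_form cstar4_manifold (log_form b)"
proof -
  have "u = (\<lambda>f. 0)" if p: "p \<in> cstar4" and u: "u \<in> tangent_space cstar4_manifold p"
    and null: "\<forall>v\<in>tangent_space cstar4_manifold p. log_form b p u v = 0" for p u
  proof -
    define c where "c i = lder u p (zc i)" for i
    have "(\<Sum>i<4. of_real (b i j) * c i) = 0" if j: "j < 4" for j
    proof -
      define w where "w = (\<Sum>i<4. of_real (b i j) * c i) * cnj (inverse (zc j p))"
      have "Re (w * cnj (dz_coeff j k)) = 0" if k: "k = 2 * j \<or> k = 2 * j + 1" for k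
      proof -
        have k8: "k < 8" using k j by auto
        have dz: "dz_coeff j' k = 0" if "j' < 4" "j' \<noteq> j" for j'
        proof -
          have "k \<noteq> 2 * j'" "k \<noteq> 2 * j' + 1" using k that by presburger+
          then show ?thesis by (simp add: dz_coeff_def complex_eq_iff)
        qed
        have "0 = log_form b p u (cstar4_vec k p)"
          using null coord_vec_tangent(1)[OF openin_cstar4 k8 p] by simp
        also have "\<dots> = (\<Sum>i<4. \<Sum>j'<4. if j' = j then b i j * Re (c i * cnj (dz_coeff j k * inverse (zc j p))) else 0)"
          unfolding log_form_def lder_cstar4_vec[OF k8 p] c_def[symmetric]
          by (intro sum.cong refl) (auto simp: dz)
        also have "\<dots> = (\<Sum>i<4. b i j * Re (c i * cnj (dz_coeff j k * inverse (zc j p))))"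
          using j by (simp add: sum.delta)
        also have "\<dots> = Re (w * cnj (dz_coeff j k))"
          unfolding sum_Re_mult w_def by (simp add: mult.assoc mult.commute)
        finally show ?thesis by simp
      qed
      from this[of "2 * j"] this[of "2 * j + 1"] have "w = 0"
        by (simp add: dz_coeff_def complex_eq_iff)
      then show ?thesis
        using cstar4_nonzero[OF p j] by (simp add: w_def)
    qed
    then have c: "\<forall>i<4. c i = 0" by (rule nondeg)
    show ?thesis
    proof (rule derivation_eq_zero[OF openin_cstar4 u p])
      fix k :: nat assume k: "k < 8"
      then have "k div 2 < 4" by simp
      then have "cder u (zc (k div 2)) = 0"
        using c cstar4_nonzero[OF p] by (auto simp: c_def lder_def)
      then have "u (\<lambda>q. q (2 * (k div 2))) = 0" "u (\<lambda>q. q (2 * (k div 2) + 1)) = 0"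
        by (simp_all add: cder_def zc_def complex_eq_iff)
      moreover have "k = 2 * (k div 2) \<or> k = 2 * (k div 2) + 1" by presburger
      ultimately show "u (\<lambda>q. q k) = 0" by metis
    qed
  qed
  then show ?thesis
    using two_form_log_form[OF skew] closed_form_log_form[OF skew] openin_cstar4
    by (simp add: symplectic_form_def nondegenerate_form_def)
qed

section \<open>Monomial maps\<close>

text \<open>Coordinates from n on vanish on \<open>W\<close>, so continuity into the product space
  follows from the smoothness of the first n components.\<close>

lemma smooth_map_open_manifold:
  assumes W: "openin (Euclidean_space n) W"
  shows "smooth_map (open_manifold n W) (open_manifold n W) F \<longleftrightarrow>
    F \<in> W \<rightarrow> W \<and> (\<forall>j<n. smooth_on n W (\<lambda>x. F x j))"
proof -
  have cong: "smooth_on n W (\<lambda>x. F (inv_into W (\<lambda>x. x) x) j) \<longleftrightarrow> smooth_on n W (\<lambda>x. F x j)" for j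
    by (rule smooth_on_cong[OF W]) simp
  have cont: "continuous_on W F" if F: "F \<in> W \<rightarrow> W" "\<forall>j<n. smooth_on n W (\<lambda>x. F x j)"
  proof (rule continuous_on_coordinatewise_then_product)
    fix j show "continuous_on W (\<lambda>x. F x j)"
    proof (cases "j < n")
      case True
      then show ?thesis using F smooth_on_imp_continuous_on[OF W] by blast
    next
      case False
      then have "F x j = 0" if "x \<in> W" for x
        using that F(1) openin_subset[OF W] by (auto simp: topspace_Euclidean_space)
      then show ?thesis
        using continuous_on_cong[of W W "\<lambda>x. F x j" "\<lambda>x. 0"] by simp
    qed
  qed
  have dom: "{p \<in> W. F p \<in> W} = W" if "F \<in> W \<rightarrow> W"
    using that by auto
  have "matlas (open_manifold n W) = {(W, \<lambda>x. x)}" "mdim (open_manifold n W) = n"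
    by (simp_all add: open_manifold_def)
  then show ?thesis
    unfolding smooth_map_def mtop_open_manifold[OF W]
    using cont dom by (auto simp: cong continuous_map_in_subtopology)
qed

lemma pushforward_cder:
  assumes W: "openin (Euclidean_space n) W" and "csmooth_on n W f"
  shows "cder (pushforward (open_manifold n W) (open_manifold n W) F u) f = cder u (\<lambda>q. f (F q))"
  using assms(2) by (simp add: pushforward_def cder_def csmooth_on_def smooth_fun_open_manifold[OF W])

text \<open>Row i of \<open>A\<close> holds the exponents of the i-th complex component. The value
  \<open>undefined\<close> off \<open>cstar4\<close> makes the map extensional, as the carrier of
  \<open>Symp\<close> demands.\<close>

definition mono_map :: "(nat \<Rightarrow> nat \<Rightarrow> int) \<Rightarrow> (nat \<Rightarrow> real) \<Rightarrow> nat \<Rightarrow> real" where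
  "mono_map A x = (if x \<in> cstar4 then (\<lambda>k. if k < 8 then
     (if even k then Re else Im) (\<Prod>j<4. zc j x powi A (k div 2) j) else 0) else undefined)"

lemma zc_mono_map:
  assumes "x \<in> cstar4" "i < 4"
  shows "zc i (mono_map A x) = (\<Prod>j<4. zc j x powi A i j)"
proof -
  have "mono_map A x (2 * i) = Re (\<Prod>j<4. zc j x powi A i j)"
    "mono_map A x (2 * i + 1) = Im (\<Prod>j<4. zc j x powi A i j)"
    using assms by (simp_all add: mono_map_def)
  then show ?thesis
    by (simp add: zc_def[of i "mono_map A x"])
qed

lemma mono_map_cstar4:
  assumes "x \<in> cstar4" shows "mono_map A x \<in> cstar4"
proof -
  have "mono_map A x \<in> topspace (Euclidean_space 8)"
    unfolding mono_map_def topspace_Euclidean_space if_P[OF assms] by simp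
  moreover have "zc i (mono_map A x) \<noteq> 0" if "i < 4" for i
  proof -
    have "zc j x powi A i j \<noteq> 0" if "j < 4" for j
      using cstar4_nonzero[OF assms that] power_int_not_zero by blast
    then show ?thesis
      unfolding zc_mono_map[OF assms that] by (subst prod_zero_iff) auto
  qed
  ultimately show ?thesis unfolding cstar4_def by blast
qed

lemma cstar4_eqI:
  assumes "x \<in> cstar4" "y \<in> cstar4" "\<And>i. i < 4 \<Longrightarrow> zc i x = zc i y"
  shows "x = y"
proof
  fix k
  show "x k = y k"
  proof (cases "k < 8")
    case True
    have "\<exists>m. k = 2 * m \<or> k = 2 * m + 1" by presburger
    then obtain m where m: "k = 2 * m \<or> k = 2 * m + 1" ..
    have "m < 4" using m True by linarith
    note zc_eq = assms(3)[OF this]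
    have "x (2 * m) = y (2 * m)" "x (2 * m + 1) = y (2 * m + 1)"
      using arg_cong[OF zc_eq, of Re] arg_cong[OF zc_eq, of Im] unfolding zc_def complex.sel .
    then show ?thesis
      using m by blast
  next
    case False
    have "x \<in> topspace (Euclidean_space 8)" "y \<in> topspace (Euclidean_space 8)"
      using assms(1,2) unfolding cstar4_def by blast+
    then show ?thesis
      using False unfolding topspace_Euclidean_space by simp
  qed
qed

lemma mono_map_mult:
  assumes x: "x \<in> cstar4"
  shows "mono_map A (mono_map B x) = mono_map (mat4_mult A B) x"
proof (rule cstar4_eqI)
  fix i :: nat assume i: "i < 4"
  have "zc i (mono_map A (mono_map B x)) = (\<Prod>j<4. (\<Prod>k<4. zc k x powi B j k) powi A i j)"
    using x i by (simp add: zc_mono_map mono_map_cstar4)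
  also have "\<dots> = (\<Prod>j<4. \<Prod>k<4. zc k x powi (A i j * B j k))"
  proof -
    have "(\<Prod>k\<in>K. f k) powi m = (\<Prod>k\<in>K. f k powi m)" for f :: "nat \<Rightarrow> complex" and K m
      by (induction K rule: infinite_finite_induct) (simp_all add: power_int_mult_distrib)
    then show ?thesis
      by (simp only: power_int_mult[symmetric]) (simp only: mult.commute)
  qed
  also have "\<dots> = (\<Prod>k<4. \<Prod>j<4. zc k x powi (A i j * B j k))"
    by (rule prod.swap)
  also have "\<dots> = (\<Prod>k<4. zc k x powi mat4_mult A B i k)"
  proof -
    have "(\<Prod>j\<in>J. z powi f j) = z powi (\<Sum>j\<in>J. f j)" if "z \<noteq> 0" for z :: complex and f and J :: "nat set"
      using that by (induction J rule: infinite_finite_induct) (simp_all add: power_int_add)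
    then show ?thesis
      using x by (intro prod.cong refl) (simp add: mat4_mult_def)
  qed
  finally show "zc i (mono_map A (mono_map B x)) = zc i (mono_map (mat4_mult A B) x)"
    using x i by (simp add: zc_mono_map)
qed (simp_all add: mono_map_cstar4 x)

lemma mono_map_ident:
  assumes x: "x \<in> cstar4" and A: "\<And>i j. i < 4 \<Longrightarrow> j < 4 \<Longrightarrow> A i j = (if i = j then 1 else 0)"
  shows "mono_map A x = x"
proof (rule cstar4_eqI)
  fix i :: nat assume i: "i < 4"
  have "zc i (mono_map A x) = (\<Prod>j<4. if j = i then zc j x else 1)"
    unfolding zc_mono_map[OF x i] by (intro prod.cong refl) (auto simp: A i)
  then show "zc i (mono_map A x) = zc i x"
    using i by simp
qed (simp_all add: mono_map_cstar4 x)

lemma csmooth_on_monomial: "csmooth_on 8 cstar4 (\<lambda>x. \<Prod>j<4. zc j x powi a j)"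
  by (intro csmooth_on_prod csmooth_on_power_int csmooth_on_zc openin_cstar4) auto

lemma smooth_map_mono_map: "smooth_map cstar4_manifold cstar4_manifold (mono_map A)"
  unfolding smooth_map_open_manifold[OF openin_cstar4]
proof (intro conjI allI impI)
  fix k :: nat assume k: "k < 8"
  have "smooth_on 8 cstar4 (\<lambda>x. (if even k then Re else Im) (\<Prod>j<4. zc j x powi A (k div 2) j))"
    using csmooth_on_monomial[of "A (k div 2)"] by (auto simp: csmooth_on_def)
  then show "smooth_on 8 cstar4 (\<lambda>x. mono_map A x k)"
    using k by (subst smooth_on_cong[OF openin_cstar4]) (auto simp: mono_map_def)
qed (auto simp: mono_map_cstar4)

lemma sum_swap4:
  "(\<Sum>i\<in>I. \<Sum>l\<in>L. \<Sum>j\<in>J. \<Sum>k\<in>K. f i l j k) = (\<Sum>j\<in>J. \<Sum>k\<in>K. \<Sum>i\<in>I. \<Sum>l\<in>L. (f i l j k :: 'a::comm_monoid_add))"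
proof -
  have "(\<Sum>i\<in>I. \<Sum>l\<in>L. \<Sum>j\<in>J. \<Sum>k\<in>K. f i l j k) = (\<Sum>i\<in>I. \<Sum>j\<in>J. \<Sum>l\<in>L. \<Sum>k\<in>K. f i l j k)"
    by (intro sum.cong refl) (rule sum.swap)
  also have "\<dots> = (\<Sum>j\<in>J. \<Sum>i\<in>I. \<Sum>k\<in>K. \<Sum>l\<in>L. f i l j k)"
    by (subst sum.swap) (intro sum.cong refl sum.swap)
  also have "\<dots> = (\<Sum>j\<in>J. \<Sum>k\<in>K. \<Sum>i\<in>I. \<Sum>l\<in>L. f i l j k)"
    by (intro sum.cong refl) (rule sum.swap)
  finally show ?thesis .
qed

lemma preserves_form_sum:
  assumes "preserves_form b A"
  shows "(\<Sum>i<4. \<Sum>l<4. b i l * Re ((\<Sum>j<4. of_int (A i j) * c j) * cnj (\<Sum>k<4. of_int (A l k) * d k))) =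
    (\<Sum>j<4. \<Sum>k<4. b j k * Re (c j * cnj (d k)))"
proof -
  have Re: "Re ((\<Sum>j<4. of_int (A i j) * c j) * cnj (\<Sum>k<4. of_int (A l k) * d k)) =
      (\<Sum>j<4. \<Sum>k<4. of_int (A i j) * of_int (A l k) * Re (c j * cnj (d k)))" for i l
  proof -
    have "(\<Sum>j<4. of_int (A i j) * c j) * cnj (\<Sum>k<4. of_int (A l k) * d k) =
        (\<Sum>j<4. \<Sum>k<4. (of_int (A i j) * c j) * (of_int (A l k) * cnj (d k)))"
      by (simp add: sum_product cnj_sum)
    also have "\<dots> = (\<Sum>j<4. \<Sum>k<4. of_real (of_int (A i j) * of_int (A l k)) * (c j * cnj (d k)))"
      by (intro sum.cong refl) simp
    finally show ?thesis
      by (simp only: Re_sum) (intro sum.cong refl, simp)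
  qed
  have "(\<Sum>i<4. \<Sum>l<4. b i l * Re ((\<Sum>j<4. of_int (A i j) * c j) * cnj (\<Sum>k<4. of_int (A l k) * d k))) =
      (\<Sum>i<4. \<Sum>l<4. \<Sum>j<4. \<Sum>k<4. (b i l * of_int (A i j) * of_int (A l k)) * Re (c j * cnj (d k)))"
    unfolding Re sum_distrib_left by (simp only: mult.assoc)
  also have "\<dots> = (\<Sum>j<4. \<Sum>k<4. (\<Sum>i<4. \<Sum>l<4. b i l * of_int (A i j) * of_int (A l k)) * Re (c j * cnj (d k)))"
    unfolding sum_distrib_right by (rule sum_swap4)
  also have "\<dots> = (\<Sum>j<4. \<Sum>k<4. b j k * Re (c j * cnj (d k)))"
    using assms by (intro sum.cong refl) (simp add: preserves_form_def)
  finally show ?thesis .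
qed

text \<open>In logarithmic coordinates the differential of a monomial map is the constant matrix
  \<open>A\<close>, so invariance of the form is the congruence of \<open>b\<close> with itself
  under \<open>A\<close>. The matrix \<open>B\<close> provides the inverse map.\<close>

lemma symplectomorphism_mono_map:
  assumes A: "preserves_form b A"
    and AB: "\<And>i j. i < 4 \<Longrightarrow> j < 4 \<Longrightarrow> mat4_mult A B i j = (if i = j then 1 else 0)"
    and BA: "\<And>i j. i < 4 \<Longrightarrow> j < 4 \<Longrightarrow> mat4_mult B A i j = (if i = j then 1 else 0)"
  shows "symplectomorphism cstar4_manifold (log_form b) (mono_map A)"
proof -
  have inv: "mono_map A (mono_map B x) = x" "mono_map B (mono_map A x) = x" if "x \<in> cstar4" for x
    using that AB BA by (simp_all add: mono_map_mult mono_map_ident)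
  have bij: "bij_betw (mono_map A) cstar4 cstar4"
    by (rule bij_betw_byWitness[of _ "mono_map B"]) (auto simp: inv mono_map_cstar4)
  have inv_into: "inv_into cstar4 (mono_map A) x = mono_map B x" if "x \<in> cstar4" for x
    using that bij inv by (intro inv_into_f_eq) (auto simp: bij_betw_def mono_map_cstar4)
  have "smooth_map cstar4_manifold cstar4_manifold (inv_into cstar4 (mono_map A))"
    unfolding smooth_map_open_manifold[OF openin_cstar4]
  proof (intro conjI allI impI)
    fix k :: nat assume "k < 8"
    then have "smooth_on 8 cstar4 (\<lambda>x. mono_map B x k)"
      using smooth_map_mono_map[of B] unfolding smooth_map_open_manifold[OF openin_cstar4] by blast
    then show "smooth_on 8 cstar4 (\<lambda>x. inv_into cstar4 (mono_map A) x k)"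
      by (subst smooth_on_cong[OF openin_cstar4]) (simp_all add: inv_into)
  qed (auto simp: inv_into mono_map_cstar4)
  then have "diffeo cstar4_manifold (mono_map A)"
    using bij smooth_map_mono_map openin_cstar4 by (simp add: diffeo_def)
  moreover have "log_form b (mono_map A p) (pushforward cstar4_manifold cstar4_manifold (mono_map A) u)
      (pushforward cstar4_manifold cstar4_manifold (mono_map A) v) = log_form b p u v"
    if p: "p \<in> cstar4" and u: "u \<in> tangent_space cstar4_manifold p" and v: "v \<in> tangent_space cstar4_manifold p" for p u v
  proof -
    have push: "lder (pushforward cstar4_manifold cstar4_manifold (mono_map A) w) (mono_map A p) (zc i) =
        (\<Sum>j<4. of_int (A i j) * lder w p (zc j))"
      if w: "w \<in> tangent_space cstar4_manifold p" and i: "i < 4" for w i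
    proof -
      have "cder w (\<lambda>q. zc i (mono_map A q)) = cder w (\<lambda>q. \<Prod>j<4. zc j q powi A i j)"
        by (rule cder_cong[OF openin_cstar4 w p csmooth_on_monomial, symmetric]) (simp add: zc_mono_map i)
      then have "lder (pushforward cstar4_manifold cstar4_manifold (mono_map A) w) (mono_map A p) (zc i) =
          lder w p (\<lambda>q. \<Prod>j<4. zc j q powi A i j)"
        by (simp add: lder_def pushforward_cder[OF openin_cstar4 csmooth_on_zc] zc_mono_map p i)
      also have "\<dots> = (\<Sum>j<4. lder w p (\<lambda>q. zc j q powi A i j))"
        using p by (intro lder_prod[OF openin_cstar4 w p] csmooth_on_power_int csmooth_on_zc openin_cstar4)
          (auto simp: power_int_eq_0_iff)
      also have "\<dots> = (\<Sum>j<4. of_int (A i j) * lder w p (zc j))"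
        by (intro sum.cong refl lder_power_int[OF openin_cstar4 w p] csmooth_on_zc) auto
      finally show ?thesis .
    qed
    have "log_form b (mono_map A p) (pushforward cstar4_manifold cstar4_manifold (mono_map A) u)
      (pushforward cstar4_manifold cstar4_manifold (mono_map A) v) =
      (\<Sum>i<4. \<Sum>l<4. b i l * Re ((\<Sum>j<4. of_int (A i j) * lder u p (zc j)) * cnj (\<Sum>k<4. of_int (A l k) * lder v p (zc k))))"
      unfolding log_form_def by (intro sum.cong refl) (simp only: push[OF u] push[OF v] lessThan_iff)
    then show ?thesis
      unfolding preserves_form_sum[OF A] log_form_def .
  qed
  ultimately show ?thesis
    using openin_cstar4 by (simp add: symplectomorphism_def)
qed

section \<open>The action of a self-map on the first homology\<close>

text \<open>The universal cover C^4 as an iterated product of types, which makes it a normed real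
  vector space with convex, hence contractible, universe.\<close>

type_synonym c4 = "(complex \<times> complex) \<times> (complex \<times> complex)"

definition comp4 :: "c4 \<Rightarrow> nat \<Rightarrow> complex" where
  "comp4 \<zeta> i = (if i = 0 then fst (fst \<zeta>) else if i = 1 then snd (fst \<zeta>)
     else if i = 2 then fst (snd \<zeta>) else snd (snd \<zeta>))"

definition vec4 :: "(nat \<Rightarrow> complex) \<Rightarrow> c4" where
  "vec4 f = ((f 0, f 1), (f 2, f 3))"

lemma comp4_vec4: "i < 4 \<Longrightarrow> comp4 (vec4 f) i = f i"
  by (auto simp: less_4_cases comp4_def vec4_def)

lemma comp4_add: "comp4 (\<zeta> + \<eta>) i = comp4 \<zeta> i + comp4 \<eta> i"
  by (simp add: comp4_def)

lemma comp4_diff: "comp4 (\<zeta> - \<eta>) i = comp4 \<zeta> i - comp4 \<eta> i"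
  by (simp add: comp4_def)

lemma comp4_eqI:
  assumes "\<And>i. i < 4 \<Longrightarrow> comp4 \<zeta> i = comp4 \<eta> i" shows "\<zeta> = \<eta>"
  using assms[of 0] assms[of 1] assms[of 2] assms[of 3] by (simp add: comp4_def prod_eq_iff)

lemma continuous_on_comp4 [continuous_intros]:
  "continuous_on S f \<Longrightarrow> continuous_on S (\<lambda>x. comp4 (f x) i)"
  unfolding comp4_def by (cases "i = 0"; cases "i = 1"; cases "i = 2") (auto intro!: continuous_intros)

lemma continuous_on_vec4 [continuous_intros]:
  "(\<And>i. i < 4 \<Longrightarrow> continuous_on S (\<lambda>x. f x i)) \<Longrightarrow> continuous_on S (\<lambda>x. vec4 (f x))"
  unfolding vec4_def by (intro continuous_intros) auto

text \<open>The universal covering of \<open>cstar4\<close>; its deck transformations are the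
  translations by \<open>lat\<close>.\<close>

definition exp4 :: "c4 \<Rightarrow> nat \<Rightarrow> real" where
  "exp4 \<zeta> = (\<lambda>k. if k < 8 then (if even k then Re else Im) (exp (comp4 \<zeta> (k div 2))) else 0)"

lemma zc_exp4: "i < 4 \<Longrightarrow> zc i (exp4 \<zeta>) = exp (comp4 \<zeta> i)"
  by (simp add: zc_def exp4_def complex_eq_iff)

lemma exp4_cstar4 [simp]: "exp4 \<zeta> \<in> cstar4"
  unfolding cstar4_def using zc_exp4[of _ \<zeta>]
  by (auto simp: topspace_Euclidean_space exp4_def[of \<zeta>])

lemma exp4_eq_iff: "exp4 \<zeta> = exp4 \<eta> \<longleftrightarrow> (\<forall>i<4. exp (comp4 \<zeta> i) = exp (comp4 \<eta> i))"
  using cstar4_eqI[of "exp4 \<zeta>" "exp4 \<eta>"] zc_exp4 exp4_cstar4 by metis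

lemma continuous_on_exp4: "continuous_on UNIV exp4"
proof (rule continuous_on_coordinatewise_then_product)
  fix k
  show "continuous_on UNIV (\<lambda>\<zeta>. exp4 \<zeta> k)"
    unfolding exp4_def by (cases "k < 8"; cases "even k") (auto intro!: continuous_intros)
qed

lemma continuous_on_zc: "continuous_on S (zc i)"
proof -
  have "zc i = (\<lambda>x. of_real (x (2 * i)) + \<i> * of_real (x (2 * i + 1)))"
    by (auto simp: zc_def complex_eq_iff)
  moreover have "continuous_on S (\<lambda>x::nat \<Rightarrow> real. x j)" for j
    by (rule continuous_on_subset[OF continuous_on_product_coordinates subset_UNIV])
  ultimately show ?thesis
    by (auto intro!: continuous_intros)
qed

text \<open>The logarithms of 1 are the multiples of 2 pi i, which lie at distance at least 1 from
  each other, and a continuous function with discrete range is constant on a connected set.\<close>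

lemma exp_eq_one_constant:
  fixes h :: "'a::topological_space \<Rightarrow> complex"
  assumes "connected S" "continuous_on S h" "\<And>x. x \<in> S \<Longrightarrow> exp (h x) = 1" "x \<in> S" "y \<in> S"
  shows "h x = h y"
proof -
  have "1 \<le> norm (h y - h x)" if xy: "x \<in> S" "y \<in> S" "h y \<noteq> h x" for x y
  proof -
    obtain m n :: int where "Im (h x) = of_int (2 * m) * pi" "Im (h y) = of_int (2 * n) * pi"
        "Re (h x) = 0" "Re (h y) = 0"
      using assms(3)[OF xy(1)] assms(3)[OF xy(2)] unfolding exp_eq_1 by blast
    then have d: "h y - h x = Complex 0 (of_int (2 * (n - m)) * pi)"
      by (simp add: complex_eq_iff algebra_simps)
    then have "n \<noteq> m" using xy(3) by (auto simp: complex_eq_iff)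
    then have "1 \<le> \<bar>of_int (2 * (n - m)) :: real\<bar>"
    proof -
      have "1 \<le> \<bar>2 * (n - m)\<bar>" using \<open>n \<noteq> m\<close> by presburger
      then show ?thesis by (metis of_int_1_le_iff of_int_abs)
    qed
    moreover have "1 \<le> pi" using pi_gt3 by simp
    ultimately have "1 * 1 \<le> \<bar>of_int (2 * (n - m))\<bar> * pi"
      by (intro mult_mono) auto
    then show ?thesis
      using abs_Im_le_cmod[of "h y - h x"] by (simp add: d abs_mult)
  qed
  then have "h constant_on S"
    using assms by (intro continuous_discrete_range_constant) (auto intro!: exI[of _ "1::real"])
  then show ?thesis
    using assms(4,5) by (auto simp: constant_on_def)
qed

section \<open>Deck translations and the degree of a map\<close>

definition lat :: "(nat \<Rightarrow> int) \<Rightarrow> c4" where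
  "lat k = vec4 (\<lambda>i. \<i> * of_real (2 * pi * of_int (k i)))"

lemma comp4_lat: "i < 4 \<Longrightarrow> comp4 (lat k) i = \<i> * of_real (2 * pi * of_int (k i))"
  by (simp add: lat_def comp4_vec4)

lemma exp_lat: "i < 4 \<Longrightarrow> exp (comp4 (lat k) i) = 1"
  by (auto simp: comp4_lat exp_eq_1)

lemma exp4_add_lat: "exp4 (\<zeta> + lat k) = exp4 \<zeta>"
  by (simp add: exp4_eq_iff comp4_add exp_add exp_lat)

lemma lat_add: "lat (\<lambda>i. k i + l i) = lat k + lat l"
  by (rule comp4_eqI) (simp add: comp4_add comp4_lat algebra_simps)

lemma lat_eq_iff: "lat k = lat l \<longleftrightarrow> (\<forall>i<4. k i = l i)"
proof
  assume "lat k = lat l"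
  then show "\<forall>i<4. k i = l i"
    using comp4_lat[of _ k] comp4_lat[of _ l] by (auto simp: complex_eq_iff)
next
  assume "\<forall>i<4. k i = l i"
  then show "lat k = lat l"
    by (intro comp4_eqI) (simp add: comp4_lat)
qed

definition mat_vec :: "(nat \<Rightarrow> nat \<Rightarrow> int) \<Rightarrow> (nat \<Rightarrow> int) \<Rightarrow> nat \<Rightarrow> int" where
  "mat_vec A k i = (\<Sum>j<4. A i j * k j)"

definition is_lift :: "((nat \<Rightarrow> real) \<Rightarrow> nat \<Rightarrow> real) \<Rightarrow> (c4 \<Rightarrow> c4) \<Rightarrow> bool" where
  "is_lift F f \<longleftrightarrow> continuous_on UNIV f \<and> (\<forall>\<zeta>. F (exp4 \<zeta>) = exp4 (f \<zeta>))"

text \<open>Equivariance of a lift under the deck group: \<open>A\<close> is the matrix of the map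
  on the fundamental group Z^4, which is also H_1. Only entries with indices below 4 are
  determined.\<close>

definition is_degree :: "((nat \<Rightarrow> real) \<Rightarrow> nat \<Rightarrow> real) \<Rightarrow> (nat \<Rightarrow> nat \<Rightarrow> int) \<Rightarrow> bool" where
  "is_degree F A \<longleftrightarrow> (\<exists>f. is_lift F f \<and> (\<forall>\<zeta> k. f (\<zeta> + lat k) = f \<zeta> + lat (mat_vec A k)))"

text \<open>C^4 is contractible, so every nonvanishing component of the map, pulled back by
  \<open>exp4\<close>, has a continuous logarithm.\<close>

lemma lift_exists:
  assumes F: "continuous_on cstar4 F" "F \<in> cstar4 \<rightarrow> cstar4"
  obtains f where "is_lift F f"
proof -
  have FE: "F (exp4 \<zeta>) \<in> cstar4" for \<zeta>
    using F(2) by auto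
  have "\<exists>g. continuous_on UNIV g \<and> (\<forall>\<zeta>. zc i (F (exp4 \<zeta>)) = exp (g \<zeta>))" if i: "i < 4" for i
  proof -
    have "continuous_on UNIV (\<lambda>\<zeta>. F (exp4 \<zeta>))"
      by (rule continuous_on_compose2[OF F(1) continuous_on_exp4]) auto
    then have "continuous_on UNIV (\<lambda>\<zeta>. zc i (F (exp4 \<zeta>)))"
      by (rule continuous_on_compose2[OF continuous_on_zc[of UNIV]]) auto
    from continuous_logarithm_on_contractible[OF this convex_imp_contractible[OF convex_UNIV]]
    show ?thesis
      using cstar4_nonzero[OF FE i] by (metis UNIV_I)
  qed
  then obtain g where g: "\<And>i. i < 4 \<Longrightarrow> continuous_on UNIV (g i)"
    "\<And>i \<zeta>. i < 4 \<Longrightarrow> zc i (F (exp4 \<zeta>)) = exp (g i \<zeta>)"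
    by metis
  have "is_lift F (\<lambda>\<zeta>. vec4 (\<lambda>i. g i \<zeta>))"
    unfolding is_lift_def
  proof (intro conjI allI)
    show "continuous_on UNIV (\<lambda>\<zeta>. vec4 (\<lambda>i. g i \<zeta>))"
      using g(1) by (intro continuous_on_vec4)
    show "F (exp4 \<zeta>) = exp4 (vec4 (\<lambda>i. g i \<zeta>))" for \<zeta>
      by (rule cstar4_eqI[OF FE exp4_cstar4]) (simp add: g(2) zc_exp4 comp4_vec4)
  qed
  then show thesis by (rule that)
qed

lemma exp4_eq_difference_constant:
  fixes f g :: "c4 \<Rightarrow> c4"
  assumes "continuous_on UNIV f" "continuous_on UNIV g" "\<And>\<zeta>. exp4 (f \<zeta>) = exp4 (g \<zeta>)"
  shows "f \<zeta> - g \<zeta> = f \<eta> - g \<eta>"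
proof (rule comp4_eqI)
  fix i :: nat assume i: "i < 4"
  show "comp4 (f \<zeta> - g \<zeta>) i = comp4 (f \<eta> - g \<eta>) i"
  proof (rule exp_eq_one_constant[where S = UNIV and h = "\<lambda>\<zeta>. comp4 (f \<zeta> - g \<zeta>) i"])
    show "continuous_on UNIV (\<lambda>\<zeta>. comp4 (f \<zeta> - g \<zeta>) i)"
      using assms by (intro continuous_intros)
    show "exp (comp4 (f \<xi> - g \<xi>) i) = 1" for \<xi>
      using assms(3)[of \<xi>] i by (simp add: exp4_eq_iff comp4_diff exp_diff)
    show "connected (UNIV :: c4 set)"
      by (rule convex_connected[OF convex_UNIV])
  qed simp_all
qed

lemma lift_unique:
  assumes "is_lift F f" "is_lift F g"
  shows "f \<zeta> - g \<zeta> = f \<eta> - g \<eta>"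
  using assms unfolding is_lift_def by (intro exp4_eq_difference_constant) (blast, blast, metis)

text \<open>\<open>exp4\<close> is invariant under lattice translations, so f (\<zeta> + lat k) and
  f \<zeta> have the same image under it. Their difference is therefore constant and in each
  coordinate a logarithm of 1.\<close>

lemma lift_lat:
  assumes f: "is_lift F f"
  obtains N where "\<And>\<zeta> k. f (\<zeta> + lat k) = f \<zeta> + lat (N k)"
proof -
  have "\<exists>m. \<forall>\<zeta>. f (\<zeta> + lat k) = f \<zeta> + lat m" for k
  proof -
    have cont: "continuous_on UNIV (\<lambda>\<zeta>. f (\<zeta> + lat k))" "continuous_on UNIV f"
      using f by (auto simp: is_lift_def intro!: continuous_on_compose2[of UNIV f] continuous_intros)
    have E: "exp4 (f (\<zeta> + lat k)) = exp4 (f \<zeta>)" for \<zeta>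
      using f exp4_add_lat unfolding is_lift_def by metis
    note const = exp4_eq_difference_constant[OF cont E]
    have "\<exists>m::int. comp4 (f (0 + lat k)) i - comp4 (f 0) i = \<i> * of_real (2 * pi * of_int m)" if i: "i < 4" for i
    proof -
      have "exp (comp4 (f (0 + lat k)) i) = exp (comp4 (f 0) i)"
        using E[of 0] i by (simp add: exp4_eq_iff)
      then show ?thesis
        unfolding exp_eq by (auto intro!: exI simp: algebra_simps)
    qed
    then obtain m where m: "\<And>i. i < 4 \<Longrightarrow> comp4 (f (0 + lat k)) i - comp4 (f 0) i = \<i> * of_real (2 * pi * of_int (m i))"
      by metis
    have "f (0 + lat k) - f 0 = lat m"
      using m by (intro comp4_eqI) (simp only: comp4_lat comp4_diff)
    then have "f (\<zeta> + lat k) = f \<zeta> + lat m" for \<zeta>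
      using const[of \<zeta> 0] by (simp add: algebra_simps)
    then show ?thesis by blast
  qed
  then show thesis using that by metis
qed

text \<open>Integer vectors are functions on all of \<open>nat\<close> here; \<open>cong\<close>
  says that only the first four entries count, so \<open>N\<close> is determined by its values on
  four unit vectors.\<close>

lemma additive_eq_mat_vec:
  fixes N :: "(nat \<Rightarrow> int) \<Rightarrow> int"
  assumes add: "\<And>k l. N (\<lambda>i. k i + l i) = N k + N l"
    and cong: "\<And>k l. (\<And>i. i < 4 \<Longrightarrow> k i = l i) \<Longrightarrow> N k = N l"
  shows "N k = (\<Sum>j<4. N (\<lambda>i. of_bool (i = j)) * k j)"
proof -
  have zero: "N (\<lambda>i. 0) = 0"
    using add[of "\<lambda>i. 0" "\<lambda>i. 0"] by simp
  have nat_mult: "N (\<lambda>i. int m * l i) = int m * N l" for m l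
  proof (induction m)
    case (Suc m)
    have "N (\<lambda>i. int m * l i + l i) = int m * N l + N l"
      using Suc add[of "\<lambda>i. int m * l i" l] by simp
    then show ?case by (simp add: algebra_simps)
  qed (simp add: zero)
  have int_mult: "N (\<lambda>i. m * l i) = m * N l" for m l
  proof (cases "m \<ge> 0")
    case True
    then show ?thesis using nat_mult[of "nat m" l] by simp
  next
    case False
    have "N (\<lambda>i. m * l i) + N (\<lambda>i. int (nat (- m)) * l i) = N (\<lambda>i. m * l i + int (nat (- m)) * l i)"
      by (simp only: add)
    also have "(\<lambda>i. m * l i + int (nat (- m)) * l i) = (\<lambda>i. 0)"
      using False by auto
    finally show ?thesis
      using False zero nat_mult[of "nat (- m)" l] by simp
  qed
  have sum: "N (\<lambda>i. \<Sum>j\<in>J. f j i) = (\<Sum>j\<in>J. N (f j))" if "finite J" for f and J :: "nat set"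
    using that by (induction J rule: finite_induct) (simp_all add: zero add)
  have "N k = N (\<lambda>i. \<Sum>j<4. k j * of_bool (i = j))"
  proof (rule cong)
    fix i :: nat assume "i < 4"
    then have "k i = (\<Sum>j<4. if i = j then k j else 0)" by simp
    also have "\<dots> = (\<Sum>j<4. k j * of_bool (i = j))" by (intro sum.cong) auto
    finally show "k i = (\<Sum>j<4. k j * of_bool (i = j))" .
  qed
  also have "\<dots> = (\<Sum>j<4. N (\<lambda>i. k j * of_bool (i = j)))"
    by (simp only: sum[OF finite_lessThan])
  finally show ?thesis
    by (simp only: int_mult mult.commute)
qed

lemma degree_exists:
  assumes "continuous_on cstar4 F" "F \<in> cstar4 \<rightarrow> cstar4"
  obtains A where "is_degree F A"
proof -
  obtain f where f: "is_lift F f" using lift_exists[OF assms] .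
  obtain N where N: "\<And>\<zeta> k. f (\<zeta> + lat k) = f \<zeta> + lat (N k)" using lift_lat[OF f] by blast
  define A where "A i j = N (\<lambda>i. of_bool (i = j)) i" for i j :: nat
  have "lat (N (\<lambda>i. k i + l i)) = lat (\<lambda>i. N k i + N l i)" for k l
    using N[of 0 "\<lambda>i. k i + l i"] N[of "0 + lat k" l] N[of 0 k]
    by (simp add: lat_add add.assoc)
  then have add: "N (\<lambda>i. k i + l i) i = N k i + N l i" if "i < 4" for k l i
    using that unfolding lat_eq_iff by blast
  have cong: "N k i = N l i" if "\<And>i. i < 4 \<Longrightarrow> k i = l i" "i < 4" for k l i
  proof -
    have "lat k = lat l" using that(1) by (simp add: lat_eq_iff)
    then have "lat (N k) = lat (N l)" using N[of 0 k] N[of 0 l] by simp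
    then show ?thesis using that(2) by (simp add: lat_eq_iff)
  qed
  have "N k i = mat_vec A k i" if "i < 4" for k i
    unfolding mat_vec_def A_def using add cong that by (intro additive_eq_mat_vec) blast+
  then have "lat (N k) = lat (mat_vec A k)" for k
    by (simp add: lat_eq_iff)
  then have "is_degree F A"
    unfolding is_degree_def using f N by (intro exI[of _ f]) simp
  then show thesis by (rule that)
qed

lemma mat_vec_unit:
  assumes "j < 4" shows "mat_vec A (\<lambda>i. of_bool (i = j)) i = A i j"
proof -
  have "mat_vec A (\<lambda>i. of_bool (i = j)) i = (\<Sum>l<4. if l = j then A i l else 0)"
    unfolding mat_vec_def by (intro sum.cong) auto
  then show ?thesis using assms by simp
qed

text \<open>Two lifts differ by a constant, which drops out of the increments along lattice
  vectors.\<close>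

lemma degree_unique:
  assumes "is_degree F A" "is_degree F B" "i < 4" "j < 4"
  shows "A i j = B i j"
proof -
  obtain f g where f: "is_lift F f" "\<And>\<zeta> k. f (\<zeta> + lat k) = f \<zeta> + lat (mat_vec A k)"
    and g: "is_lift F g" "\<And>\<zeta> k. g (\<zeta> + lat k) = g \<zeta> + lat (mat_vec B k)"
    using assms unfolding is_degree_def by metis
  define e :: "nat \<Rightarrow> int" where "e i = of_bool (i = j)" for i
  have "f (0 + lat e) - g (0 + lat e) = f 0 - g 0"
    by (rule lift_unique[OF f(1) g(1)])
  then have "lat (mat_vec A e) = lat (mat_vec B e)"
    unfolding f(2) g(2) by (simp add: algebra_simps)
  then have "mat_vec A e i = mat_vec B e i"
    using assms(3) by (simp add: lat_eq_iff)
  then show ?thesis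
    unfolding e_def mat_vec_unit[OF assms(4)] .
qed

lemma degree_compose:
  assumes "is_degree F A" "is_degree G B" and H: "\<And>x. x \<in> cstar4 \<Longrightarrow> H x = F (G x)"
  shows "is_degree H (mat4_mult A B)"
proof -
  obtain f g where f: "is_lift F f" "\<And>\<zeta> k. f (\<zeta> + lat k) = f \<zeta> + lat (mat_vec A k)"
    and g: "is_lift G g" "\<And>\<zeta> k. g (\<zeta> + lat k) = g \<zeta> + lat (mat_vec B k)"
    using assms unfolding is_degree_def by metis
  have "mat_vec A (mat_vec B k) = mat_vec (mat4_mult A B) k" for k
  proof
    fix i
    have "mat_vec A (mat_vec B k) i = (\<Sum>j<4. \<Sum>l<4. A i j * B j l * k l)"
      by (simp add: mat_vec_def sum_distrib_left mult.assoc)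
    also have "\<dots> = (\<Sum>l<4. \<Sum>j<4. A i j * B j l * k l)"
      by (rule sum.swap)
    finally show "mat_vec A (mat_vec B k) i = mat_vec (mat4_mult A B) k i"
      by (simp add: mat_vec_def mat4_mult_def sum_distrib_right)
  qed
  moreover have "is_lift H (\<lambda>\<zeta>. f (g \<zeta>))"
    unfolding is_lift_def
  proof (intro conjI allI)
    show "continuous_on UNIV (\<lambda>\<zeta>. f (g \<zeta>))"
      using f(1) g(1) unfolding is_lift_def by (intro continuous_on_compose2[of UNIV f UNIV g]) auto
    show "H (exp4 \<zeta>) = exp4 (f (g \<zeta>))" for \<zeta>
      using f(1) g(1) H[OF exp4_cstar4] unfolding is_lift_def by metis
  qed
  ultimately show ?thesis
    unfolding is_degree_def by (intro exI[of _ "\<lambda>\<zeta>. f (g \<zeta>)"]) (simp add: f(2) g(2))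
qed

text \<open>The linear map \<open>A\<close> on C^4 is a lift, because the exponential turns integral
  combinations into monomials.\<close>

lemma degree_mono_map: "is_degree (mono_map A) A"
proof -
  define f where "f \<zeta> = vec4 (\<lambda>i. \<Sum>j<4. of_int (A i j) * comp4 \<zeta> j)" for \<zeta>
  have "is_lift (mono_map A) f"
    unfolding is_lift_def
  proof (intro conjI allI)
    show "continuous_on UNIV f"
      unfolding f_def by (intro continuous_intros)
    fix \<zeta>
    show "mono_map A (exp4 \<zeta>) = exp4 (f \<zeta>)"
    proof (rule cstar4_eqI)
      fix i :: nat assume i: "i < 4"
      have "zc i (mono_map A (exp4 \<zeta>)) = (\<Prod>j<4. exp (of_int (A i j) * comp4 \<zeta> j))"
        unfolding zc_mono_map[OF exp4_cstar4 i]
        by (intro prod.cong refl) (simp add: zc_exp4 exp_power_int mult.commute)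
      then show "zc i (mono_map A (exp4 \<zeta>)) = zc i (exp4 (f \<zeta>))"
        by (simp add: zc_exp4 i f_def comp4_vec4 exp_sum)
    qed (simp_all add: mono_map_cstar4)
  qed
  moreover have "f (\<zeta> + lat k) = f \<zeta> + lat (mat_vec A k)" for \<zeta> k
  proof (rule comp4_eqI)
    fix i :: nat assume i: "i < 4"
    have "(\<Sum>j<4. of_int (A i j) * comp4 (\<zeta> + lat k) j) =
        (\<Sum>j<4. of_int (A i j) * comp4 \<zeta> j + \<i> * of_real (2 * pi * of_int (A i j * k j)))"
      by (intro sum.cong refl) (simp add: comp4_add comp4_lat algebra_simps)
    also have "\<dots> = (\<Sum>j<4. of_int (A i j) * comp4 \<zeta> j) + \<i> * of_real (2 * pi * of_int (mat_vec A k i))"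
      by (simp only: sum.distrib mat_vec_def of_int_sum of_real_sum sum_distrib_left)
    finally show "comp4 (f (\<zeta> + lat k)) i = comp4 (f \<zeta> + lat (mat_vec A k)) i"
      using i by (simp only: f_def comp4_add comp4_vec4 comp4_lat)
  qed
  ultimately show ?thesis
    unfolding is_degree_def by blast
qed

text \<open>A Rouche argument on the j-th coordinate circle: the ratio of the i-th components stays
  within distance less than 1 of the point 1, so it does not wind around 0. Its winding number is
  \<open>B i j - A i j\<close>.\<close>

lemma degree_nearby:
  assumes F: "is_degree F A" and G: "is_degree G B" and i: "i < 4" and j: "j < 4"
    and maps: "F \<in> cstar4 \<rightarrow> cstar4" "G \<in> cstar4 \<rightarrow> cstar4"
    and near: "\<And>t. t \<in> {0..1} \<Longrightarrow>
      norm (zc i (G (exp4 (t *\<^sub>R lat (\<lambda>l. of_bool (l = j))))) - zc i (F (exp4 (t *\<^sub>R lat (\<lambda>l. of_bool (l = j))))))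
        < norm (zc i (F (exp4 (t *\<^sub>R lat (\<lambda>l. of_bool (l = j))))))"
  shows "A i j = B i j"
proof -
  define e where "e = lat (\<lambda>l. of_bool (l = j))"
  obtain f g where f: "is_lift F f" "\<And>\<zeta> k. f (\<zeta> + lat k) = f \<zeta> + lat (mat_vec A k)"
    and g: "is_lift G g" "\<And>\<zeta> k. g (\<zeta> + lat k) = g \<zeta> + lat (mat_vec B k)"
    using F G unfolding is_degree_def by metis
  define h where "h t = comp4 (g (t *\<^sub>R e)) i - comp4 (f (t *\<^sub>R e)) i" for t
  have exp_h: "exp (h t) = zc i (G (exp4 (t *\<^sub>R e))) / zc i (F (exp4 (t *\<^sub>R e)))" for t
  proof -
    have "F (exp4 (t *\<^sub>R e)) = exp4 (f (t *\<^sub>R e))" "G (exp4 (t *\<^sub>R e)) = exp4 (g (t *\<^sub>R e))"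
      using f(1) g(1) unfolding is_lift_def by blast+
    then show ?thesis
      by (simp only: h_def exp_diff zc_exp4[OF i])
  qed
  have cont_h: "continuous_on {0..1} h"
  proof -
    have line: "continuous_on {0..1} (\<lambda>t::real. t *\<^sub>R e)"
      by (intro continuous_intros)
    have "continuous_on {0..1} (\<lambda>t. f (t *\<^sub>R e))" "continuous_on {0..1} (\<lambda>t. g (t *\<^sub>R e))"
      using f(1) g(1) unfolding is_lift_def by (auto intro: continuous_on_compose2[OF _ line])
    then show ?thesis
      unfolding h_def by (intro continuous_on_diff continuous_on_comp4)
  qed
  have nz: "exp (h t) \<notin> \<real>\<^sub>\<le>\<^sub>0" if t: "t \<in> {0..1}" for t
  proof -
    have F0: "zc i (F (exp4 (t *\<^sub>R e))) \<noteq> 0"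
      using cstar4_nonzero[OF funcset_mem[OF maps(1) exp4_cstar4] i] .
    have "norm (exp (h t) - 1) = norm (zc i (G (exp4 (t *\<^sub>R e))) - zc i (F (exp4 (t *\<^sub>R e)))) / norm (zc i (F (exp4 (t *\<^sub>R e))))"
      unfolding exp_h using F0 by (simp add: norm_divide[symmetric] diff_divide_distrib)
    also have "\<dots> < 1"
      using near[OF t] F0 by (simp add: e_def)
    finally have "\<bar>Re (exp (h t) - 1)\<bar> < 1"
      using abs_Re_le_cmod order_le_less_trans by blast
    then have "Re (exp (h t)) > 0" by simp
    then show ?thesis
      using complex_nonpos_Reals_iff by auto
  qed
  \<comment> \<open>On the right half-plane the principal logarithm is continuous, so
    \<open>h\<close> differs from \<open>Ln (exp (h t))\<close> by a constant; as
    \<open>exp (h t)\<close> takes the same value at 0 and 1, so does \<open>h\<close>.\<close>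
  have "h 1 - Ln (exp (h 1)) = h 0 - Ln (exp (h 0))"
  proof (rule exp_eq_one_constant[where S = "{0..1::real}" and h = "\<lambda>t. h t - Ln (exp (h t))"])
    show "continuous_on {0..1} (\<lambda>t. h t - Ln (exp (h t)))"
      using nz by (intro continuous_intros cont_h) auto
    show "exp (h t - Ln (exp (h t))) = 1" for t
      by (simp add: exp_diff)
  qed auto
  moreover have "exp (h 1) = exp (h 0)"
    using exp4_add_lat[of 0] by (simp add: exp_h e_def)
  ultimately have "h 1 = h 0" by simp
  moreover have "h 1 = h 0 + \<i> * of_real (2 * pi * of_int (B i j)) - \<i> * of_real (2 * pi * of_int (A i j))"
    using f(2)[of 0] g(2)[of 0] i j
    by (simp add: h_def e_def comp4_add comp4_lat mat_vec_unit)
  ultimately show ?thesis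
    by (simp add: complex_eq_iff)
qed

section \<open>The degree on the group of symplectomorphisms\<close>

lemma symplectomorphism_smooth_map: "symplectomorphism M \<omega> F \<Longrightarrow> smooth_map M M F"
  by (simp add: symplectomorphism_def diffeo_def)

lemma smooth_map_cstar4:
  assumes "smooth_map cstar4_manifold cstar4_manifold F"
  shows "F \<in> cstar4 \<rightarrow> cstar4" "continuous_on cstar4 F" "k < 8 \<Longrightarrow> smooth_on 8 cstar4 (\<lambda>x. F x k)"
  using assms smooth_map_open_manifold[OF openin_cstar4, of F]
  by (auto simp: smooth_map_def mtop_open_manifold[OF openin_cstar4] continuous_map_in_subtopology)

definition degree_mat :: "((nat \<Rightarrow> real) \<Rightarrow> nat \<Rightarrow> real) \<Rightarrow> nat \<Rightarrow> nat \<Rightarrow> int" where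
  "degree_mat F = (SOME A. is_degree F A)"

lemma is_degree_degree_mat:
  assumes "smooth_map cstar4_manifold cstar4_manifold F"
  shows "is_degree F (degree_mat F)"
  using degree_exists[OF smooth_map_cstar4(2,1)[OF assms]] unfolding degree_mat_def by (metis someI)

lemma carrier_Symp: "carrier (Symp M \<omega>) = {F \<in> extensional (topspace (mtop M)). symplectomorphism M \<omega> F}"
  by (simp add: Symp_def)

text \<open>The degree is read off on the four coordinate circles, whose union \<open>K\<close> is
  compact. There the components of \<open>F\<close> stay away from 0, so every map uniformly close
  to \<open>F\<close> on \<open>K\<close> falls under \<open>degree_nearby\<close>.\<close>

lemma degree_locally_constant:
  assumes F: "F \<in> carrier (Symp cstar4_manifold \<omega>)"
  shows "\<exists>U. openin (Symp_topology cstar4_manifold \<omega>) U \<and> F \<in> U \<and>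
    (\<forall>G\<in>U. \<forall>i<4. \<forall>j<4. degree_mat G i j = degree_mat F i j)"
proof -
  let ?M = cstar4_manifold
  let ?c = "(cstar4, \<lambda>x. x) :: (nat \<Rightarrow> real) chart"
  define loop where "loop j t = exp4 (t *\<^sub>R lat (\<lambda>l. of_bool (l = j)))" for j :: nat and t :: real
  define K where "K = (\<Union>j<4. loop j ` {0..1})"
  have sF: "smooth_map ?M ?M F"
    using F by (auto simp: carrier_Symp intro: symplectomorphism_smooth_map)
  note F' = smooth_map_cstar4[OF sF]
  have "continuous_on {0..1} (loop j)" for j
    unfolding loop_def by (intro continuous_on_compose2[OF continuous_on_exp4] continuous_intros) auto
  then have K: "compact K"
    unfolding K_def by (intro compact_UN compact_continuous_image) auto
  have KW: "K \<subseteq> cstar4"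
    by (auto simp: K_def loop_def)
  have K0: "K \<noteq> {}" by (auto simp: K_def intro: exI[of _ 0])
  have "\<exists>e>0. \<forall>x\<in>K. e \<le> norm (zc i (F x))" if i: "i < 4" for i
  proof -
    have "continuous_on K (\<lambda>x. norm (zc i (F x)))"
      using continuous_on_subset[OF F'(2) KW]
      by (intro continuous_on_norm continuous_on_compose2[OF continuous_on_zc[of UNIV]]) auto
    then obtain x where x: "x \<in> K" "\<forall>y\<in>K. norm (zc i (F x)) \<le> norm (zc i (F y))"
      using continuous_attains_inf[OF K K0] by blast
    moreover have "norm (zc i (F x)) > 0"
      using x(1) KW F'(1) i by (simp add: subset_iff Pi_iff)
    ultimately show ?thesis by blast
  qed
  then obtain e where e: "\<And>i. i < 4 \<Longrightarrow> e i > 0" "\<And>i x. i < 4 \<Longrightarrow> x \<in> K \<Longrightarrow> e i \<le> norm (zc i (F x))"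
    by metis
  \<comment> \<open>The error in a complex component is bounded by the sum of two real coordinate
    errors, hence the division by 2.\<close>
  define \<epsilon> where "\<epsilon> = Min (e ` {..<4}) / 2"
  have ne: "{..<4::nat} \<noteq> {}" by (simp add: lessThan_empty_iff)
  have \<epsilon>: "\<epsilon> > 0" "\<And>i. i < 4 \<Longrightarrow> 2 * \<epsilon> \<le> e i"
    using e(1) ne by (auto simp: \<epsilon>_def)
  have FS: "F \<in> smooth_maps ?M ?M"
    using F sF by (simp add: carrier_Symp smooth_maps_def)
  \<comment> \<open>Derivatives of order 0 suffice, as winding numbers are stable under uniform
    approximation.\<close>
  define U where "U = Cinf_nbhd ?M ?M F ?c ?c K 0 \<epsilon>"
  have FK: "F ` K \<subseteq> cstar4" using F'(1) KW by auto
  have "compactin (mtop ?M) K"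
    using K KW by (simp add: mtop_open_manifold[OF openin_cstar4] compactin_subtopology)
  then have "openin (Cinf_topology ?M ?M) U"
    unfolding Cinf_topology_def U_def using FS KW FK \<epsilon>(1)
    by (intro topology_generated_by_Basis insertI2 CollectI exI[of _ F] exI[of _ ?c] exI[of _ K] exI[of _ "0::nat"] exI[of _ \<epsilon>])
      (auto simp: open_manifold_def)
  then have "openin (Symp_topology ?M \<omega>) (carrier (Symp ?M \<omega>) \<inter> U)"
    unfolding Symp_topology_def by (rule openin_subtopology_Int2)
  moreover have "F \<in> carrier (Symp ?M \<omega>) \<inter> U"
    using F FS FK \<epsilon>(1) by (simp add: U_def Cinf_nbhd_def)
  moreover have "degree_mat G i j = degree_mat F i j"
    if G: "G \<in> carrier (Symp ?M \<omega>) \<inter> U" and i: "i < 4" and j: "j < 4" for G i j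
  proof -
    have sG: "smooth_map ?M ?M G"
      using G by (auto simp: carrier_Symp intro: symplectomorphism_smooth_map)
    have coord: "\<bar>G x k - F x k\<bar> < \<epsilon>" if x: "x \<in> K" and k: "k < 8" for x k
    proof -
      have "\<forall>x\<in>K. \<forall>k<8. \<bar>G (inv_into cstar4 (\<lambda>x. x) x) k - F (inv_into cstar4 (\<lambda>x. x) x) k\<bar> < \<epsilon>"
        using G by (simp add: U_def Cinf_nbhd_def iter_partial_def open_manifold_def)
      moreover have "inv_into cstar4 (\<lambda>x. x) x = x"
        using x KW by (intro inv_into_ident) blast
      ultimately show ?thesis
        using x k by metis
    qed
    have "degree_mat F i j = degree_mat G i j"
    proof (rule degree_nearby[OF is_degree_degree_mat[OF sF] is_degree_degree_mat[OF sG] i j F'(1) smooth_map_cstar4(1)[OF sG]])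
      fix t :: real assume t: "t \<in> {0..1}"
      have x: "loop j t \<in> K" unfolding K_def using t j by blast
      have "norm (zc i (G (loop j t)) - zc i (F (loop j t))) \<le>
          \<bar>G (loop j t) (2 * i) - F (loop j t) (2 * i)\<bar> + \<bar>G (loop j t) (2 * i + 1) - F (loop j t) (2 * i + 1)\<bar>"
        using cmod_le[of "zc i (G (loop j t)) - zc i (F (loop j t))"] by (simp add: zc_def)
      also have "\<dots> < \<epsilon> + \<epsilon>"
        using i by (intro add_strict_mono coord x) auto
      also have "\<dots> \<le> norm (zc i (F (loop j t)))"
        using \<epsilon>(2)[OF i] e(2)[OF i x] by linarith
      finally show "norm (zc i (G (exp4 (t *\<^sub>R lat (\<lambda>l. of_bool (l = j))))) - zc i (F (exp4 (t *\<^sub>R lat (\<lambda>l. of_bool (l = j))))))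
        < norm (zc i (F (exp4 (t *\<^sub>R lat (\<lambda>l. of_bool (l = j))))))"
        unfolding loop_def .
    qed
    then show ?thesis by simp
  qed
  ultimately show ?thesis by blast
qed

lemma degree_constant_on_components:
  assumes C: "C \<in> connected_components_of (Symp_topology cstar4_manifold \<omega>)"
    and FG: "F \<in> C" "G \<in> C" and i: "i < 4" and j: "j < 4"
  shows "degree_mat F i j = degree_mat G i j"
proof -
  let ?T = "Symp_topology cstar4_manifold \<omega>"
  have top: "topspace ?T \<subseteq> carrier (Symp cstar4_manifold \<omega>)"
    by (simp add: Symp_topology_def)
  have "continuous_map ?T (discrete_topology UNIV) (\<lambda>F. degree_mat F i j)"
    unfolding continuous_map_def
  proof (intro conjI allI impI)
    fix V :: "int set"
    show "openin ?T {F \<in> topspace ?T. degree_mat F i j \<in> V}"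
    proof (subst openin_subopen, intro ballI)
      fix F assume F: "F \<in> {F \<in> topspace ?T. degree_mat F i j \<in> V}"
      then have "F \<in> carrier (Symp cstar4_manifold \<omega>)" using top by blast
      then obtain U where U: "openin ?T U" "F \<in> U"
        "\<forall>G\<in>U. \<forall>i<4. \<forall>j<4. degree_mat G i j = degree_mat F i j"
        by (metis degree_locally_constant)
      have "U \<subseteq> {F \<in> topspace ?T. degree_mat F i j \<in> V}"
      proof
        fix G assume "G \<in> U"
        then show "G \<in> {F \<in> topspace ?T. degree_mat F i j \<in> V}"
          using U(3)[rule_format, OF _ i j, of G] F openin_subset[OF U(1)] by auto
      qed
      then show "\<exists>U. openin ?T U \<and> F \<in> U \<and> U \<subseteq> {F \<in> topspace ?T. degree_mat F i j \<in> V}"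
        using U(1,2) by blast
    qed
  qed auto
  moreover have "connectedin ?T C"
    using C by (rule connectedin_connected_components_of)
  ultimately have "connectedin (discrete_topology UNIV) ((\<lambda>F. degree_mat F i j) ` C)"
    by (rule connectedin_continuous_map_image)
  then have "\<exists>a. (\<lambda>F. degree_mat F i j) ` C \<subseteq> {a}"
    by (simp add: connectedin_discrete_topology)
  then show ?thesis using FG by (auto simp: image_subset_iff)
qed

section \<open>The chain rule and the integral of a Jacobian over a torus\<close>

text \<open>At a zero of \<open>f\<close> the difference quotient of the product is that of
  \<open>f\<close> times \<open>h\<close>, so continuity of \<open>h\<close> suffices. This avoids a
  circle in the proof of the chain rule, where \<open>h\<close> is itself a composition with the
  curve.\<close>

lemma DERIV_mult_zero:
  fixes f h :: "real \<Rightarrow> real"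
  assumes "(f has_real_derivative d) (at x)" "f x = 0" "isCont h x"
  shows "((\<lambda>y. f y * h y) has_real_derivative d * h x) (at x)"
proof -
  have "((\<lambda>y. (f y - f x) / (y - x)) \<longlongrightarrow> d) (at x)"
    using assms(1) by (simp add: has_field_derivative_iff)
  from tendsto_mult[OF this assms(3)[unfolded isCont_def]]
  show ?thesis
    unfolding has_field_derivative_iff by (simp add: assms(2))
qed

text \<open>Hadamard's decomposition at p = c s0 gives g (c s) = g p + \<Sum> (c s i - p i) h i (c
  s), where each summand has a factor that vanishes at s0. So the derivative involves only the
  values \<open>h i p\<close>.\<close>

lemma smooth_on_chain:
  assumes W: "openin (Euclidean_space n) W" and g: "smooth_on n W g"
    and c: "\<And>s. c s \<in> topspace (Euclidean_space n)" "c s0 \<in> W"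
    and d: "\<And>i s. i < n \<Longrightarrow> ((\<lambda>s. c s i) has_real_derivative c' s i) (at s)"
  shows "((\<lambda>s. g (c s)) has_real_derivative (\<Sum>i<n. partial_deriv i g (c s0) * c' s0 i)) (at s0)"
proof -
  define p where "p = c s0"
  have pW: "p \<in> W" and pE: "p \<in> topspace (Euclidean_space n)"
    using c by (auto simp: p_def)
  obtain \<rho> where \<rho>: "\<rho> > 0" "eball n p \<rho> \<subseteq> W"
    using eball_exists[OF W pW] .
  have "smooth_on n (eball n p \<rho>) g"
    using g Ck_on_subset[OF W \<rho>(2)] unfolding smooth_on_def by blast
  then obtain h where h: "\<And>i. i < n \<Longrightarrow> smooth_on n (eball n p \<rho>) (h i)"
    "\<And>x. x \<in> eball n p \<rho> \<Longrightarrow> g x = g p + (\<Sum>i<n. (x i - p i) * h i x)"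
    using Hadamard[OF pE] by metis
  have key: "((\<lambda>s. g (\<gamma> s)) has_real_derivative (\<Sum>i<n. \<gamma>' \<sigma> i * h i p)) (at \<sigma>)"
    if \<gamma>: "\<And>s. \<gamma> s \<in> topspace (Euclidean_space n)" "\<gamma> \<sigma> = p"
      and \<gamma>': "\<And>i s. i < n \<Longrightarrow> ((\<lambda>s. \<gamma> s i) has_real_derivative \<gamma>' s i) (at s)" for \<gamma> \<gamma>' \<sigma>
  proof -
    have cont_i: "continuous_on UNIV (\<lambda>s. \<gamma> s i)" if "i < n" for i
      using \<gamma>'[OF that] DERIV_isCont continuous_at_imp_continuous_on by blast
    have cont: "continuous_on UNIV \<gamma>"
    proof (rule continuous_on_coordinatewise_then_product)
      fix i show "continuous_on UNIV (\<lambda>s. \<gamma> s i)"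
      proof (cases "i < n")
        case False
        then have "\<gamma> s i = 0" for s
          using \<gamma>(1)[of s] by (simp add: topspace_Euclidean_space)
        then show ?thesis
          using continuous_on_cong[of UNIV UNIV "\<lambda>s. \<gamma> s i" "\<lambda>s. 0"] by simp
      qed (rule cont_i)
    qed
    define S where "S = {s. \<gamma> s \<in> eball n p \<rho>}"
    have "continuous_on UNIV (\<lambda>s. sqdist n p (\<gamma> s))"
      unfolding sqdist_def using cont_i by (intro continuous_intros) auto
    then have "open ((\<lambda>s. sqdist n p (\<gamma> s)) -` {..<\<rho>})"
      using open_vimage[OF open_lessThan] by blast
    moreover have "S = (\<lambda>s. sqdist n p (\<gamma> s)) -` {..<\<rho>}"
      using \<gamma>(1) by (auto simp: S_def eball_def)
    ultimately have S: "open S" by simp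
    have \<sigma>: "\<sigma> \<in> S"
      using \<gamma>(2) pE \<rho>(1) by (simp add: S_def eball_def sqdist_def)
    have "isCont (\<lambda>s. h i (\<gamma> s)) \<sigma>" if "i < n" for i
    proof -
      have "continuous_on S (\<lambda>s. h i (\<gamma> s))"
        by (rule continuous_on_compose2[OF smooth_on_imp_continuous_on[OF openin_eball h(1)[OF that]]
              continuous_on_subset[OF cont]]) (auto simp: S_def)
      then show ?thesis
        using S \<sigma> continuous_on_eq_continuous_at by blast
    qed
    moreover have "((\<lambda>s. \<gamma> s i - p i) has_real_derivative \<gamma>' \<sigma> i) (at \<sigma>)" if "i < n" for i
      using DERIV_diff[OF \<gamma>'[OF that] DERIV_const] by simp
    ultimately have "((\<lambda>s. (\<gamma> s i - p i) * h i (\<gamma> s)) has_real_derivative \<gamma>' \<sigma> i * h i p) (at \<sigma>)" if "i < n" for i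
      using DERIV_mult_zero[of "\<lambda>s. \<gamma> s i - p i" "\<gamma>' \<sigma> i" \<sigma> "\<lambda>s. h i (\<gamma> s)"] that \<gamma>(2) by simp
    then have "((\<lambda>s. \<Sum>i<n. (\<gamma> s i - p i) * h i (\<gamma> s)) has_real_derivative (\<Sum>i<n. \<gamma>' \<sigma> i * h i p)) (at \<sigma>)"
      by (intro DERIV_sum) simp
    from DERIV_add[OF DERIV_const[of "g p"] this]
    have D: "((\<lambda>s. g p + (\<Sum>i<n. (\<gamma> s i - p i) * h i (\<gamma> s))) has_real_derivative (\<Sum>i<n. \<gamma>' \<sigma> i * h i p)) (at \<sigma>)"
      by simp
    have "\<forall>\<^sub>F s in nhds \<sigma>. g (\<gamma> s) = g p + (\<Sum>i<n. (\<gamma> s i - p i) * h i (\<gamma> s))"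
      using eventually_nhds_in_open[OF S \<sigma>] by (rule eventually_mono) (rule h(2), simp add: S_def)
    from DERIV_cong_ev[OF refl this refl] D show ?thesis by blast
  qed
  \<comment> \<open>The same formula, applied to a coordinate line through \<open>p\<close>,
    identifies the coefficients.\<close>
  have "h i p = partial_deriv i g p" if i: "i < n" for i
  proof -
    have "((\<lambda>s. g (p(i := s))) has_real_derivative (\<Sum>j<n. of_bool (i = j) * h j p)) (at (p i))"
    proof (rule key)
      show "p(i := s) \<in> topspace (Euclidean_space n)" for s
        using pE i by (auto simp: topspace_Euclidean_space)
      show "((\<lambda>s. (p(i := s)) j) has_real_derivative of_bool (i = j)) (at s)" for j s
        using fun_upd_partial_simp[of p i j "at s"] by (cases "i = j") simp_all
    qed simp
    moreover have "(\<Sum>j<n. of_bool (i = j) * h j p) = (\<Sum>j<n. if i = j then h j p else 0)"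
      by (intro sum.cong) auto
    ultimately show ?thesis
      using DERIV_unique[OF smooth_on_has_partial_deriv[OF g i pW]] i by simp
  qed
  moreover have "((\<lambda>s. g (c s)) has_real_derivative (\<Sum>i<n. c' s0 i * h i p)) (at s0)"
    using c(1) d by (intro key) (simp_all add: p_def)
  ultimately show ?thesis
    by (simp add: p_def mult.commute)
qed

text \<open>Equality of mixed partial derivatives from one of them: differentiating b s t' - b s c =
  \<integral> bt under the integral sign shows that \<open>bs\<close> is an integral of
  \<open>bts\<close> in the second variable.\<close>

lemma mixed_partial_derivative:
  fixes b bs bt bts :: "real \<Rightarrow> real \<Rightarrow> real"
  assumes bs: "\<And>s t. ((\<lambda>s. b s t) has_real_derivative bs s t) (at s)"
    and bt: "\<And>s t. ((\<lambda>t. b s t) has_real_derivative bt s t) (at t)"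
    and bts: "\<And>s t. ((\<lambda>s. bt s t) has_real_derivative bts s t) (at s)"
    and cont: "continuous_on UNIV (\<lambda>(s, t). bts s t)"
  shows "((\<lambda>t. bs s t) has_real_derivative bts s t) (at t)"
proof -
  \<comment> \<open>Any base point below t works; it must be strictly below for a two-sided
    derivative at t.\<close>
  define c where "c = t - 1"
  have int_bt: "(bt s has_integral b s t' - b s c) {c..t'}" if "c \<le> t'" for s t'
    using that bt by (intro fundamental_theorem_of_calculus)
      (auto simp: has_real_derivative_iff_has_vector_derivative[symmetric] intro: has_field_derivative_at_within)
  have bs_eq: "bs s t' = bs s c + integral {c..t'} (bts s)" if t': "c \<le> t'" for t'
  proof -
    have "((\<lambda>s. integral (cbox c t') (bt s)) has_real_derivative integral (cbox c t') (bts s)) (at s within UNIV)"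
    proof (rule leibniz_rule_field_derivative)
      show "((\<lambda>s. bt s \<tau>) has_real_derivative bts s \<tau>) (at s within UNIV)" for s \<tau>
        using bts by simp
      show "bt s integrable_on cbox c t'" for s
        using int_bt[OF t'] by (auto simp: integrable_on_def)
      show "continuous_on (UNIV \<times> cbox c t') (\<lambda>(s, t). bts s t)"
        by (rule continuous_on_subset[OF cont]) auto
    qed auto
    moreover have "(\<lambda>s. integral (cbox c t') (bt s)) = (\<lambda>s. b s t' - b s c)"
      using integral_unique[OF int_bt[OF t']] by auto
    ultimately have "((\<lambda>s. b s t' - b s c) has_real_derivative integral {c..t'} (bts s)) (at s)"
      by simp
    from DERIV_unique[OF this DERIV_diff[OF bs bs]] show ?thesis by simp
  qed
  have "continuous_on {c..t + 1} (bts s)"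
  proof -
    have "continuous_on {c..t + 1} (\<lambda>t. (s, t))"
      by (intro continuous_on_Pair continuous_on_const continuous_on_id)
    from continuous_on_compose2[OF cont this] show ?thesis by simp
  qed
  then have "((\<lambda>t. integral {c..t} (bts s)) has_real_derivative bts s t) (at t within {c..t + 1})"
    by (rule integral_has_real_derivative) (simp add: c_def)
  then have "((\<lambda>t. integral {c..t} (bts s)) has_real_derivative bts s t) (at t)"
    using at_within_interior[of t "{c..t + 1}"] by (simp add: c_def)
  from DERIV_add[OF DERIV_const[of "bs s c"] this]
  have D: "((\<lambda>t. bs s c + integral {c..t} (bts s)) has_real_derivative bts s t) (at t)" by simp
  have "\<forall>\<^sub>F t' in nhds t. bs s t' = bs s c + integral {c..t'} (bts s)"
  proof (rule eventually_mono[OF eventually_nhds_in_open[OF open_greaterThan[of c]]])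
    show "t \<in> {c<..}" by (simp add: c_def)
    show "bs s t' = bs s c + integral {c..t'} (bts s)" if "t' \<in> {c<..}" for t'
      using that by (intro bs_eq) simp
  qed
  from DERIV_cong_ev[OF refl this refl] D show ?thesis by blast
qed

text \<open>The Jacobian is \<open>\<partial>\<^sub>s (a \<partial>\<^sub>t b) - \<partial>\<^sub>t (a \<partial>\<^sub>s b)\<close>.\<close>

lemma torus_jacobian_integral:
  fixes a b as at' bs bt bts :: "real \<Rightarrow> real \<Rightarrow> real"
  assumes as: "\<And>s t. ((\<lambda>s. a s t) has_real_derivative as s t) (at s)"
    and at': "\<And>s t. ((\<lambda>t. a s t) has_real_derivative at' s t) (at t)"
    and bs: "\<And>s t. ((\<lambda>s. b s t) has_real_derivative bs s t) (at s)"
    and bt: "\<And>s t. ((\<lambda>t. b s t) has_real_derivative bt s t) (at t)"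
    and bts: "\<And>s t. ((\<lambda>s. bt s t) has_real_derivative bts s t) (at s)"
    and cont: "continuous_on UNIV (\<lambda>(s, t). a s t)" "continuous_on UNIV (\<lambda>(s, t). as s t)"
      "continuous_on UNIV (\<lambda>(s, t). at' s t)" "continuous_on UNIV (\<lambda>(s, t). bs s t)"
      "continuous_on UNIV (\<lambda>(s, t). bt s t)" "continuous_on UNIV (\<lambda>(s, t). bts s t)"
    and per: "\<And>t. a 1 t = a 0 t + a1" "\<And>s. a s 1 = a s 0 + a2"
      "\<And>t. b 1 t = b 0 t + b1" "\<And>s. b s 1 = b s 0 + b2"
  shows "integral {0..1} (\<lambda>t. integral {0..1} (\<lambda>s. as s t * bt s t - at' s t * bs s t)) = a1 * b2 - a2 * b1"
proof -
  \<comment> \<open>\<open>K1\<close> and \<open>K2\<close> are the derivatives of a * bt in s and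
    of a * bs in t; their common term bts * a cancels in the difference.\<close>
  define K1 where "K1 s t = as s t * bt s t + bts s t * a s t" for s t
  define K2 where "K2 s t = at' s t * bs s t + bts s t * a s t" for s t
  have cK: "continuous_on UNIV (\<lambda>(s, t). K1 s t)" "continuous_on UNIV (\<lambda>(s, t). K2 s t)"
  proof -
    show "continuous_on UNIV (\<lambda>(s, t). K1 s t)"
      using cont unfolding K1_def split_beta by (intro continuous_on_add continuous_on_mult)
    show "continuous_on UNIV (\<lambda>(s, t). K2 s t)"
      using cont unfolding K2_def split_beta by (intro continuous_on_add continuous_on_mult)
  qed
  have swap: "continuous_on UNIV (\<lambda>(t, s). k s t)" if "continuous_on UNIV (\<lambda>(s, t). k s t)" for k :: "real \<Rightarrow> real \<Rightarrow> real"
    using continuous_on_compose2[OF that continuous_on_swap[of UNIV]] by (simp add: split_beta)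
  have line: "continuous_on {0..1} (\<lambda>s. k s t)" if "continuous_on UNIV (\<lambda>(s, t). k s t)" for k :: "real \<Rightarrow> real \<Rightarrow> real" and t
  proof -
    have "continuous_on {0..1} (\<lambda>s. (s, t))"
      by (intro continuous_on_Pair continuous_on_const continuous_on_id)
    from continuous_on_compose2[OF that this] show ?thesis by simp
  qed
  have param: "continuous_on {0..1} (\<lambda>t. integral {0..1} (\<lambda>s. k s t))"
    if "continuous_on UNIV (\<lambda>(s, t). k s t)" for k :: "real \<Rightarrow> real \<Rightarrow> real"
  proof -
    have "continuous_on ({0..1} \<times> cbox 0 1) (\<lambda>(t, s). k s t)"
      by (rule continuous_on_subset[OF swap[OF that]]) auto
    from integral_continuous_on_param[OF this] show ?thesis by simp
  qed
  have bs_t: "((\<lambda>t. bs s t) has_real_derivative bts s t) (at t)" for s t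
    by (rule mixed_partial_derivative[OF bs bt bts cont(6)])
  have FTC: "integral {0..1} g' = g 1 - g 0" if "\<And>x. (g has_real_derivative g' x) (at x)" for g g' :: "real \<Rightarrow> real"
    using that by (intro integral_unique fundamental_theorem_of_calculus)
      (auto simp: has_real_derivative_iff_has_vector_derivative[symmetric] intro: has_field_derivative_at_within)
  have bt_per: "bt 1 t = bt 0 t" for t
  proof -
    have "((\<lambda>t. b 0 t + b1) has_real_derivative bt 0 t) (at t)"
      using DERIV_add[OF bt DERIV_const] by simp
    moreover have "((\<lambda>t. b 0 t + b1) has_real_derivative bt 1 t) (at t)"
      using bt[of 1 t] per(3) by simp
    ultimately show ?thesis by (metis DERIV_unique)
  qed
  have bs_per: "bs s 1 = bs s 0" for s
  proof -
    have "((\<lambda>s. b s 0 + b2) has_real_derivative bs s 0) (at s)"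
      using DERIV_add[OF bs DERIV_const] by simp
    moreover have "((\<lambda>s. b s 0 + b2) has_real_derivative bs s 1) (at s)"
      using bs[where t = 1 and s = s] per(4) by simp
    ultimately show ?thesis by (metis DERIV_unique)
  qed
  have "integral {0..1} (\<lambda>s. K1 s t) = a 1 t * bt 1 t - a 0 t * bt 0 t" for t
    unfolding K1_def by (rule FTC) (rule DERIV_mult[OF as bts])
  then have "integral {0..1} (\<lambda>t. integral {0..1} (\<lambda>s. K1 s t)) = integral {0..1} (\<lambda>t. a1 * bt 0 t)"
    by (simp add: bt_per per(1) algebra_simps)
  also have "\<dots> = a1 * integral {0..1} (bt 0)"
    by simp
  also have "integral {0..1} (bt 0) = b2"
    using FTC[of "b 0" "bt 0"] bt per(4)[of 0] by simp
  finally have I1: "integral {0..1} (\<lambda>t. integral {0..1} (\<lambda>s. K1 s t)) = a1 * b2" .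
  have "integral {0..1} (\<lambda>t. K2 s t) = a s 1 * bs s 1 - a s 0 * bs s 0" for s
    unfolding K2_def by (rule FTC) (rule DERIV_mult[OF at' bs_t])
  then have "integral {0..1} (\<lambda>s. integral {0..1} (\<lambda>t. K2 s t)) = integral {0..1} (\<lambda>s. a2 * bs s 0)"
    by (simp add: bs_per per(2) algebra_simps)
  also have "\<dots> = a2 * integral {0..1} (\<lambda>s. bs s 0)"
    by simp
  also have "integral {0..1} (\<lambda>s. bs s 0) = b1"
    using FTC[of "\<lambda>s. b s 0" "\<lambda>s. bs s 0"] bs per(3)[of 0] by simp
  \<comment> \<open>\<open>K2\<close> is a derivative in t and was integrated over t first; the
    order is exchanged to match that of \<open>K1\<close>.\<close>
  also have "integral {0..1} (\<lambda>s. integral {0..1} (\<lambda>t. K2 s t)) = integral {0..1} (\<lambda>t. integral {0..1} (\<lambda>s. K2 s t))"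
    using integral_swap_continuous[of 0 0 1 1 K2] continuous_on_subset[OF cK(2) subset_UNIV] by simp
  finally have I2: "integral {0..1} (\<lambda>t. integral {0..1} (\<lambda>s. K2 s t)) = a2 * b1" .
  have "integral {0..1} (\<lambda>s. as s t * bt s t - at' s t * bs s t) =
      integral {0..1} (\<lambda>s. K1 s t) - integral {0..1} (\<lambda>s. K2 s t)" for t
  proof -
    have "integral {0..1} (\<lambda>s. K1 s t - K2 s t) = integral {0..1} (\<lambda>s. K1 s t) - integral {0..1} (\<lambda>s. K2 s t)"
      by (intro integral_diff integrable_continuous_interval line cK)
    moreover have "(\<lambda>s. K1 s t - K2 s t) = (\<lambda>s. as s t * bt s t - at' s t * bs s t)"
      by (auto simp: K1_def K2_def)
    ultimately show ?thesis by simp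
  qed
  then have "integral {0..1} (\<lambda>t. integral {0..1} (\<lambda>s. as s t * bt s t - at' s t * bs s t)) =
      integral {0..1} (\<lambda>t. integral {0..1} (\<lambda>s. K1 s t) - integral {0..1} (\<lambda>s. K2 s t))"
    by presburger
  also have "\<dots> = integral {0..1} (\<lambda>t. integral {0..1} (\<lambda>s. K1 s t)) - integral {0..1} (\<lambda>t. integral {0..1} (\<lambda>s. K2 s t))"
    by (intro integral_diff integrable_continuous_interval param cK)
  finally show ?thesis by (simp add: I1 I2)
qed

section \<open>Symplectomorphisms act by isometries of the period form\<close>

text \<open>The derivative along the vector field with complex components v_i z_i, that is, the
  constant field \<open>v\<close> in logarithmic coordinates; its flow lines are s \<mapsto> exp4
  (\<zeta> + s v).\<close>

definition along :: "c4 \<Rightarrow> ((nat \<Rightarrow> real) \<Rightarrow> real) \<Rightarrow> (nat \<Rightarrow> real) \<Rightarrow> real" where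
  "along v g x = (\<Sum>m<8. partial_deriv m g x * (if even m then Re else Im) (comp4 v (m div 2) * zc (m div 2) x))"

definition calong :: "c4 \<Rightarrow> ((nat \<Rightarrow> real) \<Rightarrow> complex) \<Rightarrow> (nat \<Rightarrow> real) \<Rightarrow> complex" where
  "calong v f x = Complex (along v (\<lambda>q. Re (f q)) x) (along v (\<lambda>q. Im (f q)) x)"

lemma comp4_line: "comp4 (\<zeta> + s *\<^sub>R v) i = comp4 \<zeta> i + of_real s * comp4 v i"
  by (simp add: comp4_def scaleR_conv_of_real)

lemma exp_line_has_vector_derivative:
  fixes a b :: complex
  shows
  "((\<lambda>s. exp (a + of_real s * b)) has_vector_derivative b * exp (a + of_real s * b)) (at s)"
proof -
  have "((\<lambda>z. exp (a + z * b)) has_field_derivative exp (a + of_real s * b) * b) (at (of_real s))"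
    by (auto intro!: derivative_eq_intros)
  from has_vector_derivative_real_field[OF this] show ?thesis
    by (simp add: mult.commute)
qed

lemma exp4_line_has_derivative:
  assumes "m < 8"
  shows "((\<lambda>s. exp4 (\<zeta> + s *\<^sub>R v) m) has_real_derivative
    (if even m then Re else Im) (comp4 v (m div 2) * zc (m div 2) (exp4 (\<zeta> + s *\<^sub>R v)))) (at s)"
proof -
  let ?i = "m div 2"
  have i: "?i < 4" using assms by simp
  note D = exp_line_has_vector_derivative[of "comp4 \<zeta> ?i" "comp4 v ?i" s]
  have "((\<lambda>s. Re (exp (comp4 \<zeta> ?i + of_real s * comp4 v ?i))) has_real_derivative
      Re (comp4 v ?i * exp (comp4 \<zeta> ?i + of_real s * comp4 v ?i))) (at s)"
    "((\<lambda>s. Im (exp (comp4 \<zeta> ?i + of_real s * comp4 v ?i))) has_real_derivative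
      Im (comp4 v ?i * exp (comp4 \<zeta> ?i + of_real s * comp4 v ?i))) (at s)"
    unfolding has_real_derivative_iff_has_vector_derivative
    by (rule bounded_linear.has_vector_derivative[OF bounded_linear_Re D]
        bounded_linear.has_vector_derivative[OF bounded_linear_Im D])+
  moreover have "exp4 w m = (if even m then Re else Im) (exp (comp4 w ?i))" for w
    using assms by (simp add: exp4_def)
  ultimately show ?thesis
    by (cases "even m") (simp_all only: zc_exp4[OF i] comp4_line if_True if_False)
qed

lemma along_has_derivative:
  assumes "smooth_on 8 cstar4 g"
  shows "((\<lambda>s. g (exp4 (\<zeta> + s *\<^sub>R v))) has_real_derivative along v g (exp4 (\<zeta> + s *\<^sub>R v))) (at s)"
  unfolding along_def
  by (rule smooth_on_chain[OF openin_cstar4 assms _ exp4_cstar4 exp4_line_has_derivative])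
    (rule subsetD[OF openin_subset[OF openin_cstar4] exp4_cstar4])

lemma smooth_on_along:
  assumes "smooth_on 8 cstar4 g" shows "smooth_on 8 cstar4 (along v g)"
proof -
  have "csmooth_on 8 cstar4 (\<lambda>x. comp4 v i * zc i x)" for i
    by (intro csmooth_on_mult csmooth_on_const csmooth_on_zc openin_cstar4)
  then have "smooth_on 8 cstar4 (\<lambda>x. (if even m then Re else Im) (comp4 v (m div 2) * zc (m div 2) x))" for m
    unfolding csmooth_on_def by (cases "even m") (simp_all only: if_True if_False)
  then show ?thesis
    unfolding along_def[abs_def] using assms
    by (intro smooth_on_sum smooth_on_mult smooth_on_partial_deriv openin_cstar4) (simp_all only: lessThan_iff)
qed

lemma csmooth_on_calong: "csmooth_on 8 cstar4 f \<Longrightarrow> csmooth_on 8 cstar4 (calong v f)"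
  unfolding csmooth_on_def calong_def[abs_def] complex.sel using smooth_on_along by blast

lemma calong_has_vector_derivative:
  assumes "csmooth_on 8 cstar4 f"
  shows "((\<lambda>s. f (exp4 (\<zeta> + s *\<^sub>R v))) has_vector_derivative calong v f (exp4 (\<zeta> + s *\<^sub>R v))) (at s)"
proof -
  let ?x = "\<lambda>s. exp4 (\<zeta> + s *\<^sub>R v)"
  have D: "((\<lambda>s. Re (f (?x s))) has_vector_derivative along v (\<lambda>q. Re (f q)) (?x s)) (at s)"
    "((\<lambda>s. Im (f (?x s))) has_vector_derivative along v (\<lambda>q. Im (f q)) (?x s)) (at s)"
    using assms along_has_derivative[where v = v and \<zeta> = \<zeta> and s = s]
    unfolding csmooth_on_def has_real_derivative_iff_has_vector_derivative by blast+
  have "((\<lambda>s. of_real (Re (f (?x s))) + \<i> * of_real (Im (f (?x s)))) has_vector_derivative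
      of_real (along v (\<lambda>q. Re (f q)) (?x s)) + \<i> * of_real (along v (\<lambda>q. Im (f q)) (?x s))) (at s)"
    by (intro has_vector_derivative_add has_vector_derivative_mult_right
        bounded_linear.has_vector_derivative[OF bounded_linear_of_real] D)
  moreover have "of_real (Re z) + \<i> * of_real (Im z) = z" for z
    by (simp add: complex_eq_iff)
  moreover have "of_real (along v (\<lambda>q. Re (f q)) (?x s)) + \<i> * of_real (along v (\<lambda>q. Im (f q)) (?x s)) = calong v f (?x s)"
    by (simp add: calong_def complex_eq_iff)
  ultimately show ?thesis by (simp only:)
qed

definition along_vec :: "c4 \<Rightarrow> (nat \<Rightarrow> real) \<Rightarrow> (nat \<Rightarrow> real) tvec" where
  "along_vec v p = (\<lambda>g. if smooth_on 8 cstar4 g then along v g p else 0)"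

lemma along_vec_tangent:
  assumes p: "p \<in> cstar4"
  shows "along_vec v p \<in> tangent_space cstar4_manifold p"
proof -
  define c where "c m = (if even m then Re else Im) (comp4 v (m div 2) * zc (m div 2) p)" for m
  have eq: "along v g p = (\<Sum>m<8. cstar4_vec m p g * c m)" if "smooth_on 8 cstar4 g" for g
    unfolding along_def c_def using coord_vec_tangent(2)[OF openin_cstar4 _ p that] by simp
  note S = smooth_on_add[OF openin_cstar4] smooth_on_mult[OF openin_cstar4] smooth_on_const[OF openin_cstar4]
  note T = coord_vec_tangent(1)[OF openin_cstar4 _ p]
  have "along v (\<lambda>q. a * f q + g q) p = a * along v f p + along v g p"
    if "smooth_on 8 cstar4 f" "smooth_on 8 cstar4 g" for a f g
  proof -
    have sm: "smooth_on 8 cstar4 (\<lambda>q. a * f q + g q)" by (intro S that)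
    have "cstar4_vec m p (\<lambda>q. a * f q + g q) = a * cstar4_vec m p f + cstar4_vec m p g" if "m < 8" for m
      using T[OF that] \<open>smooth_on 8 cstar4 f\<close> \<open>smooth_on 8 cstar4 g\<close>
      unfolding tangent_space_open_manifold[OF openin_cstar4] by blast
    then show ?thesis
      unfolding eq[OF sm] eq[OF that(1)] eq[OF that(2)] sum_distrib_left sum.distrib[symmetric]
      by (intro sum.cong refl) (simp add: distrib_right)
  qed
  moreover have "along v (\<lambda>q. f q * g q) p = f p * along v g p + g p * along v f p"
    if "smooth_on 8 cstar4 f" "smooth_on 8 cstar4 g" for f g
  proof -
    have sm: "smooth_on 8 cstar4 (\<lambda>q. f q * g q)" by (intro S that)
    have "cstar4_vec m p (\<lambda>q. f q * g q) = f p * cstar4_vec m p g + g p * cstar4_vec m p f" if "m < 8" for m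
      using derivation_mult[OF openin_cstar4 T[OF that] p] \<open>smooth_on 8 cstar4 f\<close> \<open>smooth_on 8 cstar4 g\<close> by blast
    then show ?thesis
      unfolding eq[OF sm] eq[OF that(1)] eq[OF that(2)] sum_distrib_left sum.distrib[symmetric]
      by (intro sum.cong refl) (simp add: distrib_right)
  qed
  ultimately show ?thesis
    unfolding tangent_space_open_manifold[OF openin_cstar4] along_vec_def
    using S by simp
qed

lemma cder_along_vec: "csmooth_on 8 cstar4 f \<Longrightarrow> cder (along_vec v p) f = calong v f p"
  by (simp add: cder_def along_vec_def calong_def csmooth_on_def)

text \<open>A lift is known only to be continuous. Near \<open>s0\<close> it equals
  \<open>U s0 + Ln (Q s)\<close> with \<open>Q\<close> close to 1, and the right-hand side is
  differentiable.\<close>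

lemma has_vector_derivative_exp_lift:
  fixes U :: "real \<Rightarrow> complex"
  assumes U: "continuous_on UNIV U" and D: "((\<lambda>s. exp (U s)) has_vector_derivative D) (at s0)"
  shows "(U has_vector_derivative D / exp (U s0)) (at s0)"
proof -
  define Q where "Q s = exp (U s) / exp (U s0)" for s
  have Q: "(Q has_vector_derivative D / exp (U s0)) (at s0)"
    unfolding Q_def by (rule has_vector_derivative_divide[OF D])
  have "(Ln has_field_derivative inverse (Q s0)) (at (Q s0))"
    by (rule has_field_derivative_Ln) (simp add: Q_def)
  from field_vector_diff_chain_at[OF Q this]
  have "((\<lambda>s. Ln (Q s)) has_vector_derivative D / exp (U s0)) (at s0)"
    by (simp add: o_def Q_def)
  from has_vector_derivative_add[OF has_vector_derivative_const[of "U s0"] this]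
  have D': "((\<lambda>s. U s0 + Ln (Q s)) has_vector_derivative D / exp (U s0)) (at s0)" by simp
  \<comment> \<open>On this neighbourhood of \<open>s0\<close> the principal logarithm inverts the
    exponential of \<open>U s - U s0\<close>.\<close>
  define S where "S = {s. \<bar>Im (U s - U s0)\<bar> < pi}"
  have "continuous_on UNIV (\<lambda>s. \<bar>Im (U s - U s0)\<bar>)"
    using U by (intro continuous_intros)
  from open_vimage[OF open_lessThan[of pi] this] have "open S"
    by (simp add: S_def vimage_def)
  moreover have "s0 \<in> S" by (simp add: S_def)
  moreover have "U s0 + Ln (Q s) = U s" if "s \<in> S" for s
  proof -
    have "Ln (exp (U s - U s0)) = U s - U s0"
      using that by (intro Ln_exp) (auto simp: S_def abs_less_iff)
    then show ?thesis by (simp add: Q_def exp_diff)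
  qed
  ultimately show ?thesis
    using has_vector_derivative_transform_within_open[OF D'] by blast
qed

lemma log_derivative_along:
  assumes f: "csmooth_on 8 cstar4 f" and U: "continuous_on UNIV U"
    and lift: "\<And>s. exp (U s) = f (exp4 (\<zeta> + s *\<^sub>R v))"
  shows "(U has_vector_derivative calong v f (exp4 (\<zeta> + s *\<^sub>R v)) / f (exp4 (\<zeta> + s *\<^sub>R v))) (at s)"
  using has_vector_derivative_exp_lift[OF U, of "calong v f (exp4 (\<zeta> + s *\<^sub>R v))" s]
    calong_has_vector_derivative[OF f]
  by (simp add: lift)

text \<open>In logarithmic coordinates the tangent vector is \<open>v\<close> itself, so the form is
  constant on such vector fields.\<close>

lemma lder_along_vec_zc:
  assumes "i < 4" shows "lder (along_vec v (exp4 \<zeta>)) (exp4 \<zeta>) (zc i) = comp4 v i"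
proof -
  have "((\<lambda>s. comp4 (\<zeta> + s *\<^sub>R v) i) has_vector_derivative
      calong v (zc i) (exp4 (\<zeta> + 0 *\<^sub>R v)) / zc i (exp4 (\<zeta> + 0 *\<^sub>R v))) (at 0)"
    by (intro log_derivative_along csmooth_on_zc continuous_intros) (simp add: zc_exp4 assms)
  moreover have "((\<lambda>s. comp4 (\<zeta> + s *\<^sub>R v) i) has_vector_derivative comp4 v i) (at 0)"
    unfolding comp4_line by (auto intro!: derivative_eq_intros)
  ultimately have "calong v (zc i) (exp4 (\<zeta> + 0 *\<^sub>R v)) / zc i (exp4 (\<zeta> + 0 *\<^sub>R v)) = comp4 v i"
    by (rule vector_derivative_unique_at)
  then show ?thesis
    unfolding lder_def cder_along_vec[OF csmooth_on_zc] by (simp only: scaleR_zero_left add_0_right)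
qed

section \<open>Periods over two-dimensional tori\<close>

lemma double_integral_sum:
  fixes k :: "'a \<Rightarrow> real \<Rightarrow> real \<Rightarrow> real"
  assumes "finite I" "\<And>x. x \<in> I \<Longrightarrow> continuous_on UNIV (\<lambda>(s, t). k x s t)"
  shows "integral {0..1} (\<lambda>t. integral {0..1} (\<lambda>s. \<Sum>x\<in>I. c x * k x s t)) =
    (\<Sum>x\<in>I. c x * integral {0..1} (\<lambda>t. integral {0..1} (\<lambda>s. k x s t)))"
proof -
  have line: "(\<lambda>s. k x s t) integrable_on {0..1}" if "x \<in> I" for x t
  proof -
    have "continuous_on {0..1} (\<lambda>s. (s, t))"
      by (intro continuous_on_Pair continuous_on_const continuous_on_id)
    from continuous_on_compose2[OF assms(2)[OF that] this] show ?thesis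
      by (simp add: integrable_continuous_interval)
  qed
  have param: "(\<lambda>t. integral {0..1} (\<lambda>s. k x s t)) integrable_on {0..1}" if "x \<in> I" for x
  proof -
    have "continuous_on ({0..1} \<times> cbox 0 1) (\<lambda>z. (snd z, fst z))"
      by (intro continuous_on_Pair continuous_on_fst continuous_on_snd continuous_on_id)
    from continuous_on_compose2[OF assms(2)[OF that] this]
    have "continuous_on ({0..1} \<times> cbox 0 1) (\<lambda>(t, s). k x s t)"
      by (simp add: split_beta)
    from integral_continuous_on_param[OF this] show ?thesis
      by (simp add: integrable_continuous_interval)
  qed
  have "integral {0..1} (\<lambda>s. \<Sum>x\<in>I. c x * k x s t) = (\<Sum>x\<in>I. c x * integral {0..1} (\<lambda>s. k x s t))" for t
    using line assms(1) by (simp add: integral_sum integrable_on_mult_right)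
  moreover have "integral {0..1} (\<lambda>t. \<Sum>x\<in>I. c x * integral {0..1} (\<lambda>s. k x s t)) =
      (\<Sum>x\<in>I. c x * integral {0..1} (\<lambda>t. integral {0..1} (\<lambda>s. k x s t)))"
    using param assms(1) by (simp add: integral_sum integrable_on_mult_right)
  ultimately show ?thesis by simp
qed

text \<open>The torus (s, t) \<mapsto> exp4 (s v + t w), spanned by the loops j and k, has the same
  period before and after applying \<open>F\<close>. Before, the integrand is constant; after, the
  integral depends only on the increments of the lift along the two loops, that is, on columns j and
  k of \<open>A\<close>.\<close>

lemma degree_preserves_form:
  assumes F: "symplectomorphism cstar4_manifold (log_form b) F" and A: "is_degree F A"
    and skew: "\<And>i j. b j i = - b i j"
  shows "preserves_form b A"
  unfolding preserves_form_def
proof (intro allI impI)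
  fix j k :: nat assume j: "j < 4" and k: "k < 4"
  obtain f where f: "is_lift F f" "\<And>\<zeta> l. f (\<zeta> + lat l) = f \<zeta> + lat (mat_vec A l)"
    using A unfolding is_degree_def by metis
  note smF = smooth_map_cstar4[OF symplectomorphism_smooth_map[OF F]]
  have FE: "F (exp4 \<zeta>) = exp4 (f \<zeta>)" for \<zeta>
    using f(1) unfolding is_lift_def by blast
  have contf: "continuous_on UNIV f"
    using f(1) unfolding is_lift_def by blast
  have zF: "csmooth_on 8 cstar4 (\<lambda>x. zc i (F x))" if "i < 4" for i
    using smF(3)[of "2 * i"] smF(3)[of "2 * i + 1"] that by (simp add: csmooth_on_def zc_def)
  have zF_nz: "zc i (F x) \<noteq> 0" if "x \<in> cstar4" "i < 4" for x i
    using cstar4_nonzero[OF funcset_mem[OF smF(1) that(1)] that(2)] .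
  \<comment> \<open>The logarithmic derivative of the i-th component of \<open>F\<close>; by
    \<open>fL\<close> it is the derivative of the lift in direction \<open>v\<close>.\<close>
  define L where "L v i x = calong v (\<lambda>x. zc i (F x)) x * inverse (zc i (F x))" for v i x
  have L: "csmooth_on 8 cstar4 (L v i)" if "i < 4" for v i
    unfolding L_def using that zF zF_nz
    by (intro csmooth_on_mult csmooth_on_calong csmooth_on_inverse openin_cstar4)
  have fL: "((\<lambda>s. comp4 (f (\<zeta> + s *\<^sub>R v)) i) has_vector_derivative L v i (exp4 (\<zeta> + s *\<^sub>R v))) (at s)"
    if "i < 4" for i \<zeta> v s
  proof -
    have line: "continuous_on UNIV (\<lambda>s::real. \<zeta> + s *\<^sub>R v)"
      by (intro continuous_intros)
    have "continuous_on UNIV (\<lambda>s. comp4 (f (\<zeta> + s *\<^sub>R v)) i)"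
      by (rule continuous_on_comp4[OF continuous_on_compose2[OF contf line subset_UNIV]])
    from log_derivative_along[OF zF[OF that] this]
    show ?thesis
      unfolding L_def divide_inverse by (simp only: FE zc_exp4[OF that])
  qed
  have symp: "(\<Sum>i<4. \<Sum>l<4. b i l * Re (L v i (exp4 \<zeta>) * cnj (L w l (exp4 \<zeta>)))) =
      (\<Sum>i<4. \<Sum>l<4. b i l * Re (comp4 v i * cnj (comp4 w l)))" for v w \<zeta>
  proof -
    let ?p = "exp4 \<zeta>"
    have push: "lder (pushforward cstar4_manifold cstar4_manifold F (along_vec v ?p)) (F ?p) (zc i) = L v i ?p"
      if "i < 4" for v i
      unfolding lder_def pushforward_cder[OF openin_cstar4 csmooth_on_zc] cder_along_vec[OF zF[OF that]]
        L_def divide_inverse ..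
    have "log_form b (F ?p) (pushforward cstar4_manifold cstar4_manifold F (along_vec v ?p))
        (pushforward cstar4_manifold cstar4_manifold F (along_vec w ?p)) =
        log_form b ?p (along_vec v ?p) (along_vec w ?p)"
      using F along_vec_tangent[OF exp4_cstar4] topspace_open_manifold[OF openin_cstar4] exp4_cstar4
      unfolding symplectomorphism_def by metis
    moreover have "log_form b (F ?p) (pushforward cstar4_manifold cstar4_manifold F (along_vec v ?p))
        (pushforward cstar4_manifold cstar4_manifold F (along_vec w ?p)) =
        (\<Sum>i<4. \<Sum>l<4. b i l * Re (L v i ?p * cnj (L w l ?p)))"
      unfolding log_form_def by (intro sum.cong refl) (simp only: push lessThan_iff)
    moreover have "log_form b ?p (along_vec v ?p) (along_vec w ?p) =
        (\<Sum>i<4. \<Sum>l<4. b i l * Re (comp4 v i * cnj (comp4 w l)))"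
      unfolding log_form_def by (intro sum.cong refl) (simp only: lder_along_vec_zc lessThan_iff)
    ultimately show ?thesis by simp
  qed
  define e :: "nat \<Rightarrow> nat \<Rightarrow> int" where "e j = (\<lambda>i. of_bool (i = j))" for j
  define v w where "v = lat (e j)" and "w = lat (e k)"
  define part :: "bool \<Rightarrow> complex \<Rightarrow> real" where "part c = (if c then Re else Im)" for c
  have part_deriv: "((\<lambda>s. part c (g s)) has_real_derivative part c g') (at s)"
    if "(g has_vector_derivative g') (at s)" for c g g' s
    unfolding has_real_derivative_iff_has_vector_derivative part_def
    by (cases c) (simp_all add: bounded_linear.has_vector_derivative[OF bounded_linear_Re that]
        bounded_linear.has_vector_derivative[OF bounded_linear_Im that])
  have part_smooth: "smooth_on 8 cstar4 (\<lambda>x. part c (g x))" if "csmooth_on 8 cstar4 g" for c g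
    using that unfolding csmooth_on_def part_def by (cases c) simp_all
  define p where "p s t = exp4 (s *\<^sub>R v + t *\<^sub>R w)" for s t
  define a where "a c i s t = part c (comp4 (f (s *\<^sub>R v + t *\<^sub>R w)) i)" for c i s t
  define ds where "ds c i s t = part c (L v i (p s t))" for c i s t
  define dt where "dt c i s t = part c (L w i (p s t))" for c i s t
  define dts where "dts c i s t = along v (\<lambda>x. part c (L w i x)) (p s t)" for c i s t
  have plane: "continuous_on UNIV (\<lambda>z::real \<times> real. fst z *\<^sub>R v + snd z *\<^sub>R w)"
    by (intro continuous_intros)
  have cont: "continuous_on UNIV (\<lambda>(s, t). g (p s t))" if "smooth_on 8 cstar4 g" for g
  proof -
    have "continuous_on UNIV (\<lambda>z::real \<times> real. exp4 (fst z *\<^sub>R v + snd z *\<^sub>R w))"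
      by (rule continuous_on_compose2[OF continuous_on_exp4 plane subset_UNIV])
    from continuous_on_compose2[OF smooth_on_imp_continuous_on[OF openin_cstar4 that] this]
    show ?thesis by (simp add: p_def split_beta image_subset_iff)
  qed
  have as: "((\<lambda>s. a c i s t) has_real_derivative ds c i s t) (at s)" if "i < 4" for c i s t
    using part_deriv[OF fL[OF that, of "t *\<^sub>R w" v s], of c]
    by (simp only: a_def ds_def p_def add.commute)
  have at: "((\<lambda>t. a c i s t) has_real_derivative dt c i s t) (at t)" if "i < 4" for c i s t
    using part_deriv[OF fL[OF that, of "s *\<^sub>R v" w t], of c]
    by (simp only: a_def dt_def p_def)
  have ats: "((\<lambda>s. dt c i s t) has_real_derivative dts c i s t) (at s)" if "i < 4" for c i s t
    using along_has_derivative[OF part_smooth[OF L[OF that]], where \<zeta> = "t *\<^sub>R w" and v = v]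
    by (simp only: dt_def dts_def p_def add.commute)
  have cds: "continuous_on UNIV (\<lambda>(s, t). ds c i s t)" "continuous_on UNIV (\<lambda>(s, t). dt c i s t)"
    "continuous_on UNIV (\<lambda>(s, t). dts c i s t)" if "i < 4" for c i
    unfolding ds_def dt_def dts_def
    by (intro cont part_smooth smooth_on_along L that)+
  have ca: "continuous_on UNIV (\<lambda>(s, t). a c i s t)" for c i
  proof -
    have "continuous_on UNIV (\<lambda>z::real \<times> real. comp4 (f (fst z *\<^sub>R v + snd z *\<^sub>R w)) i)"
      by (rule continuous_on_comp4[OF continuous_on_compose2[OF contf plane subset_UNIV]])
    then show ?thesis
      unfolding a_def part_def split_beta by (cases c) (simp_all add: continuous_on_Re continuous_on_Im)
  qed
  \<comment> \<open>The functions log |z_i| are single-valued, so only the imaginary parts have an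
    increment along a loop.\<close>
  define inc where "inc c i l = (if c then 0 else 2 * pi * of_int (A i l))" for c i l
  have per: "a c i 1 t = a c i 0 t + inc c i j" "a c i s 1 = a c i s 0 + inc c i k" if i: "i < 4" for c i s t
  proof -
    have inc: "part c (comp4 (f (\<zeta> + lat (e l))) i) = part c (comp4 (f \<zeta>) i) + inc c i l" if "l < 4" for \<zeta> l
      using i that by (cases c) (simp_all add: part_def f(2) comp4_add comp4_lat e_def mat_vec_unit inc_def)
    have "1 *\<^sub>R v + t *\<^sub>R w = (0 *\<^sub>R v + t *\<^sub>R w) + lat (e j)" "s *\<^sub>R v + 1 *\<^sub>R w = (s *\<^sub>R v + 0 *\<^sub>R w) + lat (e k)"
      by (simp_all add: v_def w_def)
    then show "a c i 1 t = a c i 0 t + inc c i j" "a c i s 1 = a c i s 0 + inc c i k"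
      unfolding a_def using inc[OF j] inc[OF k] by presburger+
  qed
  define jac where "jac x s t = (case x of (i, l, c) \<Rightarrow> ds c i s t * dt c l s t - dt c i s t * ds c l s t)" for x s t
  define I where "I = {..<4::nat} \<times> {..<4::nat} \<times> (UNIV :: bool set)"
  define C where "C = (\<Sum>i<4. \<Sum>l<4. b i l * Re (comp4 v i * cnj (comp4 w l)))"
  have sumI: "(\<Sum>x\<in>I. (case x of (i, l, c) \<Rightarrow> g i l c)) = (\<Sum>i<4. \<Sum>l<4. g i l True + g i l False)"
    for g :: "nat \<Rightarrow> nat \<Rightarrow> bool \<Rightarrow> real"
    unfolding I_def by (simp add: sum.cartesian_product[symmetric] UNIV_bool add.commute)
  have skew_sum: "(\<Sum>i<4. \<Sum>l<4. b i l * (x l * y i)) = - (\<Sum>i<4. \<Sum>l<4. b i l * (x i * y l))" for x y :: "nat \<Rightarrow> real"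
  proof -
    have "(\<Sum>i<4. \<Sum>l<4. b i l * (x l * y i)) = (\<Sum>l<4. \<Sum>i<4. b i l * (x l * y i))"
      by (rule sum.swap)
    also have "\<dots> = (\<Sum>l<4. \<Sum>i<4. - (b l i * (x l * y i)))"
      by (intro sum.cong refl, subst skew) simp
    finally show ?thesis by (simp add: sum_negf)
  qed
  \<comment> \<open>Rewrites the form through 2x2 Jacobians, to which
    \<open>torus_jacobian_integral\<close> applies; skewness accounts for the factor 2.\<close>
  have alt: "(\<Sum>i<4. \<Sum>l<4. b i l * (x i * y l - y i * x l)) = 2 * (\<Sum>i<4. \<Sum>l<4. b i l * (x i * y l))" for x y :: "nat \<Rightarrow> real"
  proof -
    have "(\<Sum>i<4. \<Sum>l<4. b i l * (x i * y l - y i * x l)) =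
        (\<Sum>i<4. \<Sum>l<4. b i l * (x i * y l)) - (\<Sum>i<4. \<Sum>l<4. b i l * (x l * y i))"
      unfolding sum_subtractf[symmetric] by (intro sum.cong refl) (simp add: algebra_simps)
    then show ?thesis
      unfolding skew_sum by simp
  qed
  \<comment> \<open>By the symplectic condition the integrand is the value of the original form on
    the constant fields \<open>v\<close> and \<open>w\<close>.\<close>
  have const: "(\<Sum>x\<in>I. (case x of (i, l, c) \<Rightarrow> b i l) * jac x s t) = 2 * C" for s t
  proof -
    have "(\<Sum>x\<in>I. (case x of (i, l, c) \<Rightarrow> b i l) * jac x s t) =
        (\<Sum>x\<in>I. (case x of (i, l, c) \<Rightarrow> b i l * (ds c i s t * dt c l s t - dt c i s t * ds c l s t)))"
      by (intro sum.cong refl) (auto simp: jac_def)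
    also have "\<dots> = (\<Sum>i<4. \<Sum>l<4. b i l * (ds True i s t * dt True l s t - dt True i s t * ds True l s t)) +
        (\<Sum>i<4. \<Sum>l<4. b i l * (ds False i s t * dt False l s t - dt False i s t * ds False l s t))"
      unfolding sumI sum.distrib ..
    also have "\<dots> = 2 * (\<Sum>i<4. \<Sum>l<4. b i l * (ds True i s t * dt True l s t) + b i l * (ds False i s t * dt False l s t))"
      unfolding alt sum.distrib by simp
    also have "(\<Sum>i<4. \<Sum>l<4. b i l * (ds True i s t * dt True l s t) + b i l * (ds False i s t * dt False l s t)) =
        (\<Sum>i<4. \<Sum>l<4. b i l * Re (L v i (p s t) * cnj (L w l (p s t))))"
      by (intro sum.cong refl) (simp add: ds_def dt_def part_def algebra_simps)
    also have "\<dots> = C"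
      unfolding C_def p_def by (rule symp)
    finally show ?thesis .
  qed
  have jac_int: "integral {0..1} (\<lambda>t. integral {0..1} (\<lambda>s. jac (i, l, c) s t)) = inc c i j * inc c l k - inc c i k * inc c l j"
    if "i < 4" "l < 4" for i l c
    unfolding jac_def case_prod_conv
    by (rule torus_jacobian_integral[OF as[OF that(1)] at[OF that(1)] as[OF that(2)] at[OF that(2)] ats[OF that(2)]
          ca cds(1,2)[OF that(1)] cds[OF that(2)] per[OF that(1)] per[OF that(2)]])
  have jac_cont: "continuous_on UNIV (\<lambda>(s, t). jac x s t)" if xI: "x \<in> I" for x
  proof -
    obtain i l c where x: "x = (i, l, c)" "i < 4" "l < 4"
      using xI by (auto simp: I_def)
    show ?thesis
      using cds[OF x(2), of c] cds[OF x(3), of c] unfolding jac_def x(1) split_beta fst_conv snd_conv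
      by (intro continuous_on_diff continuous_on_mult)
  qed
  have "2 * C = integral {0..1} (\<lambda>t::real. integral {0..1} (\<lambda>s::real. 2 * C))"
    by simp
  also have "\<dots> = integral {0..1} (\<lambda>t. integral {0..1} (\<lambda>s. \<Sum>x\<in>I. (case x of (i, l, c) \<Rightarrow> b i l) * jac x s t))"
    unfolding const ..
  also have "\<dots> = (\<Sum>x\<in>I. (case x of (i, l, c) \<Rightarrow> b i l) * integral {0..1} (\<lambda>t. integral {0..1} (\<lambda>s. jac x s t)))"
    by (rule double_integral_sum[OF _ jac_cont]) (simp_all add: I_def)
  also have "\<dots> = (\<Sum>x\<in>I. (case x of (i, l, c) \<Rightarrow> b i l * (inc c i j * inc c l k - inc c i k * inc c l j)))"
    by (intro sum.cong refl) (auto simp: I_def jac_int)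
  also have "\<dots> = (\<Sum>i<4. \<Sum>l<4. b i l * (inc False i j * inc False l k - inc False i k * inc False l j))"
    unfolding sumI by (intro sum.cong refl) (simp add: inc_def)
  also have "\<dots> = 2 * (\<Sum>i<4. \<Sum>l<4. b i l * (inc False i j * inc False l k))"
    by (rule alt)
  finally have "C = (\<Sum>i<4. \<Sum>l<4. b i l * (inc False i j * inc False l k))" by simp
  also have "\<dots> = (2 * pi)\<^sup>2 * (\<Sum>i<4. \<Sum>l<4. b i l * of_int (A i j) * of_int (A l k))"
    unfolding sum_distrib_left by (intro sum.cong refl) (simp add: inc_def power2_eq_square)
  finally have C1: "C = (2 * pi)\<^sup>2 * (\<Sum>i<4. \<Sum>l<4. b i l * of_int (A i j) * of_int (A l k))" .
  \<comment> \<open>\<open>v\<close> and \<open>w\<close> are unit vectors times 2 pi i, so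
    \<open>C\<close> is also the period over the original torus.\<close>
  have "C = (\<Sum>i<4. \<Sum>l<4. if l = k then (if i = j then (2 * pi)\<^sup>2 * b i l else 0) else 0)"
    unfolding C_def v_def w_def
    by (intro sum.cong refl) (auto simp: comp4_lat e_def power2_eq_square)
  also have "\<dots> = (2 * pi)\<^sup>2 * b j k"
    using j k by simp
  finally have "C = (2 * pi)\<^sup>2 * b j k" .
  with C1 show "(\<Sum>i<4. \<Sum>l<4. b i l * of_int (A i j) * of_int (A l k)) = b j k"
    by simp
qed

section \<open>Free quotients of the symplectic mapping class group\<close>

lemma torus_form_coeff_skew: "torus_form_coeff m n j i = - torus_form_coeff m n i j"
  by (cases "i = 0"; cases "i = 1"; cases "i = 2"; cases "i = 3") (simp_all add: torus_form_coeff_def)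

lemma torus_form_skew: "torus_form n j i = - torus_form n i j"
  by (simp add: torus_form_def torus_form_coeff_skew[of _ n j i])

text \<open>The Pfaffian of the form is sqrt 3 - 2 n, and sqrt 3 < 2 \<le> 2 n.\<close>

lemma torus_form_nondegenerate:
  fixes c :: "nat \<Rightarrow> complex"
  assumes n: "n > 0" and null: "\<And>j. j < 4 \<Longrightarrow> (\<Sum>i<4. of_real (torus_form n i j) * c i) = 0"
  shows "\<forall>i<4. c i = 0"
proof -
  define r where "r = complex_of_real (sqrt 2)"
  define q where "q = complex_of_real (sqrt 3)"
  have r: "r * r = 2"
    unfolding r_def by (metis of_real_mult of_real_numeral real_sqrt_mult_self abs_numeral)
  have "2 * real_of_int n \<noteq> sqrt 3"
  proof -
    have "sqrt 3 < sqrt (4 :: real)" unfolding real_sqrt_less_iff by simp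
    then have "sqrt 3 < 2" by simp
    moreover have "2 \<le> 2 * real_of_int n" using n by simp
    ultimately show ?thesis by linarith
  qed
  then have "q \<noteq> of_real (2 * of_int n)"
    unfolding q_def of_real_eq_iff by simp
  then have nq: "q - 2 * of_int n \<noteq> 0" by simp
  have eqs: "- c 1 = r * of_int n * c 3" "c 0 + r * c 2 = 0"
    "- (r * c 1) = q * c 3" "r * of_int n * c 0 + q * c 2 = 0"
    using null[of 0] null[of 1] null[of 2] null[of 3]
    by (simp_all add: sum_lessThan_4 torus_form_def torus_form_coeff_def r_def[symmetric] q_def[symmetric]
        del: One_nat_def)
  have "(q - 2 * of_int n) * c 3 = 0" "(q - 2 * of_int n) * c 2 = 0"
    using eqs r by algebra+
  then have c: "c 3 = 0" "c 2 = 0" using nq by simp_all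
  then have "c 0 = 0" "c 1 = 0" using eqs by simp_all
  then show ?thesis
    using c unfolding less_4_cases by blast
qed

text \<open>\<phi> descends to components, where it is evaluated at a chosen element. An element
  chosen from \<open>A <#> B\<close> is a product of elements of \<open>A\<close> and
  \<open>B\<close>, so multiplicativity of \<phi> and constancy on both factors give that of
  \<open>h\<close>.\<close>

lemma epi_pi0_group:
  assumes top: "topspace T = carrier G"
    and carrier: "\<And>x. x \<in> carrier G \<Longrightarrow> \<phi> x \<in> carrier H"
    and mult: "\<And>x y. x \<in> carrier G \<Longrightarrow> y \<in> carrier G \<Longrightarrow> \<phi> (x \<otimes>\<^bsub>G\<^esub> y) = \<phi> x \<otimes>\<^bsub>H\<^esub> \<phi> y"
    and surj: "\<And>z. z \<in> carrier H \<Longrightarrow> \<exists>x\<in>carrier G. \<phi> x = z"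
    and const: "\<And>C x y. C \<in> connected_components_of T \<Longrightarrow> x \<in> C \<Longrightarrow> y \<in> C \<Longrightarrow> \<phi> x = \<phi> y"
  shows "\<exists>h. h \<in> epi (pi0_group G T) H"
proof -
  define h where "h C = \<phi> (SOME x. x \<in> C)" for C
  have h: "h C = \<phi> x" if "C \<in> connected_components_of T" "x \<in> C" for C x
  proof -
    have "(SOME x. x \<in> C) \<in> C" using that(2) by (rule someI)
    then show ?thesis unfolding h_def using that(2) by (rule const[OF that(1)])
  qed
  have sub: "C \<subseteq> carrier G" "C \<noteq> {}" if "C \<in> connected_components_of T" for C
    using connected_components_of_subset[OF that] nonempty_connected_components_of[OF that] unfolding top by blast+
  have h_mult: "h (A <#>\<^bsub>G\<^esub> B) = h A \<otimes>\<^bsub>H\<^esub> h B"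
    if A: "A \<in> connected_components_of T" and B: "B \<in> connected_components_of T" for A B
  proof -
    obtain a b where ab: "a \<in> A" "b \<in> B"
      using sub(2)[OF A] sub(2)[OF B] by blast
    define y where "y = (SOME x. x \<in> A <#>\<^bsub>G\<^esub> B)"
    have "a \<otimes>\<^bsub>G\<^esub> b \<in> A <#>\<^bsub>G\<^esub> B" using ab unfolding set_mult_def by blast
    then have "y \<in> A <#>\<^bsub>G\<^esub> B" unfolding y_def by (rule someI)
    then obtain a' b' where ab': "a' \<in> A" "b' \<in> B" "y = a' \<otimes>\<^bsub>G\<^esub> b'"
      unfolding set_mult_def by blast
    have "h (A <#>\<^bsub>G\<^esub> B) = \<phi> (a' \<otimes>\<^bsub>G\<^esub> b')"
      unfolding h_def y_def[symmetric] ab'(3) ..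
    also have "\<dots> = \<phi> a' \<otimes>\<^bsub>H\<^esub> \<phi> b'"
      using sub(1)[OF A] sub(1)[OF B] ab' by (intro mult) blast+
    finally show ?thesis
      unfolding h[OF A ab'(1)] h[OF B ab'(2)] .
  qed
  have h_carrier: "h C \<in> carrier H" if C: "C \<in> connected_components_of T" for C
  proof -
    obtain x where x: "x \<in> C" using sub(2)[OF C] by blast
    then show ?thesis
      unfolding h[OF C x] using sub(1)[OF C] carrier by blast
  qed
  have h_surj: "\<exists>C\<in>connected_components_of T. h C = z" if z: "z \<in> carrier H" for z
  proof -
    obtain x where x: "x \<in> carrier G" "\<phi> x = z" using surj[OF z] by blast
    have "connected_component_of_set T x \<in> connected_components_of T"
      using x(1) unfolding connected_component_in_connected_components_of top .
    moreover have "x \<in> connected_component_of_set T x"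
      using x(1) unfolding mem_Collect_eq connected_component_of_refl top .
    ultimately show ?thesis
      using h[of "connected_component_of_set T x" x] x(2) by blast
  qed
  have "h \<in> hom (pi0_group G T) H"
    using h_mult h_carrier by (simp add: hom_def pi0_group_def)
  moreover have "h ` carrier (pi0_group G T) = carrier H"
    using h_carrier h_surj by (fastforce simp: pi0_group_def)
  ultimately show ?thesis
    unfolding epi_def by blast
qed

section \<open>The epimorphism for one congruence level\<close>

lemma topspace_Symp_topology: "topspace (Symp_topology M \<omega>) = carrier (Symp M \<omega>)"
proof -
  have "carrier (Symp M \<omega>) \<subseteq> smooth_maps M M"
    by (auto simp: carrier_Symp smooth_maps_def symplectomorphism_smooth_map)
  also have "smooth_maps M M \<subseteq> topspace (Cinf_topology M M)"
    unfolding Cinf_topology_def topology_generated_by_topspace by blast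
  finally show ?thesis
    unfolding Symp_topology_def topspace_subtopology by blast
qed

text \<open>\<open>degree_mat\<close> is a choice that the map determines only in the entries with
  indices below 4; its corner is independent of the choice.\<close>

lemma corner_degree_eq:
  assumes "is_degree F A" "is_degree F B" shows "corner A = corner B"
  using degree_unique[OF assms] by (simp add: corner_def)

lemma epi_pi0_Symp_free_group:
  assumes k: "k > 0" "4 dvd k"
  shows "\<exists>h. h \<in> epi (pi0_Symp cstar4_manifold (log_form (torus_form (k\<^sup>2)))) (free_group {..<nat k})"
  unfolding pi0_Symp_def
proof (rule epi_pi0_group[where \<phi> = "\<lambda>F. cusp_hom k (corner (degree_mat F))"])
  let ?n = "k\<^sup>2"
  let ?G = "Symp cstar4_manifold (log_form (torus_form ?n))"
  have n: "?n > 0" using k by simp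
  have topM: "topspace (mtop cstar4_manifold) = cstar4"
    by (rule topspace_open_manifold[OF openin_cstar4])
  have symp: "symplectomorphism cstar4_manifold (log_form (torus_form ?n)) F" if "F \<in> carrier ?G" for F
    using that by (simp add: carrier_Symp)
  have deg: "is_degree F (degree_mat F)" if "F \<in> carrier ?G" for F
    by (rule is_degree_degree_mat[OF symplectomorphism_smooth_map[OF symp[OF that]]])
  have pres: "preserves_form (torus_form ?n) (degree_mat F)" if "F \<in> carrier ?G" for F
    by (rule degree_preserves_form[OF symp[OF that] deg[OF that] torus_form_skew])
  show "topspace (Symp_topology cstar4_manifold (log_form (torus_form ?n))) = carrier ?G"
    by (rule topspace_Symp_topology)
  show "cusp_hom k (corner (degree_mat F)) \<in> carrier (free_group {..<nat k})" for F
    by (rule cusp_hom_carrier[OF k(1)])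
  show "cusp_hom k (corner (degree_mat (F \<otimes>\<^bsub>?G\<^esub> G))) =
      cusp_hom k (corner (degree_mat F)) \<otimes>\<^bsub>free_group {..<nat k}\<^esub> cusp_hom k (corner (degree_mat G))"
    if F: "F \<in> carrier ?G" and G: "G \<in> carrier ?G" for F G
  proof -
    have "F \<in> Bij cstar4" "G \<in> Bij cstar4"
      using F G by (auto simp: carrier_Symp Bij_def symplectomorphism_def diffeo_def topM)
    then have FG: "F \<otimes>\<^bsub>?G\<^esub> G = compose cstar4 F G"
      by (simp add: Symp_def BijGroup_def topM)
    have comp: "is_degree (compose cstar4 F G) (mat4_mult (degree_mat F) (degree_mat G))"
      by (rule degree_compose[OF deg[OF F] deg[OF G]]) (simp add: compose_def)
    then have "is_degree (compose cstar4 F G) (degree_mat (compose cstar4 F G))"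
      unfolding degree_mat_def[of "compose cstar4 F G"]
      by (rule someI[where P = "is_degree (compose cstar4 F G)"])
    from corner_degree_eq[OF this comp]
    have "corner (degree_mat (F \<otimes>\<^bsub>?G\<^esub> G)) = mul2 (corner (degree_mat F)) (corner (degree_mat G))"
      unfolding FG corner_mult[OF pres[OF F]] .
    then show ?thesis
      using cusp_hom_mult[OF k preserves_form_corner(1)[OF pres[OF F]] preserves_form_corner(1)[OF pres[OF G]]]
      by (simp add: free_group_def)
  qed
  show "\<exists>F\<in>carrier ?G. cusp_hom k (corner (degree_mat F)) = y" if y: "y \<in> carrier (free_group {..<nat k})" for y
  proof -
    obtain g where g: "g \<in> Gamma0 ?n" "cusp_hom k g = y"
      using cusp_hom_surj[OF k y] by blast
    obtain g' where g': "\<And>i j. i < 4 \<Longrightarrow> j < 4 \<Longrightarrow> mat4_mult (stabilizer_mat ?n g) (stabilizer_mat ?n g') i j = (if i = j then 1 else 0)"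
      "\<And>i j. i < 4 \<Longrightarrow> j < 4 \<Longrightarrow> mat4_mult (stabilizer_mat ?n g') (stabilizer_mat ?n g) i j = (if i = j then 1 else 0)"
      using stabilizer_mat_inverse[OF g(1) n] by metis
    let ?F = "mono_map (stabilizer_mat ?n g)"
    have "?F \<in> extensional cstar4"
      by (simp add: extensional_def mono_map_def)
    then have F: "?F \<in> carrier ?G"
      using symplectomorphism_mono_map[OF preserves_form_stabilizer_mat[OF g(1) n] g']
      by (simp add: carrier_Symp topM)
    moreover have "corner (degree_mat ?F) = g"
      using corner_degree_eq[OF deg[OF F] degree_mono_map] by simp
    ultimately show ?thesis
      using g(2) by (intro bexI[of _ ?F]) simp_all
  qed
  show "cusp_hom k (corner (degree_mat F)) = cusp_hom k (corner (degree_mat G))"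
    if C: "C \<in> connected_components_of (Symp_topology cstar4_manifold (log_form (torus_form ?n)))" "F \<in> C" "G \<in> C" for C F G
    using degree_constant_on_components[OF C] by (simp add: corner_def)
qed

theorem theorem1p3:
  shows "\<exists>(Z :: (nat \<Rightarrow> real) manifold) (\<omega> :: real \<Rightarrow> (nat \<Rightarrow> real) form2) (N :: real \<Rightarrow> nat).
           smooth_manifold Z \<and>
           (\<forall>\<delta>\<in>{0<..1}. symplectic_form Z (\<omega> \<delta>) \<and>
              (\<exists>h. h \<in> epi (pi0_Symp Z (\<omega> \<delta>)) (free_group {..<N \<delta>}))) \<and>
           filterlim N at_top (at_right 0)"
proof -
  \<comment> \<open>The level of the congruence group is the square of \<open>N \<delta>\<close>,
    and the construction asks for a positive multiple of 4.\<close>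
  define N :: "real \<Rightarrow> nat" where "N \<delta> = 4 * nat \<lceil>1 / \<delta>\<rceil>" for \<delta>
  define \<omega> where "\<omega> \<delta> = log_form (torus_form ((int (N \<delta>))\<^sup>2))" for \<delta>
  have "smooth_manifold cstar4_manifold"
    by (rule smooth_manifold_open_manifold[OF openin_cstar4])
  moreover have "symplectic_form cstar4_manifold (\<omega> \<delta>) \<and>
      (\<exists>h. h \<in> epi (pi0_Symp cstar4_manifold (\<omega> \<delta>)) (free_group {..<N \<delta>}))" if "\<delta> \<in> {0<..1}" for \<delta>
  proof
    have "0 < 1 / \<delta>" using that by simp
    then have "0 < nat \<lceil>1 / \<delta>\<rceil>" by linarith
    then have N: "int (N \<delta>) > 0" "4 dvd int (N \<delta>)"
      unfolding N_def by (simp_all only: of_nat_mult of_nat_numeral dvd_triv_left of_nat_0_less_iff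
          zero_less_mult_iff zero_less_numeral simp_thms)
    have "(int (N \<delta>))\<^sup>2 > 0" using N by simp
    then show "symplectic_form cstar4_manifold (\<omega> \<delta>)"
      unfolding \<omega>_def by (rule symplectic_form_log_form[OF torus_form_skew torus_form_nondegenerate])
    show "\<exists>h. h \<in> epi (pi0_Symp cstar4_manifold (\<omega> \<delta>)) (free_group {..<N \<delta>})"
      using epi_pi0_Symp_free_group[OF N] unfolding \<omega>_def by simp
  qed
  moreover have "filterlim N at_top (at_right 0)"
    unfolding filterlim_at_top
  proof
    fix m :: nat
    have "\<forall>\<^sub>F \<delta> in at_right (0::real). \<delta> < 1 / (real m + 1)"
      unfolding eventually_at_right_field by (intro exI[of _ "1 / (real m + 1)"]) simp
    then show "\<forall>\<^sub>F \<delta> in at_right 0. m \<le> N \<delta>"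
      using eventually_at_right_less[of "0::real"]
    proof eventually_elim
      case (elim \<delta>)
      then have "real m \<le> 1 / \<delta>" by (simp add: field_simps)
      then have "m \<le> nat \<lceil>1 / \<delta>\<rceil>" by linarith
      then show ?case by (simp add: N_def)
    qed
  qed
  ultimately show ?thesis by blast
qed

end
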